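(* Let $\Bbbk$ be a field and let $R$ be an affine representable $\Bbbk$-algebra. Then there is an affine commutative $\Bbbk$-algebra $D$ such that $R \equiv D$ (that is, $R$ and $D$ are growth equivalent). In particular, the Gelfand-Kirillov dimension $\operatorname{GKdim} R$ is an integer.
   Context: All algebras are associative and unital (not necessarily commutative), over an arbitrary base field $\Bbbk$. A $\Bbbk$-algebra is called affine if it is finitely generated as a $\Bbbk$-algebra. A $\Bbbk$-algebra $R$ is called representable if it embeds (as a $\Bbbk$-algebra) into a matrix algebra $\operatorname{Mat}_d(C)$ over some commutative $\Bbbk$-algebra $C$. For a $\Bbbk$-algebra $S$, a finite subset $\mathscr{S} \subseteq S$ and an integer $n \ge 0$, let $\mathscr{S}^{(n)}$ denote the $\Bbbk$-subspace of $S$ generated by all products $s_1 s_2 \cdots s_m$ with $s_i \in \mathscr{S}$ and $m \le n$ (the empty product, $m=0$, being $1$). The Gelfand-Kirillov dimension of $S$ is $$\operatorname{GKdim} S = \sup_{\mathscr{S}} \limsup_{n} \log_n \dim_\Bbbk \mathscr{S}^{(n)},$$ where $\mathscr{S}$ runs over the finite subsets of $S$ and $\log_n x = \log x/\log n$. For $\Bbbk$-algebras $S$ and $T$, write $S \preceq T$ if for every finite subset $\mathscr{S} \subseteq S$ there are a finite subset $\mathscr{T} \subseteq T$ and a constant $K$ such that $\dim_\Bbbk \mathscr{S}^{(n)} \le K \dim_\Bbbk \mathscr{T}^{(n)}$ for all $n$. If $S \preceq T$ and $T \preceq S$, write $S \equiv T$ and call $S$ and $T$ growth equivalent. *)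

theory Defs
  imports
    "HOL-Algebra.Module"
    "HOL-Library.Extended_Real"
    "HOL-Library.Liminf_Limsup"
    "Jordan_Normal_Form.Missing_VectorSpace"
    "Jordan_Normal_Form.Matrix"
begin

text \<open>
  Associative unital algebras over a field, not necessarily commutative. The library locale
  \<open>algebra\<close> covers only commutative ones; the two notions are compared below.
\<close>

locale unital_algebra = vectorspace K A + alg?: ring A
  for K :: "'k ring" and A :: "('k, 'a) module" (structure) +
  assumes smult_mult_left:
      "\<lbrakk>c \<in> carrier K; x \<in> carrier A; y \<in> carrier A\<rbrakk> \<Longrightarrow> (c \<odot> x) \<otimes> y = c \<odot> (x \<otimes> y)"
    and smult_mult_right:
      "\<lbrakk>c \<in> carrier K; x \<in> carrier A; y \<in> carrier A\<rbrakk> \<Longrightarrow> x \<otimes> (c \<odot> y) = c \<odot> (x \<otimes> y)"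

lemma algebra_iff_commutative_unital_algebra:
  assumes "field K"
  shows "algebra K A \<longleftrightarrow> unital_algebra K A \<and> cring A"
proof
  assume *: "algebra K A"
  interpret C: cring A by (rule algebra.M_cring[OF *])
  interpret algebra K A by (rule *)
  interpret field K by (rule assms)
  show "unital_algebra K A \<and> cring A"
  proof
    show "unital_algebra K A"
    proof (unfold_locales, goal_cases)
      case (1 c x y)
      then show ?case by (rule smult_assoc2)
    next
      case (2 c x y)
      then show ?case
        using smult_assoc2[of c y x] by (simp add: C.m_comm)
    qed
    show "cring A" by (rule M_cring)
  qed
next
  assume *: "unital_algebra K A \<and> cring A"
  then interpret unital_algebra K A by simp
  interpret C: cring A using * by simp
  show "algebra K A"
    by unfold_locales (rule smult_mult_left)
qed

inductive_set subalgebra_generated :: "'k ring \<Rightarrow> ('k, 'a) module \<Rightarrow> 'a set \<Rightarrow> 'a set"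
  for K and A (structure) and S where
  one: "\<one> \<in> subalgebra_generated K A S"
| incl: "x \<in> S \<Longrightarrow> x \<in> subalgebra_generated K A S"
| add: "\<lbrakk>x \<in> subalgebra_generated K A S; y \<in> subalgebra_generated K A S\<rbrakk>
    \<Longrightarrow> x \<oplus> y \<in> subalgebra_generated K A S"
| mult: "\<lbrakk>x \<in> subalgebra_generated K A S; y \<in> subalgebra_generated K A S\<rbrakk>
    \<Longrightarrow> x \<otimes> y \<in> subalgebra_generated K A S"
| smult: "\<lbrakk>c \<in> carrier K; x \<in> subalgebra_generated K A S\<rbrakk>
    \<Longrightarrow> c \<odot> x \<in> subalgebra_generated K A S"

definition affine_algebra :: "'k ring \<Rightarrow> ('k, 'a) module \<Rightarrow> bool" where
  "affine_algebra K A \<longleftrightarrow>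
     (\<exists>S. finite S \<and> S \<subseteq> carrier A \<and> subalgebra_generated K A S = carrier A)"

definition mat_algebra :: "('k, 'c) module \<Rightarrow> nat \<Rightarrow> ('k, 'c mat) module" where
  "mat_algebra C d =
    \<lparr>carrier = {M. M \<in> carrier_mat d d \<and> elements_mat M \<subseteq> carrier C},
     monoid.mult = (\<lambda>M N. mat d d (\<lambda>(i, j). \<Oplus>\<^bsub>C\<^esub>l\<in>{..<d}. M $$ (i, l) \<otimes>\<^bsub>C\<^esub> N $$ (l, j))),
     one = mat d d (\<lambda>(i, j). if i = j then \<one>\<^bsub>C\<^esub> else \<zero>\<^bsub>C\<^esub>),
     zero = mat d d (\<lambda>(i, j). \<zero>\<^bsub>C\<^esub>),
     add = (\<lambda>M N. mat d d (\<lambda>(i, j). M $$ (i, j) \<oplus>\<^bsub>C\<^esub> N $$ (i, j))),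
     module.smult = (\<lambda>c M. mat d d (\<lambda>(i, j). c \<odot>\<^bsub>C\<^esub> M $$ (i, j)))\<rparr>"

text \<open>
  HOL cannot quantify existentially over types, so the carrier type of the commutative algebra
  \<open>C\<close> is a parameter. A theorem assuming \<open>representable TYPE('c) K A\<close> for a type variable
  \<open>'c\<close> applies to algebras that are representable over a commutative algebra of any type.
\<close>

definition representable :: "'c itself \<Rightarrow> 'k ring \<Rightarrow> ('k, 'a) module \<Rightarrow> bool" where
  "representable ty K A \<longleftrightarrow>
     (\<exists>(C :: ('k, 'c) module) d f. algebra K C \<and> 0 < d \<and>
        f \<in> Ring.ring_hom A (mat_algebra C d) \<and>
        (\<forall>c\<in>carrier K. \<forall>x\<in>carrier A. f (c \<odot>\<^bsub>A\<^esub> x) = c \<odot>\<^bsub>mat_algebra C d\<^esub> f x) \<and>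
        inj_on f (carrier A))"

definition word_products :: "('k, 'a) module \<Rightarrow> 'a set \<Rightarrow> nat \<Rightarrow> 'a set" where
  "word_products A S n =
     {foldr (\<lambda>x y. x \<otimes>\<^bsub>A\<^esub> y) ws \<one>\<^bsub>A\<^esub> | ws. set ws \<subseteq> S \<and> length ws \<le> n}"

definition word_space :: "'k ring \<Rightarrow> ('k, 'a) module \<Rightarrow> 'a set \<Rightarrow> nat \<Rightarrow> 'a set" where
  "word_space K A S n = LinearCombinations.module.span K A (word_products A S n)"

definition growth :: "'k ring \<Rightarrow> ('k, 'a) module \<Rightarrow> 'a set \<Rightarrow> nat \<Rightarrow> nat" where
  "growth K A S n = vectorspace.dim K (A\<lparr>carrier := word_space K A S n\<rparr>)"

text \<open>
  Since \<^term>\<open>ln (0::real) = 0\<close>, the zero algebra, all of whose growth functions vanish, gets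
  Gelfand-Kirillov dimension 0. For a nonzero algebra the arguments of the logarithm are at
  least 1; the terms with \<open>n \<le> 1\<close> do not affect the limit superior.
\<close>

definition GKdim :: "'k ring \<Rightarrow> ('k, 'a) module \<Rightarrow> ereal" where
  "GKdim K A =
     (SUP S\<in>{S. finite S \<and> S \<subseteq> carrier A}.
        limsup (\<lambda>n. ereal (log (real n) (real (growth K A S n)))))"

definition growth_le :: "'k ring \<Rightarrow> ('k, 'a) module \<Rightarrow> ('k, 'b) module \<Rightarrow> bool" where
  "growth_le K A B \<longleftrightarrow>
     (\<forall>S. finite S \<and> S \<subseteq> carrier A \<longrightarrow>
        (\<exists>T (c::real). finite T \<and> T \<subseteq> carrier B \<and>
           (\<forall>n. real (growth K A S n) \<le> c * real (growth K B T n))))"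

definition growth_equivalent :: "'k ring \<Rightarrow> ('k, 'a) module \<Rightarrow> ('k, 'b) module \<Rightarrow> bool" where
  "growth_equivalent K A B \<longleftrightarrow> growth_le K A B \<and> growth_le K B A"

text \<open>
  A fixed carrier type for affine commutative algebras over a field with carrier in \<open>'k\<close>. A
  polynomial in countably many variables is given by its coefficient function
  (\<open>nat multiset \<Rightarrow> 'k\<close>), as in \<open>HOL-Algebra.Indexed_Polynomials\<close>, and the elements of a quotient
  \<open>K[x\<^sub>1,\<dots>,x\<^sub>m]/I\<close> are sets (cosets) of polynomials. Hence every affine commutative
  algebra has an isomorphic copy whose carrier lives in this type.
\<close>

type_synonym 'k poly_coset = "(nat multiset \<Rightarrow> 'k) set"

end

theory Submission
  imports Defs "HOL-Library.List_Lexorder" "HOL-Library.Multiset_Order" "HOL-Combinatorics.Permutations"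
begin

text \<open>
The growth of a nonzero $R$ is, up to constant factors, exactly $n^m$ for an integer $m$. This gives everything
at once: the polynomial algebra in $m$ variables has the same growth, and taking logarithms shows
that the Gelfand-Kirillov dimension is $m$. No structure theory enters. A matrix algebra over a
commutative algebra is spanned by finitely many elements over a central subring, and only two
consequences of this fact are used.

The first is the standard identity (\<open>standard_identity\<close>), because an alternating multilinear expression
vanishes once it has more arguments than there are spanning elements. It rewrites a product of
generators into lexicographically smaller ones unless the word of generators avoids a certain
pattern, and Shirshov's argument shows that words without this pattern have the period $p!$ up to a
bounded number of defects (\<open>card_defects_le\<close>). Such a word has the form
$u_1^{k_1} g_1 \cdots u_h^{k_h} g_h$ with $h$ fixed and the $u_i$, $g_i$ taken from a finite set
(\<open>power_form_of_few_defects\<close>). So the space of products of length at most $n$ is a finite sum of spaces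
spanned by such power products with $\sum k_i \le n$, up to rescaling $n$.

The second is that every element is integral over the central subring (\<open>integral_over_center\<close>). Fix the
$u_i$ and $g_i$ and send the monomial $T^k$ to the power product with exponents $k$; let $I$ be the
largest ideal of $K[T_1, \dots, T_h]$ in the kernel of this linear map. The image of the
polynomials of degree at most $n$ is a quotient of their image in $K[T]/I$. Conversely, a polynomial
$P$ lies in $I$ as soon as the multiples $P T^e$ are in the kernel for all $e$ in a finite box, since the
integrality relations express all other multiples by these (\<open>relation_box\<close>); hence the image is also
not much smaller than the image in $K[T]/I$. This replaces the noncommutative problem by a commutative one
(\<open>power_product_growth\<close>). Finally, the monomials that are not leading monomials
of $I$ form an order ideal in $\mathbb{N}^h$, and the number of elements of degree at most $n$ in an
order ideal grows like $n^m$, where $m$ is the dimension of the largest coordinate orthant inside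
it (\<open>order_ideal_growth\<close>). The largest exponent among the finitely many choices of $u_i$, $g_i$ is the
growth exponent of $R$ (\<open>growth_polynomial\<close>). The zero algebra, whose growth functions vanish, is treated separately.
\<close>

section \<open>Lexicographically reducible words\<close>

definition factor_at :: "nat \<Rightarrow> nat \<Rightarrow> 'a list \<Rightarrow> 'a list" where
  "factor_at l t w = take l (drop t w)"

text \<open>
The pattern that the standard identity of degree \<open>p\<close> can rewrite: $p$ consecutive blocks starting at the
positions \<open>q 0\<close>, \dots, \<open>q (p - 1)\<close>, whose initial segments of length \<open>l\<close> decrease strictly. The
position \<open>q p\<close> marks the end of the last block.
\<close>

definition decomposable :: "nat \<Rightarrow> nat \<Rightarrow> 'a::linorder list \<Rightarrow> bool" where
  "decomposable l p w \<longleftrightarrow>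
     (\<exists>q::nat \<Rightarrow> nat. (\<forall>i<p. q i + l \<le> q (Suc i)) \<and> q p \<le> length w \<and>
        (\<forall>i j. i < j \<longrightarrow> j < p \<longrightarrow> factor_at l (q j) w < factor_at l (q i) w))"

lemma append_less_append:
  fixes u v :: "'a::linorder list"
  assumes "length u = length v" "u < v"
  shows "a @ u @ x < a @ v @ y"
proof -
  from assms have "u @ x < v @ y"
    by (induction u v rule: list_induct2) auto
  then show ?thesis by (induction a) auto
qed

text \<open>
At the first position where the permutation moves something, a later block is put in front, and its
initial segment is smaller than the one it replaces.
\<close>

lemma concat_permuted_less:
  fixes ws :: "'a::linorder list list"
  assumes len: "\<And>i. i < length ws \<Longrightarrow> l \<le> length (ws ! i)"
    and dec: "\<And>i j. i < j \<Longrightarrow> j < length ws \<Longrightarrow> take l (ws ! j) < take l (ws ! i)"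
    and \<sigma>: "\<sigma> permutes {..<length ws}" "\<sigma> \<noteq> id"
  shows "concat (map (\<lambda>i. ws ! \<sigma> i) [0..<length ws]) < concat ws"
proof -
  let ?p = "length ws"
  define i where "i = (LEAST i. \<sigma> i \<noteq> i)"
  obtain j where "\<sigma> j \<noteq> j" using \<sigma>(2) by (auto simp: fun_eq_iff)
  then have i: "\<sigma> i \<noteq> i" unfolding i_def by (rule LeastI)
  have low: "\<sigma> j = j" if "j < i" for j using that not_less_Least unfolding i_def by blast
  have ip: "i < ?p" using i \<sigma>(1) by (metis lessThan_iff permutes_not_in)
  then have sip: "\<sigma> i < ?p" using \<sigma>(1) by (metis lessThan_iff permutes_in_image)
  have "\<sigma> i > i"
  proof (rule ccontr)
    assume "\<not> \<sigma> i > i"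
    with i have "\<sigma> i < i" by simp
    with low have "\<sigma> (\<sigma> i) = \<sigma> i" by blast
    with \<sigma>(1) i show False by (metis permutes_inverses(2))
  qed
  then have lt: "take l (ws ! \<sigma> i) < take l (ws ! i)" using dec sip by simp
  have up: "[0..<?p] = [0..<i] @ i # [Suc i..<?p]"
    using upt_add_eq_append[of 0 i "?p - i"] upt_conv_Cons[OF ip] ip by simp
  have "concat ws = concat (map (\<lambda>j. ws ! j) [0..<?p])" by (simp add: map_nth)
  also have "\<dots> = concat (map (\<lambda>j. ws ! j) [0..<i]) @ take l (ws ! i) @ drop l (ws ! i)
      @ concat (map (\<lambda>j. ws ! j) [Suc i..<?p])"
    by (simp add: up)
  finally have 1: "concat ws = \<dots>" .
  have "map (\<lambda>j. ws ! \<sigma> j) [0..<i] = map (\<lambda>j. ws ! j) [0..<i]" using low by simp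
  note low_map = this
  have 2: "concat (map (\<lambda>j. ws ! \<sigma> j) [0..<?p]) = concat (map (\<lambda>j. ws ! j) [0..<i])
      @ take l (ws ! \<sigma> i) @ drop l (ws ! \<sigma> i) @ concat (map (\<lambda>j. ws ! \<sigma> j) [Suc i..<?p])"
    by (simp add: up low_map del: map_eq_conv)
  show ?thesis unfolding 1 2
    using lt len[OF ip] len[OF sip] by (intro append_less_append) auto
qed

lemma concat_factors:
  assumes "\<And>i. i < p \<Longrightarrow> q i \<le> q (Suc i)" "q p \<le> length w"
  shows "concat (map (\<lambda>i. take (q (Suc i) - q i) (drop (q i) w)) [0..<p])
           = take (q p - q 0) (drop (q 0) w) \<and> q 0 \<le> q p"
  using assms
proof (induction p)
  case (Suc p)
  have qp: "q p \<le> q (Suc p)" "q p \<le> length w" using Suc.prems(1)[of p] Suc.prems(2) by auto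
  have IH: "concat (map (\<lambda>i. take (q (Suc i) - q i) (drop (q i) w)) [0..<p])
           = take (q p - q 0) (drop (q 0) w)" "q 0 \<le> q p"
    using Suc qp by simp_all
  have "take (q (Suc p) - q 0) (drop (q 0) w)
      = take ((q p - q 0) + (q (Suc p) - q p)) (drop (q 0) w)"
    using qp IH by simp
  also have "\<dots> = take (q p - q 0) (drop (q 0) w) @ take (q (Suc p) - q p) (drop (q p) w)"
    using IH(2) by (simp only: take_add drop_drop) simp
  finally show ?case using IH qp by simp
qed simp

lemma decomposable_smaller:
  fixes w :: "'a::linorder list"
  assumes "decomposable l p w"
  obtains a ws b where "w = a @ concat ws @ b" "length ws = p"
    "\<And>\<sigma>. \<sigma> permutes {..<p} \<Longrightarrow> \<sigma> \<noteq> id \<Longrightarrow>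
        a @ concat (map (\<lambda>i. ws ! \<sigma> i) [0..<p]) @ b < w"
    "\<And>\<sigma>. \<sigma> permutes {..<p} \<Longrightarrow>
        mset (a @ concat (map (\<lambda>i. ws ! \<sigma> i) [0..<p]) @ b) = mset w"
proof -
  from assms obtain q where q: "\<And>i. i < p \<Longrightarrow> q i + l \<le> q (Suc i)" "q p \<le> length w"
    "\<And>i j. i < j \<Longrightarrow> j < p \<Longrightarrow> factor_at l (q j) w < factor_at l (q i) w"
    unfolding decomposable_def by blast
  define ws where "ws = map (\<lambda>i. take (q (Suc i) - q i) (drop (q i) w)) [0..<p]"
  have q': "q i \<le> q (Suc i)" if "i < p" for i using q(1)[OF that] by simp
  have cw: "concat ws = take (q p - q 0) (drop (q 0) w)" "q 0 \<le> q p"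
    using concat_factors[OF q' q(2)] by (auto simp: ws_def)
  have w: "w = take (q 0) w @ concat ws @ drop (q p) w"
    unfolding cw(1) using cw(2) q(2)
    by (metis append_take_drop_id drop_drop le_add_diff_inverse2)
  have lws: "length ws = p" by (simp add: ws_def)
  have mono: "q (Suc i) \<le> q p" if "i < p" for i
    using that q' by (induction p) (auto simp: less_Suc_eq intro: order.trans)
  have tl: "take l (ws ! i) = factor_at l (q i) w" if "i < p" for i
    using that q(1)[OF that] by (simp add: ws_def factor_at_def min_def)
  have len: "l \<le> length (ws ! i)" if "i < p" for i
    using that q(1)[OF that] mono[OF that] q(2) by (simp add: ws_def)
  have less: "concat (map (\<lambda>i. ws ! \<sigma> i) [0..<p]) < concat ws"
    if "\<sigma> permutes {..<p}" "\<sigma> \<noteq> id" for \<sigma>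
    using concat_permuted_less[of ws l \<sigma>] that len tl q(3) unfolding lws by auto
  have perm: "mset (concat (map (\<lambda>i. ws ! \<sigma> i) [0..<p])) = mset (concat ws)"
    if "\<sigma> permutes {..<p}" for \<sigma>
  proof -
    have "mset (map (\<lambda>i. ws ! \<sigma> i) [0..<p]) = image_mset ((!) ws) (image_mset \<sigma> (mset_set {..<p}))"
      by (simp add: multiset.map_comp comp_def atLeast0LessThan)
    also have "image_mset \<sigma> (mset_set {..<p}) = mset_set {..<p}"
      using that by (simp add: image_mset_mset_set permutes_inj_on permutes_image)
    also have "image_mset ((!) ws) (mset_set {..<p}) = mset ws"
      by (metis atLeast0LessThan lws map_nth mset_map mset_upt)
    finally have "mset (map (\<lambda>i. ws ! \<sigma> i) [0..<p]) = mset ws" .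
    moreover have "mset (concat xs) = sum_mset (image_mset mset (mset xs))" for xs :: "'a list list"
      by (induction xs) auto
    ultimately show ?thesis by metis
  qed
  have eqlen: "length (concat (map (\<lambda>i. ws ! \<sigma> i) [0..<p])) = length (concat ws)"
    if "\<sigma> permutes {..<p}" for \<sigma> using perm[OF that] by (metis size_mset)
  show thesis
  proof (rule that[OF w lws])
    fix \<sigma> assume s: "\<sigma> permutes {..<p}" "\<sigma> \<noteq> id"
    have "take (q 0) w @ concat (map (\<lambda>i. ws ! \<sigma> i) [0..<p]) @ drop (q p) w
        < take (q 0) w @ concat ws @ drop (q p) w"
      by (intro append_less_append eqlen less s)
    also note w[symmetric]
    finally show "take (q 0) w @ concat (map (\<lambda>i. ws ! \<sigma> i) [0..<p]) @ drop (q p) w < w" .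
  next
    fix \<sigma> assume s: "\<sigma> permutes {..<p}"
    have "mset (take (q 0) w @ concat (map (\<lambda>i. ws ! \<sigma> i) [0..<p]) @ drop (q p) w)
        = mset (take (q 0) w @ concat ws @ drop (q p) w)"
      using perm[OF s] by (simp only: mset_append)
    also note w[symmetric]
    finally show "mset (take (q 0) w @ concat (map (\<lambda>i. ws ! \<sigma> i) [0..<p]) @ drop (q p) w)
        = mset w" .
  qed
qed

section \<open>Irreducible words are almost periodic\<close>

text \<open>
A window of the word is rich if it contains enough distinct factors to supply one block of the pattern
of \<open>decomposable\<close> for each rank in their order. A window that is not rich repeats a factor, which forces a
period.
\<close>

definition rich :: "nat \<Rightarrow> nat \<Rightarrow> 'a list \<Rightarrow> nat \<Rightarrow> bool" where
  "rich l p w t \<longleftrightarrow> t + (l + p) \<le> length w \<and> inj_on (\<lambda>a. factor_at l (t + a) w) {..<p}"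

lemma length_factor_at: "t + l \<le> length w \<Longrightarrow> length (factor_at l t w) = l"
  by (simp add: factor_at_def)

lemma nth_factor_at: "t + l \<le> length w \<Longrightarrow> i < l \<Longrightarrow> factor_at l t w ! i = w ! (t + i)"
  by (simp add: factor_at_def)

lemma factor_at_factor_at: "a + l \<le> L \<Longrightarrow> factor_at l a (factor_at L t w) = factor_at l (t + a) w"
  by (simp add: factor_at_def drop_take min_def add.commute)

lemma set_factor_at: "set (factor_at l t w) \<subseteq> set w"
  by (auto simp: factor_at_def dest: in_set_takeD in_set_dropD)

lemma sorted_nth_gap:
  fixes ts :: "nat list"
  assumes "sorted_wrt (<) ts" "i \<le> j" "j < length ts"
  shows "ts ! i + (j - i) \<le> ts ! j"
  using assms(2,3)
proof (induction j rule: dec_induct)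
  case (step j)
  have "ts ! j < ts ! Suc j" using assms(1) step.prems sorted_wrt_nth_less by blast
  with step show ?case by simp
qed simp

text \<open>
If the same rich window occurs at \<open>p\<close> disjoint places, the largest of its factors can be taken from the first
occurrence, the second largest from the next one, and so on; this gives a decreasing sequence of
factors at increasing positions.
\<close>

lemma decomposable_if_frequent_rich_factor:
  fixes w :: "'a::linorder list"
  assumes T: "finite T" "p * (l + p) < card T" and p: "0 < p"
    and rich: "\<And>t. t \<in> T \<Longrightarrow> rich l p w t \<and> factor_at (l + p) t w = z"
  shows "decomposable l p w"
proof -
  let ?L = "l + p"
  define ts where "ts = sorted_list_of_set T"
  have lts: "length ts = card T" and sts: "sorted_wrt (<) ts" and setts: "set ts = T"
    using T(1) by (auto simp: ts_def)
  \<comment> \<open>Taking every \<open>?L\<close>-th occurrence makes the occurrences disjoint.\<close>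
  define t where "t i = ts ! (i * ?L)" for i
  have tT: "t i \<in> T" if "i \<le> p" for i
  proof -
    have "i * ?L < card T" using that T(2) by (meson le_less_trans mult_le_mono1)
    then show ?thesis using setts lts by (metis nth_mem t_def)
  qed
  have gap: "t i + ?L \<le> t (Suc i)" if "i < p" for i
  proof -
    have "Suc i * ?L < card T" using that T(2) by (meson Suc_leI le_less_trans mult_le_mono1)
    then show ?thesis using sorted_nth_gap[OF sts, of "i * ?L" "Suc i * ?L"] lts by (simp add: t_def)
  qed
  define F where "F = (\<lambda>a. factor_at l a z) ` {..<p}"
  have facz: "factor_at l (t i + a) w = factor_at l a z" if "i \<le> p" "a < p" for i a
    using rich[OF tT[OF that(1)]] that factor_at_factor_at[of a l ?L "t i" w] by simp
  have "inj_on (\<lambda>a. factor_at l a z) {..<p}"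
    using rich[OF tT[of 0]] facz[of 0] unfolding rich_def inj_on_def by simp
  then have cF: "card F = p" by (simp add: F_def card_image)
  have finF: "finite F" by (simp add: F_def)
  define vs where "vs = rev (sorted_list_of_set F)"
  have lvs: "length vs = p" and setvs: "set vs = F" using finF cF by (auto simp: vs_def)
  have dvs: "vs ! j < vs ! i" if "i < j" "j < p" for i j
  proof -
    have "sorted_wrt (\<lambda>x y. y < x) vs"
      unfolding vs_def sorted_wrt_rev using finF by simp
    then show ?thesis using that lvs sorted_wrt_nth_less by blast
  qed
  have "\<exists>a. a < p \<and> factor_at l a z = vs ! i" if "i < p" for i
    using that setvs lvs nth_mem[of i vs] unfolding F_def by auto
  then obtain ofs where ofs: "\<And>i. i < p \<Longrightarrow> ofs i < p \<and> factor_at l (ofs i) z = vs ! i" by metis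
  \<comment> \<open>The factor of rank \<open>i\<close> is taken from the \<open>i\<close>-th occurrence; the occurrence after the last one ends the last block.\<close>
  define q where "q i = (if i < p then t i + ofs i else t i)" for i
  have "q i + l \<le> q (Suc i)" if "i < p" for i
    using gap[OF that] ofs[OF that] that by (auto simp: q_def)
  moreover have "q p \<le> length w" using rich[OF tT[of p]] by (auto simp: q_def rich_def)
  moreover have "factor_at l (q j) w < factor_at l (q i) w" if "i < j" "j < p" for i j
    using that facz[of i "ofs i"] facz[of j "ofs j"] ofs[of i] ofs[of j] dvs[of i j]
    by (auto simp: q_def)
  ultimately show ?thesis unfolding decomposable_def by blast
qed

text \<open>
There are only finitely many possible windows, and a window that is rich occurs boundedly often by the
preceding lemma.
\<close>

lemma card_rich_le:
  fixes w :: "'a::linorder list"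
  assumes "\<not> decomposable l p w" "0 < p" "set w \<subseteq> S" "finite S"
  shows "card {t. rich l p w t} \<le> card S ^ (l + p) * (p * (l + p))"
proof -
  let ?L = "l + p" and ?R = "{t. rich l p w t}"
  define Z where "Z = {z. set z \<subseteq> S \<and> length z = ?L}"
  have finZ: "finite Z" and cZ: "card Z = card S ^ ?L"
    unfolding Z_def using assms(4) finite_lists_length_eq card_lists_length_eq by auto
  have finR: "finite ?R" by (rule finite_subset[of _ "{..length w}"]) (auto simp: rich_def)
  have "?R \<subseteq> (\<Union>z\<in>Z. {t \<in> ?R. factor_at ?L t w = z})"
  proof
    fix t assume t: "t \<in> ?R"
    then have "factor_at ?L t w \<in> Z"
      using assms(3) set_factor_at[of ?L t w] length_factor_at[of t ?L w] unfolding Z_def rich_def by blast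
    with t show "t \<in> (\<Union>z\<in>Z. {t \<in> ?R. factor_at ?L t w = z})" by blast
  qed
  then have "card ?R \<le> card (\<Union>z\<in>Z. {t \<in> ?R. factor_at ?L t w = z})"
    using finR finZ by (intro card_mono) auto
  also have "\<dots> \<le> (\<Sum>z\<in>Z. card {t \<in> ?R. factor_at ?L t w = z})"
    using finZ by (rule card_UN_le)
  also have "\<dots> \<le> (\<Sum>z\<in>Z. p * ?L)"
  proof (rule sum_mono)
    fix z assume "z \<in> Z"
    show "card {t \<in> ?R. factor_at ?L t w = z} \<le> p * ?L"
    proof (rule ccontr)
      assume "\<not> ?thesis"
      then have "decomposable l p w"
        using finR assms(2)
        by (intro decomposable_if_frequent_rich_factor[of "{t \<in> ?R. factor_at ?L t w = z}" p l w z]) auto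
      with assms(1) show False by simp
    qed
  qed
  finally show ?thesis by (simp add: cZ)
qed

lemma periodic_multiple:
  fixes x :: "nat \<Rightarrow> 'a"
  assumes "\<And>r. b \<le> r \<Longrightarrow> r + d \<le> e \<Longrightarrow> x r = x (r + d)" "b + n * d \<le> e"
  shows "x b = x (b + n * d)"
  using assms(2)
proof (induction n)
  case (Suc n)
  then have "x b = x (b + n * d)" by simp
  also have "\<dots> = x (b + n * d + d)" using Suc.prems by (intro assms(1)) auto
  finally show ?case by (simp add: ac_simps)
qed simp

text \<open>
Two equal factors at distance \<open>d < p\<close> mean that the word has period \<open>d\<close> on the factors. As \<open>d\<close> divides
$p!$, the letters at distance $p!$ agree, so that one period serves for all windows.
\<close>

lemma periodic_at_poor_position:
  assumes "\<not> rich l p w t" "t + (l + p) \<le> length w" "p + fact p \<le> l"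
  shows "w ! (t + p) = w ! (t + p + fact p)"
proof -
  from assms obtain a b where ab: "a < b" "b < p" "factor_at l (t + a) w = factor_at l (t + b) w"
    unfolding rich_def inj_on_def by (metis lessThan_iff linorder_neqE_nat)
  define d where "d = b - a"
  have d: "0 < d" "d \<le> p" using ab by (auto simp: d_def)
  then obtain n where n: "fact p = n * d" using dvd_fact[of d p] by (metis Suc_leI One_nat_def dvd_def mult.commute)
  have step: "w ! (t + r) = w ! (t + (r + d))" if "p \<le> r" "r + d \<le> p + fact p" for r
  proof -
    have "r - a < l" using that assms(3) ab d by linarith
    moreover have "t + a + (r - a) = t + r" "t + b + (r - a) = t + (r + d)"
      using that ab by (auto simp: d_def)
    ultimately have "factor_at l (t + a) w ! (r - a) = w ! (t + r)"
        "factor_at l (t + b) w ! (r - a) = w ! (t + (r + d))"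
      using nth_factor_at[of "t + a" l w "r - a"] nth_factor_at[of "t + b" l w "r - a"] ab assms(2) by auto
    with ab show ?thesis by simp
  qed
  have "w ! (t + p) = w ! (t + (p + n * d))"
    using periodic_multiple[of p d "p + fact p" "\<lambda>r. w ! (t + r)" n] step n by simp
  then show ?thesis by (simp add: n add.assoc)
qed

text \<open>
The number of places where the period \<open>P\<close> fails; a word splits into at most one periodic piece more than it has
defects.
\<close>

definition defects :: "nat \<Rightarrow> 'a list \<Rightarrow> nat set" where
  "defects P w = {t. t + P < length w \<and> w ! t \<noteq> w ! (t + P)}"

lemma finite_defects: "finite (defects P w)"
  by (rule finite_subset[of _ "{..length w}"]) (auto simp: defects_def)

text \<open>
Apart from a bounded number of positions at both ends of the word, a defect lies \<open>p\<close> places after the start of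
a rich window.
\<close>

lemma card_defects_le:
  fixes w :: "'a::linorder list"
  assumes "\<not> decomposable l p w" "0 < p" "set w \<subseteq> S" "finite S" "p + fact p \<le> l"
  shows "card (defects (fact p) w) \<le> card S ^ (l + p) * (p * (l + p)) + p + (l + p)"
proof -
  let ?R = "{t. rich l p w t}"
  let ?E = "{length w - (l + p)..<length w}"
  have finR: "finite ?R" by (rule finite_subset[of _ "{..length w}"]) (auto simp: rich_def)
  have "defects (fact p) w \<subseteq> ((\<lambda>t. t + p) ` ?R \<union> {..<p}) \<union> ?E"
  proof
    fix t assume t: "t \<in> defects (fact p) w"
    show "t \<in> ((\<lambda>t. t + p) ` ?R \<union> {..<p}) \<union> ?E"
    proof (rule ccontr)
      assume n: "t \<notin> ((\<lambda>t. t + p) ` ?R \<union> {..<p}) \<union> ?E"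
      then have pt: "p \<le> t" and "t < length w - (l + p)" using t by (auto simp: defects_def)
      then have "t - p + (l + p) \<le> length w" by simp
      moreover have "\<not> rich l p w (t - p)" using n pt by (auto simp: image_iff)
      ultimately have "w ! t = w ! (t + fact p)"
        using periodic_at_poor_position[of l p w "t - p"] assms(5) pt by simp
      with t show False by (simp add: defects_def)
    qed
  qed
  then have "card (defects (fact p) w) \<le> card (((\<lambda>t. t + p) ` ?R \<union> {..<p}) \<union> ?E)"
    using finR by (intro card_mono) auto
  also have "\<dots> \<le> (card ((\<lambda>t. t + p) ` ?R) + card {..<p}) + card ?E"
    by (meson add_mono card_Un_le le_refl order.trans)
  also have "\<dots> \<le> card S ^ (l + p) * (p * (l + p)) + p + (l + p)"
    using card_rich_le[OF assms(1-4)] card_image_le[OF finR, of "\<lambda>t. t + p"] by simp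
  finally show ?thesis .
qed

text \<open>
The word $u_0^{k_0} g_0 u_1^{k_1} g_1 \cdots$ for a list of pairs $(u_i, g_i)$.
\<close>

fun power_form :: "('a list \<times> 'a list) list \<Rightarrow> (nat \<Rightarrow> nat) \<Rightarrow> 'a list" where
  "power_form [] k = []"
| "power_form (ug # ps) k =
     concat (replicate (k 0) (fst ug)) @ snd ug @ power_form ps (\<lambda>i. k (Suc i))"

lemma periodic_word:
  assumes "defects P w = {}" "k * P \<le> length w"
  shows "w = concat (replicate k (take P w)) @ drop (k * P) w"
  using assms(2)
proof (induction k)
  case (Suc k)
  have per: "w ! t = w ! (t + P)" if "t + P < length w" for t
    using assms(1) that by (auto simp: defects_def)
  have "take P (drop (k * P) w) = take P w"
  proof (rule nth_equalityI)
    fix i assume "i < length (take P (drop (k * P) w))"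
    then have i: "i < P" "i + k * P < length w" using Suc.prems by auto
    have "w ! i = w ! (i + k * P)"
      using i per by (intro periodic_multiple[of i P "i + k * P"]) auto
    then show "take P (drop (k * P) w) ! i = take P w ! i"
      using i by (simp add: add.commute)
  qed (use Suc.prems in auto)
  then have d: "drop (k * P) w = take P w @ drop (Suc k * P) w"
    by (metis append_take_drop_id drop_drop mult_Suc)
  have r: "concat (replicate (Suc k) u) = concat (replicate k u) @ u" for u :: "'a list"
    by (induction k) auto
  from Suc d show ?case unfolding r by simp
qed simp

text \<open>
The part of the word up to one period after the first defect is periodic, hence a power followed by a short
remainder. The rest has one defect less.
\<close>

lemma power_form_of_few_defects:
  assumes "card (defects P w) \<le> b" "0 < P"
  shows "\<exists>ps k. length ps = Suc b \<and> w = power_form ps k \<and> sum k {..<Suc b} \<le> length w \<and>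
    (\<forall>ug\<in>set ps. length (fst ug) \<le> P \<and> length (snd ug) \<le> 2 * P
        \<and> set (fst ug) \<subseteq> set w \<and> set (snd ug) \<subseteq> set w)"
  using assms(1)
proof (induction b arbitrary: w)
  case 0
  then have nd: "defects P w = {}" by (simp add: finite_defects)
  define k where "k = length w div P"
  have "w = concat (replicate k (take P w)) @ drop (k * P) w"
    by (rule periodic_word[OF nd]) (simp add: k_def)
  moreover have "k \<le> length w" by (simp add: k_def)
  moreover have "length w mod P < P" using assms(2) by simp
  then have "length (drop (k * P) w) \<le> 2 * P"
    by (simp add: k_def minus_div_mult_eq_mod)
  ultimately show ?case
    by (intro exI[of _ "[(take P w, drop (k * P) w)]"] exI[of _ "\<lambda>_. k"])
      (auto dest: in_set_takeD in_set_dropD)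
next
  case (Suc b)
  show ?case
  proof (cases "defects P w = {}")
    case True
    then have "card (defects P w) \<le> b" by simp
    from Suc.IH[OF this] obtain ps k where IH: "length ps = Suc b" "w = power_form ps k"
      "sum k {..<Suc b} \<le> length w"
      "\<forall>ug\<in>set ps. length (fst ug) \<le> P \<and> length (snd ug) \<le> 2 * P
        \<and> set (fst ug) \<subseteq> set w \<and> set (snd ug) \<subseteq> set w" by blast
    define k' where "k' i = (case i of 0 \<Rightarrow> 0 | Suc j \<Rightarrow> k j)" for i
    have "w = power_form (([], []) # ps) k'" using IH(2) by (simp add: k'_def)
    moreover have "sum k' {..<Suc (Suc b)} = sum k {..<Suc b}"
      by (subst sum.lessThan_Suc_shift) (simp add: k'_def)
    ultimately show ?thesis using IH by (intro exI[of _ "([], []) # ps"] exI[of _ k']) auto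
  next
    case False
    define t where "t = Min (defects P w)"
    have t: "t \<in> defects P w" "\<And>s. s \<in> defects P w \<Longrightarrow> t \<le> s"
      using Min_in[OF finite_defects False] Min_le[OF finite_defects] by (auto simp: t_def)
    \<comment> \<open>The defect at \<open>t\<close> compares \<open>t\<close> with \<open>t + P\<close>; cutting there separates the two.\<close>
    define x y where "x = take (t + P) w" and "y = drop (t + P) w"
    have w: "w = x @ y" by (simp add: x_def y_def)
    have tw: "t + P < length w" using t(1) by (simp add: defects_def)
    have "defects P x = {}"
    proof (rule ccontr)
      assume "defects P x \<noteq> {}"
      then obtain s where "s \<in> defects P x" by blast
      then have "s < t" "s \<in> defects P w" using tw by (auto simp: defects_def x_def)
      with t(2) show False by (meson not_less)
    qed
    define k where "k = length x div P"
    have x: "x = concat (replicate k (take P x)) @ drop (k * P) x"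
      by (rule periodic_word[OF \<open>defects P x = {}\<close>]) (simp add: k_def)
    have kx: "k \<le> length x" by (simp add: k_def)
    have "length x mod P < P" using assms(2) by simp
    then have rest: "length (drop (k * P) x) \<le> 2 * P"
      by (simp add: k_def minus_div_mult_eq_mod)
    have "(\<lambda>s. s + (t + P)) ` defects P y \<subseteq> defects P w - {t}"
      using assms(2) by (auto simp: defects_def y_def ac_simps)
    then have "card ((\<lambda>s. s + (t + P)) ` defects P y) \<le> card (defects P w - {t})"
      by (intro card_mono) (simp_all add: finite_defects)
    then have "card (defects P y) \<le> card (defects P w - {t})"
      by (simp add: card_image)
    also have "\<dots> \<le> b" using Suc.prems t(1) by (simp add: finite_defects)
    finally obtain ps l where IH: "length ps = Suc b" "y = power_form ps l"
      "sum l {..<Suc b} \<le> length y"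
      "\<forall>ug\<in>set ps. length (fst ug) \<le> P \<and> length (snd ug) \<le> 2 * P
        \<and> set (fst ug) \<subseteq> set y \<and> set (snd ug) \<subseteq> set y" using Suc.IH by blast
    define l' where "l' i = (case i of 0 \<Rightarrow> k | Suc j \<Rightarrow> l j)" for i
    let ?ps = "(take P x, drop (k * P) x) # ps"
    have "w = power_form ?ps l'"
      using arg_cong[OF x, of "\<lambda>v. v @ y"] IH(2) by (simp add: l'_def w)
    moreover have "sum l' {..<Suc (Suc b)} \<le> length w"
      using IH(3) kx by (subst sum.lessThan_Suc_shift) (simp add: l'_def w)
    moreover have "\<forall>ug\<in>set ?ps. length (fst ug) \<le> P \<and> length (snd ug) \<le> 2 * P
        \<and> set (fst ug) \<subseteq> set w \<and> set (snd ug) \<subseteq> set w"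
    proof -
      have "set (take P x) \<subseteq> set w" "set (drop (k * P) x) \<subseteq> set w" "set y \<subseteq> set w"
        using set_take_subset[of P x] set_drop_subset[of "k * P" x] by (auto simp: w)
      moreover from this(3) have "\<forall>ug\<in>set ps. length (fst ug) \<le> P \<and> length (snd ug) \<le> 2 * P
        \<and> set (fst ug) \<subseteq> set w \<and> set (snd ug) \<subseteq> set w"
        using IH(4) by (meson subset_trans)
      ultimately show ?thesis using rest by simp
    qed
    moreover have "length ?ps = Suc (Suc b)" using IH(1) by simp
    ultimately show ?thesis by blast
  qed
qed

section \<open>Counting monomials in an order ideal\<close>

definition monomials :: "nat set \<Rightarrow> nat \<Rightarrow> nat multiset set" where
  "monomials H n = {M. set_mset M \<subseteq> H \<and> size M \<le> n}"

lemma finite_monomials: "finite H \<Longrightarrow> finite (monomials H n)"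
proof -
  assume "finite H"
  then have "finite (mset ` {xs. set xs \<subseteq> H \<and> length xs \<le> n})"
    by (intro finite_imageI finite_lists_length_le)
  moreover have "monomials H n \<subseteq> mset ` {xs. set xs \<subseteq> H \<and> length xs \<le> n}"
  proof
    fix M assume "M \<in> monomials H n"
    moreover obtain xs where "mset xs = M" using ex_mset by blast
    ultimately show "M \<in> mset ` {xs. set xs \<subseteq> H \<and> length xs \<le> n}"
      by (auto simp: monomials_def)
  qed
  ultimately show ?thesis using finite_subset by blast
qed

text \<open>
The multiset order is a total order compatible with addition. Comparing the sizes first makes all
smaller monomials have at most the same degree, which keeps reductions inside the space of polynomials of bounded degree.
\<close>

definition deglex :: "nat multiset \<Rightarrow> nat multiset \<Rightarrow> bool" where
  "deglex M M' \<longleftrightarrow> size M < size M' \<or> (size M = size M' \<and> M < M')"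

lemma deglex_irrefl: "\<not> deglex M M"
  by (simp add: deglex_def)

lemma deglex_trans: "deglex L M \<Longrightarrow> deglex M N \<Longrightarrow> deglex L N"
  by (auto simp: deglex_def)

lemma deglex_total: "deglex M N \<or> M = N \<or> deglex N M"
  by (auto simp: deglex_def)

lemma deglex_add: "deglex M N \<Longrightarrow> deglex (M + G) (N + G)"
  by (auto simp: deglex_def)

lemma deglex_size: "deglex M N \<Longrightarrow> size M \<le> size N"
  by (auto simp: deglex_def)

lemma count_sum_replicate:
  assumes "finite B"
  shows "count (\<Sum>b\<in>B. replicate_mset (f b) b) i = (if i \<in> B then f i else 0)"
  using assms by (induction B rule: finite_induct) auto

lemma size_sum_replicate:
  assumes "finite B"
  shows "size (\<Sum>b\<in>B. replicate_mset (f b) b) = sum f B"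
  using assms by (induction B rule: finite_induct) auto

text \<open>
Choosing each of the exponents independently in \<open>{0..n div card B}\<close> stays within degree \<open>n\<close>.
\<close>

lemma card_monomials_ge:
  assumes "finite B"
  shows "real n ^ card B \<le> real (card B) ^ card B * real (card (monomials B n))"
proof (cases "card B = 0")
  case True
  have "{#} \<in> monomials B n" by (simp add: monomials_def)
  then have "card (monomials B n) \<ge> 1"
    using finite_monomials[OF assms] by (metis One_nat_def Suc_leI card_gt_0_iff empty_iff)
  then show ?thesis using True by simp
next
  case False
  define m where "m = card B"
  define k where "k = n div m"
  have m: "0 < m" using False by (simp add: m_def)
  let ?F = "B \<rightarrow>\<^sub>E {..k}"
  define g where "g f = (\<Sum>b\<in>B. replicate_mset (f b) b)" for f :: "nat \<Rightarrow> nat"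
  have cnt: "count (g f) i = (if i \<in> B then f i else 0)" for f i
    unfolding g_def by (rule count_sum_replicate[OF assms])
  have "inj_on g ?F"
  proof (rule inj_onI)
    fix f f' assume f: "f \<in> ?F" "f' \<in> ?F" "g f = g f'"
    have "f i = f' i" if "i \<in> B" for i using cnt[of f i] cnt[of f' i] f(3) that by simp
    with f(1,2) show "f = f'" by (metis PiE_ext)
  qed
  moreover have "g ` ?F \<subseteq> monomials B n"
  proof
    fix M assume "M \<in> g ` ?F"
    then obtain f where f: "f \<in> ?F" "M = g f" by blast
    have "size M = (\<Sum>b\<in>B. f b)" unfolding f(2) g_def by (rule size_sum_replicate[OF assms])
    also have "\<dots> \<le> (\<Sum>b\<in>B. k)" using f(1) by (intro sum_mono) auto
    also have "\<dots> \<le> n" by (simp add: m_def[symmetric] k_def)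
    finally have "size M \<le> n" .
    moreover have "set_mset M \<subseteq> B" using cnt[of f] f(2)
      by (metis count_eq_zero_iff subsetI)
    ultimately show "M \<in> monomials B n" by (simp add: monomials_def)
  qed
  ultimately have "card ?F \<le> card (monomials B n)"
    using finite_monomials[OF assms] card_inj_on_le by blast
  moreover have "card ?F = Suc k ^ m" using assms by (simp add: card_PiE m_def)
  ultimately have "real (Suc k) ^ m \<le> real (card (monomials B n))"
    by (metis of_nat_le_iff of_nat_power)
  moreover have "n \<le> m * Suc k" using m by (simp add: k_def) (metis add.commute dividend_less_times_div less_imp_le mult.commute)
  then have "real n \<le> real m * real (Suc k)" by (metis of_nat_le_iff of_nat_mult)
  then have "real n ^ m \<le> (real m * real (Suc k)) ^ m"
    by (intro power_mono) simp_all
  ultimately show ?thesis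
    by (simp add: m_def[symmetric] power_mult_distrib) (meson mult_left_mono order.trans zero_le_power of_nat_0_le_iff)
qed

lemma card_bounded_counts_le:
  assumes "finite H" "C \<subseteq> H"
  shows "card {M. set_mset M \<subseteq> H \<and> (\<forall>i\<in>C. count M i \<le> n) \<and> (\<forall>i\<in>H - C. count M i \<le> b)}
      \<le> Suc n ^ card C * Suc b ^ card (H - C)" (is "card ?X \<le> _")
proof -
  let ?F = "Pi\<^sub>E H (\<lambda>i. if i \<in> C then {..n} else {..b})"
  let ?g = "\<lambda>M. restrict (count M) H"
  have "inj_on ?g ?X"
  proof (rule inj_onI)
    fix M M' assume M: "M \<in> ?X" "M' \<in> ?X" "?g M = ?g M'"
    show "M = M'"
    proof (rule multiset_eqI)
      fix i
      show "count M i = count M' i"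
      proof (cases "i \<in> H")
        case True
        then show ?thesis using M(3) by (metis restrict_apply')
      next
        case False
        then show ?thesis using M(1,2) by (auto simp: subset_iff) (metis count_inI)
      qed
    qed
  qed
  moreover have "?g ` ?X \<subseteq> ?F" using assms(2) by (auto simp: PiE_def Pi_def extensional_def)
  moreover have "finite ?F" using assms(1) by (intro finite_PiE) auto
  ultimately have "card ?X \<le> card ?F" using card_inj_on_le by blast
  also have "card ?F = (\<Prod>i\<in>H. if i \<in> C then Suc n else Suc b)"
    using assms(1) by (simp add: card_PiE if_distrib cong: if_cong)
  also have "\<dots> = Suc n ^ card C * Suc b ^ card (H - C)"
    using assms by (simp add: prod.If_cases Int_absorb1 Diff_eq)
  finally show ?thesis .
qed

text \<open>
The exponent is the largest size of a set \<open>B\<close> of variables such that all monomials in \<open>B\<close> belong to the order ideal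
\<open>N\<close>; counting the monomials in \<open>B\<close> gives the lower bound. For the upper bound, every larger set of
variables has a monomial outside \<open>N\<close>, so it cannot happen that all its variables have a large exponent in an element of \<open>N\<close>.
With a common bound \<open>b\<close>, each element of \<open>N\<close> has at most \<open>m\<close> exponents above \<open>b\<close>.
\<close>

lemma order_ideal_growth:
  assumes H: "finite H" and N: "{#} \<in> N" "\<And>M. M \<in> N \<Longrightarrow> set_mset M \<subseteq> H"
    and down: "\<And>M G. M + G \<in> N \<Longrightarrow> M \<in> N"
  shows "\<exists>m c1 c2. 0 < c1 \<and> (\<forall>n\<ge>1. c1 * real n ^ m \<le> real (card (N \<inter> monomials H n))
      \<and> real (card (N \<inter> monomials H n)) \<le> c2 * real n ^ m)"
proof -
  define full where "full B \<longleftrightarrow> B \<subseteq> H \<and> (\<forall>M. set_mset M \<subseteq> B \<longrightarrow> M \<in> N)" for B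
  have "full {}" using N(1) by (simp add: full_def)
  have finfull: "finite {B. full B}"
    by (rule finite_subset[of _ "Pow H"]) (use H in \<open>auto simp: full_def\<close>)
  define m where "m = Max (card ` {B. full B})"
  have "m \<in> card ` {B. full B}" unfolding m_def using \<open>full {}\<close> finfull by (intro Max_in) auto
  then obtain B where B: "full B" "card B = m" by auto
  have max: "card B \<le> m" if "full B" for B unfolding m_def using finfull that by (intro Max_ge) auto
  have finB: "finite B" using B(1) H finite_subset by (auto simp: full_def)
  have "\<forall>C. \<exists>M. C \<subseteq> H \<and> \<not> full C \<longrightarrow> set_mset M \<subseteq> C \<and> M \<notin> N"
    by (auto simp: full_def)
  then obtain W where W: "\<And>C. C \<subseteq> H \<Longrightarrow> \<not> full C \<Longrightarrow> set_mset (W C) \<subseteq> C \<and> W C \<notin> N" by metis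
  \<comment> \<open>An exponent vector that exceeds \<open>b\<close> on all of \<open>C\<close> is a multiple of the missing monomial \<open>W C\<close>.\<close>
  define b where "b = Max ((\<lambda>C. size (W C)) ` Pow H)"
  have b: "size (W C) \<le> b" if "C \<subseteq> H" for C unfolding b_def using H that by (intro Max_ge) auto
  let ?X = "\<lambda>n C. {M. set_mset M \<subseteq> H \<and> (\<forall>i\<in>C. count M i \<le> n) \<and> (\<forall>i\<in>H - C. count M i \<le> b)}"
  have finX: "finite (?X n C)" if "C \<subseteq> H" for n C
  proof -
    have "?X n C \<subseteq> monomials H (card H * (n + b))"
    proof
      fix M assume M: "M \<in> ?X n C"
      have "size M = (\<Sum>i\<in>set_mset M. count M i)" by (simp add: size_multiset_overloaded_eq)
      also have "\<dots> \<le> (\<Sum>i\<in>set_mset M. n + b)"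
        using M by (intro sum_mono) (metis (no_types, lifting) DiffI mem_Collect_eq subsetD trans_le_add1 trans_le_add2)
      also have "\<dots> \<le> card H * (n + b)" using M H by (simp add: card_mono)
      finally show "M \<in> monomials H (card H * (n + b))" using M by (simp add: monomials_def)
    qed
    then show ?thesis using finite_monomials[OF H] finite_subset by blast
  qed
  have cover: "N \<inter> monomials H n \<subseteq> (\<Union>C\<in>{C. C \<subseteq> H \<and> card C \<le> m}. ?X n C)" for n
  proof
    fix M assume M: "M \<in> N \<inter> monomials H n"
    define C where "C = {i \<in> H. b < count M i}"
    have "full C"
    proof (rule ccontr)
      assume nf: "\<not> full C"
      have CH: "C \<subseteq> H" by (auto simp: C_def)
      have "W C \<subseteq># M"
      proof (rule mset_subset_eqI)
        fix i
        show "count (W C) i \<le> count M i"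
        proof (cases "i \<in> C")
          case True
          have "count (W C) i \<le> b" using b[OF CH] count_le_size[of "W C" i] by linarith
          then show ?thesis using True by (simp add: C_def)
        next
          case False
          then show ?thesis using W[OF CH nf] by (metis count_inI le0 subsetD)
        qed
      qed
      then obtain G where "M = W C + G" using mset_subset_eq_exists_conv by blast
      with M down have "W C \<in> N" by blast
      with W[OF CH nf] show False by blast
    qed
    then have "card C \<le> m" "C \<subseteq> H" using max by (auto simp: full_def)
    moreover have "M \<in> ?X n C"
      using M count_le_size[of M] by (auto simp: monomials_def C_def intro: order.trans)
    ultimately show "M \<in> (\<Union>C\<in>{C. C \<subseteq> H \<and> card C \<le> m}. ?X n C)" by blast
  qed
  define c2 where "c2 = 2 ^ card H * 2 ^ m * Suc b ^ card H"
  have upper: "card (N \<inter> monomials H n) \<le> c2 * n ^ m" if n: "1 \<le> n" for n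
  proof -
    let ?I = "{C. C \<subseteq> H \<and> card C \<le> m}"
    have finI: "finite ?I" by (rule finite_subset[of _ "Pow H"]) (use H in auto)
    have "card (N \<inter> monomials H n) \<le> card (\<Union>C\<in>?I. ?X n C)"
      using finI finX by (intro card_mono cover) auto
    also have "\<dots> \<le> (\<Sum>C\<in>?I. card (?X n C))" using finI by (rule card_UN_le)
    also have "\<dots> \<le> (\<Sum>C\<in>?I. (2 * n) ^ m * Suc b ^ card H)"
    proof (rule sum_mono)
      fix C assume C: "C \<in> ?I"
      then have "card (?X n C) \<le> Suc n ^ card C * Suc b ^ card (H - C)"
        using card_bounded_counts_le[OF H] by blast
      also have "\<dots> \<le> (2 * n) ^ m * Suc b ^ card H"
      proof (rule mult_mono)
        have "Suc n ^ card C \<le> Suc n ^ m" using C by (intro power_increasing) auto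
        also have "\<dots> \<le> (2 * n) ^ m" using n by (intro power_mono) auto
        finally show "Suc n ^ card C \<le> (2 * n) ^ m" .
        show "Suc b ^ card (H - C) \<le> Suc b ^ card H"
          using H by (intro power_increasing card_mono) auto
      qed auto
      finally show "card (?X n C) \<le> (2 * n) ^ m * Suc b ^ card H" .
    qed
    also have "\<dots> = card ?I * ((2 * n) ^ m * Suc b ^ card H)" by simp
    also have "\<dots> \<le> 2 ^ card H * ((2 * n) ^ m * Suc b ^ card H)"
    proof (rule mult_le_mono1)
      have "card ?I \<le> card (Pow H)" using H by (intro card_mono) auto
      then show "card ?I \<le> 2 ^ card H" using H by (simp add: card_Pow)
    qed
    finally show ?thesis by (simp add: c2_def power_mult_distrib ac_simps)
  qed
  define c1 where "c1 = inverse (real m ^ m)"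
  have c1: "0 < c1" by (cases "m = 0") (auto simp: c1_def)
  have lower: "c1 * real n ^ m \<le> real (card (N \<inter> monomials H n))" for n
  proof -
    have "monomials B n \<subseteq> N \<inter> monomials H n" using B(1) by (auto simp: full_def monomials_def)
    then have "card (monomials B n) \<le> card (N \<inter> monomials H n)"
      using finite_monomials[OF H] by (intro card_mono) auto
    moreover have "real n ^ m \<le> real m ^ m * real (card (monomials B n))"
      using card_monomials_ge[OF finB] B(2) by simp
    ultimately have "real n ^ m \<le> real m ^ m * real (card (N \<inter> monomials H n))"
      by (meson mult_left_mono of_nat_le_iff order.trans zero_le_power of_nat_0_le_iff)
    moreover have "0 < real m ^ m" by (cases "m = 0") auto
    ultimately show ?thesis by (simp add: c1_def field_simps)
  qed
  show ?thesis
  proof (intro exI conjI allI impI)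
    fix n :: nat assume "1 \<le> n"
    show "c1 * real n ^ m \<le> real (card (N \<inter> monomials H n))" by (rule lower)
    show "real (card (N \<inter> monomials H n)) \<le> real c2 * real n ^ m"
      using upper[OF \<open>1 \<le> n\<close>] by (metis of_nat_le_iff of_nat_mult of_nat_power)
  qed (rule c1)
qed

section \<open>Dimensions of spans\<close>

context vectorspace
begin

abbreviation span_dim :: "'c set \<Rightarrow> nat" where
  "span_dim X \<equiv> vectorspace.dim K (vs (span X))"

lemma span_subsetI:
  assumes "X \<subseteq> span Y" "Y \<subseteq> carrier V"
  shows "span X \<subseteq> span Y"
  using assms by (intro span_is_subset span_is_submodule)

lemma span_basis:
  assumes "finite X" "X \<subseteq> carrier V"
  obtains B where "finite B" "B \<subseteq> span X" "lin_indpt B" "span B = span X"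
    "span_dim X = card B"
proof -
  have sub: "subspace K (span X) V" using assms(2) by (rule span_is_subspace)
  then have sm: "submodule K (span X) V" by simp
  interpret W: vectorspace K "vs (span X)" by (rule subspace_is_vs[OF sub])
  have spW: "W.span Y = span Y" "W.lin_dep Y = lin_dep Y" if "Y \<subseteq> span X" for Y
    using span_li_not_depend[OF that sm] by auto
  have X: "X \<subseteq> span X" using assms(2) by (rule in_own_span)
  have "W.fin_dim"
    unfolding W.fin_dim_def using X assms(1) spW(1)[OF X] by auto
  then obtain B where B: "finite B" "W.basis B" using W.finite_basis_exists by blast
  then have BX: "B \<subseteq> span X" by (simp add: W.basis_def)
  show thesis
  proof (rule that[OF B(1) BX])
    show "lin_indpt B" using B(2) spW(2)[OF BX] by (simp add: W.basis_def)
    show "span B = span X" using B(2) spW(1)[OF BX] by (simp add: W.basis_def)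
    show "W.dim = card B" by (rule W.dim_basis[OF B])
  qed
qed

lemma lin_indpt_card_le:
  assumes "finite A" "lin_indpt A" "A \<subseteq> span Y" "finite Y" "Y \<subseteq> carrier V"
  shows "card A \<le> card Y"
proof -
  have "A \<subseteq> carrier V" using assms(3,5) span_is_subset2 by blast
  with assms have "\<exists>C. finite C \<and> C \<subseteq> carrier V \<and> C \<subseteq> span Y \<and> C \<inter> A = {} \<and>
      int (card C) \<le> int (card Y) - int (card A) \<and> span (A \<union> C) = span Y"
    by (intro replacement) auto
  then show ?thesis by auto
qed

lemma dim_span_le_card:
  assumes "finite X" "X \<subseteq> span Y" "finite Y" "Y \<subseteq> carrier V"
  shows "span_dim X \<le> card Y"
proof -
  have X: "X \<subseteq> carrier V" using assms(2,4) span_is_subset2 by blast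
  obtain B where B: "finite B" "B \<subseteq> span X" "lin_indpt B"
    "span_dim X = card B" using span_basis[OF assms(1) X] by metis
  have "B \<subseteq> span Y" using B(2) span_subsetI[OF assms(2,4)] by blast
  with B assms show ?thesis using lin_indpt_card_le by metis
qed

lemma lin_indpt_card_le_dim:
  assumes "finite A" "lin_indpt A" "A \<subseteq> span X" "finite X" "X \<subseteq> carrier V"
  shows "card A \<le> span_dim X"
proof -
  obtain B where B: "finite B" "B \<subseteq> span X" "span B = span X"
    "span_dim X = card B" using span_basis[OF assms(4,5)] by metis
  have "B \<subseteq> carrier V" using B(2) assms(5) span_is_subset2 by blast
  with B assms show ?thesis using lin_indpt_card_le by metis
qed

lemma dim_span_mono:
  assumes "finite X" "X \<subseteq> span Y" "finite Y" "Y \<subseteq> carrier V"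
  shows "span_dim X \<le> span_dim Y"
proof -
  have X: "X \<subseteq> carrier V" using assms(2,4) span_is_subset2 by blast
  obtain B where B: "finite B" "B \<subseteq> span X" "lin_indpt B"
    "span_dim X = card B" using span_basis[OF assms(1) X] by metis
  have "B \<subseteq> span Y" using B(2) span_subsetI[OF assms(2,4)] by blast
  with B assms show ?thesis using lin_indpt_card_le_dim by metis
qed

end

text \<open>
Gaussian elimination, one equation at a time: either the equation is trivial, or a pivot variable is
eliminated from the others.
\<close>

lemma (in field) homogeneous_system:
  assumes "finite E" "finite I" "card E < card I"
    and "\<And>e i. e \<in> E \<Longrightarrow> i \<in> I \<Longrightarrow> a e i \<in> carrier R"
  shows "\<exists>c. c \<in> I \<rightarrow> carrier R \<and> (\<exists>i\<in>I. c i \<noteq> \<zero>) \<and> (\<forall>e\<in>E. (\<Oplus>i\<in>I. a e i \<otimes> c i) = \<zero>)"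
  using assms
proof (induction "card E" arbitrary: E I a)
  case 0
  then obtain i where "i \<in> I" by fastforce
  with 0 show ?case by (intro exI[of _ "\<lambda>_. \<one>"]) auto
next
  case (Suc k)
  then obtain e where e: "e \<in> E" by fastforce
  have cE: "card (E - {e}) = k" using Suc e by simp
  show ?case
  proof (cases "\<exists>i\<in>I. a e i \<noteq> \<zero>")
    case False
    have "k < card I" using Suc by simp
    with Suc.hyps(1)[of "E - {e}" I a] Suc.prems cE obtain c where
      c: "c \<in> I \<rightarrow> carrier R" "\<exists>i\<in>I. c i \<noteq> \<zero>" "\<forall>e\<in>E - {e}. (\<Oplus>i\<in>I. a e i \<otimes> c i) = \<zero>" by auto
    have "(\<Oplus>i\<in>I. a e i \<otimes> c i) = (\<Oplus>i\<in>I. \<zero>)"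
      using False c(1) by (intro finsum_cong') (auto simp: Pi_iff)
    with c show ?thesis by (intro exI[of _ c]) auto
  next
    case True
    then obtain j where j: "j \<in> I" "a e j \<noteq> \<zero>" by blast
    define J where "J = I - {j}"
    define v where "v = inv (a e j)"
    have aj: "a e j \<in> Units R" using j Suc.prems(4)[OF e j(1)] field_Units by blast
    then have v: "v \<in> carrier R" "a e j \<otimes> v = \<one>" by (auto simp: v_def)
    have J: "finite J" "card J = card I - 1" "j \<notin> J" "I = insert j J"
      using Suc.prems(2) j by (auto simp: J_def)
    define b where "b f i = a f i \<ominus> (a f j \<otimes> v) \<otimes> a e i" for f i
    have car: "a f i \<in> carrier R" if "f \<in> E" "i \<in> I" for f i using that Suc.prems(4) by blast
    have bcar: "b f i \<in> carrier R" if "f \<in> E - {e}" "i \<in> J" for f i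
      using that car[of f i] car[of f j] car[OF e, of i] v(1) j(1) by (auto simp: b_def J(4))
    obtain c where c: "c \<in> J \<rightarrow> carrier R" "\<exists>i\<in>J. c i \<noteq> \<zero>"
        "\<forall>f\<in>E - {e}. (\<Oplus>i\<in>J. b f i \<otimes> c i) = \<zero>"
    proof -
      have "card (E - {e}) < card J" using cE Suc.prems(3) Suc.hyps(2) J(2) by simp
      with Suc.hyps(1)[of "E - {e}" J b] cE Suc.prems(1) J(1) bcar that show thesis by blast
    qed
    define s where "s f = (\<Oplus>i\<in>J. a f i \<otimes> c i)" for f
    have scar: "s f \<in> carrier R" if "f \<in> E" for f
      unfolding s_def using c(1) car[OF that] J(4) by (intro finsum_closed) auto
    define d where "d i = (if i = j then \<ominus> (v \<otimes> s e) else c i)" for i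
    have dcar: "d \<in> I \<rightarrow> carrier R" using c(1) v(1) scar[OF e] J(4) by (auto simp: d_def)
    have sum_d: "(\<Oplus>i\<in>I. a f i \<otimes> d i) = a f j \<otimes> d j \<oplus> s f" if f: "f \<in> E" for f
    proof -
      have "(\<Oplus>i\<in>I. a f i \<otimes> d i) = a f j \<otimes> d j \<oplus> (\<Oplus>i\<in>J. a f i \<otimes> d i)"
        unfolding J(4) using J(1,3) car[OF f] dcar J(4) by (intro finsum_insert) auto
      also have "(\<Oplus>i\<in>J. a f i \<otimes> d i) = s f"
        unfolding s_def using J(3,4) car[OF f] c(1) by (intro finsum_cong') (auto simp: d_def)
      finally show ?thesis .
    qed
    have sol: "(\<Oplus>i\<in>I. a f i \<otimes> d i) = \<zero>" if f: "f \<in> E" for f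
    proof (cases "f = e")
      case True
      have "a e j \<otimes> \<ominus> (v \<otimes> s e) = \<ominus> ((a e j \<otimes> v) \<otimes> s e)"
        using car[OF e j(1)] v(1) scar[OF e] by (simp add: r_minus m_assoc)
      then show ?thesis using sum_d[OF f] True v scar[OF e] by (simp add: d_def l_neg)
    next
      case False
      then have f': "f \<in> E - {e}" using f by simp
      have m: "a f j \<otimes> v \<in> carrier R" using car[OF f j(1)] v(1) by simp
      have "\<zero> = (\<Oplus>i\<in>J. b f i \<otimes> c i)" using c(3) f' by simp
      also have "\<dots> = (\<Oplus>i\<in>J. a f i \<otimes> c i \<oplus> \<ominus> (a f j \<otimes> v) \<otimes> (a e i \<otimes> c i))"
      proof (intro finsum_cong')
        fix i assume i: "i \<in> J"
        have "a f i \<in> carrier R" "a e i \<in> carrier R" "c i \<in> carrier R"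
          using i c(1) car[OF f] car[OF e] J(4) by auto
        with m show "b f i \<otimes> c i = a f i \<otimes> c i \<oplus> \<ominus> (a f j \<otimes> v) \<otimes> (a e i \<otimes> c i)"
          unfolding b_def by algebra
      qed (use c(1) car[OF f] car[OF e] J(4) m in \<open>auto simp: Pi_iff\<close>)
      also have "\<dots> = s f \<oplus> (\<Oplus>i\<in>J. \<ominus> (a f j \<otimes> v) \<otimes> (a e i \<otimes> c i))"
        unfolding s_def using c(1) car[OF f] car[OF e] J(4) m by (intro finsum_addf) (auto simp: Pi_iff)
      also have "(\<Oplus>i\<in>J. \<ominus> (a f j \<otimes> v) \<otimes> (a e i \<otimes> c i)) = \<ominus> (a f j \<otimes> v) \<otimes> s e"
        unfolding s_def using c(1) car[OF e] J(1,4) m by (intro finsum_rdistr[symmetric]) (auto simp: Pi_iff)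
      finally have 0: "\<zero> = s f \<oplus> \<ominus> (a f j \<otimes> v) \<otimes> s e" .
      have "a f j \<otimes> d j \<oplus> s f = s f \<oplus> \<ominus> (a f j \<otimes> v) \<otimes> s e"
        using scar[OF f] scar[OF e] v(1) car[OF f j(1)] unfolding d_def by simp algebra
      then show ?thesis using sum_d[OF f] 0 by simp
    qed
    have "\<exists>i\<in>I. d i \<noteq> \<zero>" using c(2) J(3,4) by (auto simp: d_def)
    with dcar sol show ?thesis by blast
  qed
qed

context vectorspace
begin

lemma in_span_imp_lincomb_family:
  assumes "finite B" "B \<subseteq> carrier V" "v \<in> span B"
  obtains a where "a \<in> B \<rightarrow> carrier K" "v = (\<Oplus>\<^bsub>V\<^esub>b\<in>B. a b \<odot>\<^bsub>V\<^esub> b)"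
  using finite_in_span[OF assms] unfolding lincomb_def by metis

text \<open>
A linear relation that holds for several families of vectors at once is a solution of a homogeneous system with one
equation for each family and each basis vector. This plays the role of a dimension count in a direct power of
the space.
\<close>

lemma common_linear_relation:
  assumes I: "finite I" and G: "finite G" and X: "finite X" "X \<subseteq> carrier V"
    and x: "\<And>i g. i \<in> I \<Longrightarrow> g \<in> G \<Longrightarrow> x i g \<in> span X"
    and card: "card G * span_dim X < card I"
  shows "\<exists>c. c \<in> I \<rightarrow> carrier K \<and> (\<exists>i\<in>I. c i \<noteq> \<zero>\<^bsub>K\<^esub>) \<and>
    (\<forall>g\<in>G. (\<Oplus>\<^bsub>V\<^esub>i\<in>I. c i \<odot>\<^bsub>V\<^esub> x i g) = \<zero>\<^bsub>V\<^esub>)"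
proof -
  obtain B where B: "finite B" "B \<subseteq> span X" "span B = span X"
    "span_dim X = card B" using span_basis[OF X] by metis
  have BV: "B \<subseteq> carrier V" using B(2) X(2) span_is_subset2 by blast
  have "\<exists>a. a \<in> B \<rightarrow> carrier K \<and> x i g = (\<Oplus>\<^bsub>V\<^esub>b\<in>B. a b \<odot>\<^bsub>V\<^esub> b)" if "i \<in> I" "g \<in> G" for i g
    using in_span_imp_lincomb_family[OF B(1) BV] x[OF that] B(3) by metis
  then obtain a where a: "\<And>i g. i \<in> I \<Longrightarrow> g \<in> G \<Longrightarrow> a i g \<in> B \<rightarrow> carrier K"
    "\<And>i g. i \<in> I \<Longrightarrow> g \<in> G \<Longrightarrow> x i g = (\<Oplus>\<^bsub>V\<^esub>b\<in>B. a i g b \<odot>\<^bsub>V\<^esub> b)" by metis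
  have "finite (G \<times> B)" "card (G \<times> B) < card I"
    using G B card by (auto simp: card_cartesian_product)
  moreover have "a i (fst e) (snd e) \<in> carrier K" if "e \<in> G \<times> B" "i \<in> I" for e i
    using that a(1)[of i "fst e"] by auto
  ultimately obtain c where c: "c \<in> I \<rightarrow> carrier K" "\<exists>i\<in>I. c i \<noteq> \<zero>\<^bsub>K\<^esub>"
    and sol: "\<forall>e\<in>G \<times> B. (\<Oplus>\<^bsub>K\<^esub>i\<in>I. a i (fst e) (snd e) \<otimes>\<^bsub>K\<^esub> c i) = \<zero>\<^bsub>K\<^esub>"
    using field.homogeneous_system[of "G \<times> B" I "\<lambda>e i. a i (fst e) (snd e)"] I by blast
  have "(\<Oplus>\<^bsub>V\<^esub>i\<in>I. c i \<odot>\<^bsub>V\<^esub> x i g) = \<zero>\<^bsub>V\<^esub>" if g: "g \<in> G" for g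
  proof -
    have car: "a i g b \<in> carrier K" "c i \<in> carrier K" "b \<in> carrier V" if "i \<in> I" "b \<in> B" for i b
      using a(1) c(1) BV that g by auto
    have "(\<Oplus>\<^bsub>V\<^esub>i\<in>I. c i \<odot>\<^bsub>V\<^esub> x i g) = (\<Oplus>\<^bsub>V\<^esub>i\<in>I. \<Oplus>\<^bsub>V\<^esub>b\<in>B. (a i g b \<otimes>\<^bsub>K\<^esub> c i) \<odot>\<^bsub>V\<^esub> b)"
    proof (intro finsum_cong')
      fix i assume i: "i \<in> I"
      have "c i \<odot>\<^bsub>V\<^esub> x i g = (\<Oplus>\<^bsub>V\<^esub>b\<in>B. c i \<odot>\<^bsub>V\<^esub> (a i g b \<odot>\<^bsub>V\<^esub> b))"
        unfolding a(2)[OF i g] using B(1) c(1) i car by (intro finsum_smult) (auto simp: Pi_iff)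
      also have "\<dots> = (\<Oplus>\<^bsub>V\<^esub>b\<in>B. (a i g b \<otimes>\<^bsub>K\<^esub> c i) \<odot>\<^bsub>V\<^esub> b)"
        using i car by (intro finsum_cong') (auto simp: smult_assoc1[symmetric] R.m_comm)
      finally show "c i \<odot>\<^bsub>V\<^esub> x i g = (\<Oplus>\<^bsub>V\<^esub>b\<in>B. (a i g b \<otimes>\<^bsub>K\<^esub> c i) \<odot>\<^bsub>V\<^esub> b)" .
    qed (use car in \<open>auto intro!: finsum_closed\<close>)
    also have "\<dots> = (\<Oplus>\<^bsub>V\<^esub>b\<in>B. \<Oplus>\<^bsub>V\<^esub>i\<in>I. (a i g b \<otimes>\<^bsub>K\<^esub> c i) \<odot>\<^bsub>V\<^esub> b)"
      using I B(1) car by (intro M.add.finprod_finprod_swap) auto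
    also have "\<dots> = (\<Oplus>\<^bsub>V\<^esub>b\<in>B. \<zero>\<^bsub>V\<^esub>)"
    proof (intro finsum_cong')
      fix b assume b: "b \<in> B"
      have "(\<Oplus>\<^bsub>V\<^esub>i\<in>I. (a i g b \<otimes>\<^bsub>K\<^esub> c i) \<odot>\<^bsub>V\<^esub> b) = (\<Oplus>\<^bsub>K\<^esub>i\<in>I. a i g b \<otimes>\<^bsub>K\<^esub> c i) \<odot>\<^bsub>V\<^esub> b"
        using b car I BV by (intro finsum_smult_r[symmetric]) auto
      also have "\<dots> = \<zero>\<^bsub>V\<^esub>" using bspec[OF sol, of "(g, b)"] g b BV by auto
      finally show "(\<Oplus>\<^bsub>V\<^esub>i\<in>I. (a i g b \<otimes>\<^bsub>K\<^esub> c i) \<odot>\<^bsub>V\<^esub> b) = \<zero>\<^bsub>V\<^esub>" .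
    qed auto
    finally show ?thesis by simp
  qed
  with c show ?thesis by blast
qed

end

section \<open>The standard identity\<close>

text \<open>
The linear combinations of elements of \<open>E\<close> with coefficients in \<open>Z\<close>, built one term at a time. Statements about all of them
follow by induction.
\<close>

inductive_set zspan :: "('a, 'b) ring_scheme \<Rightarrow> 'a set \<Rightarrow> 'a set \<Rightarrow> 'a set"
  for A (structure) and Z E where
  zero: "\<zero> \<in> zspan A Z E"
| step: "z \<in> Z \<Longrightarrow> e \<in> E \<Longrightarrow> x \<in> zspan A Z E \<Longrightarrow> (z \<otimes> e) \<oplus> x \<in> zspan A Z E"

locale central_subring = ring A for A (structure) +
  fixes Z :: "'a set"
  assumes Z_carrier: "Z \<subseteq> carrier A"
    and central: "z \<in> Z \<Longrightarrow> a \<in> carrier A \<Longrightarrow> z \<otimes> a = a \<otimes> z"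
    and Z_one: "\<one> \<in> Z"
    and Z_add: "z \<in> Z \<Longrightarrow> z' \<in> Z \<Longrightarrow> z \<oplus> z' \<in> Z"
    and Z_mult: "z \<in> Z \<Longrightarrow> z' \<in> Z \<Longrightarrow> z \<otimes> z' \<in> Z"
    and Z_minus: "z \<in> Z \<Longrightarrow> \<ominus> z \<in> Z"
begin

lemma Z_closed [simp]: "z \<in> Z \<Longrightarrow> z \<in> carrier A"
  using Z_carrier by blast

lemma Z_zero: "\<zero> \<in> Z"
  using Z_add[OF Z_one Z_minus[OF Z_one]] by (simp add: r_neg)

lemma zspan_closed: "x \<in> zspan A Z E \<Longrightarrow> E \<subseteq> carrier A \<Longrightarrow> x \<in> carrier A"
  by (induction rule: zspan.induct) auto

lemma zspan_mono:
  assumes "x \<in> zspan A Z E" "E \<subseteq> F"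
  shows "x \<in> zspan A Z F"
  using assms by (induction rule: zspan.induct) (auto intro: zspan.intros)

lemma zspan_add:
  assumes "x \<in> zspan A Z E" "y \<in> zspan A Z E" "E \<subseteq> carrier A"
  shows "x \<oplus> y \<in> zspan A Z E"
  using assms(1)
proof (induction rule: zspan.induct)
  case zero
  then show ?case using assms zspan_closed by simp
next
  case (step z e x)
  have "(z \<otimes> e) \<oplus> x \<oplus> y = (z \<otimes> e) \<oplus> (x \<oplus> y)"
    using step assms zspan_closed by (intro a_assoc) auto
  with step show ?case by (simp add: zspan.step)
qed

lemma zspan_smult:
  assumes "z \<in> Z" "x \<in> zspan A Z E" "E \<subseteq> carrier A"
  shows "z \<otimes> x \<in> zspan A Z E"
  using assms(2)
proof (induction rule: zspan.induct)
  case zero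
  then show ?case using assms(1) by (simp add: zspan.zero)
next
  case (step z' e x)
  have "z \<otimes> ((z' \<otimes> e) \<oplus> x) = ((z \<otimes> z') \<otimes> e) \<oplus> (z \<otimes> x)"
    using step assms zspan_closed[OF step(3)] by (auto simp: r_distr m_assoc)
  with step assms(1) show ?case by (simp add: zspan.step Z_mult)
qed

lemma zspan_uminus:
  assumes "x \<in> zspan A Z E" "E \<subseteq> carrier A"
  shows "\<ominus> x \<in> zspan A Z E"
  using zspan_smult[OF Z_minus[OF Z_one] assms] zspan_closed[OF assms] by (simp add: l_minus)

lemma zspan_incl:
  assumes "e \<in> E" "E \<subseteq> carrier A"
  shows "e \<in> zspan A Z E"
proof -
  have "\<one> \<otimes> e \<oplus> \<zero> \<in> zspan A Z E" by (intro zspan.intros Z_one assms(1))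
  with assms show ?thesis by auto
qed

text \<open>
A map that is linear over \<open>Z\<close> is controlled by its values on the spanning set. With \<open>W = {}\<close> this says that a map vanishing on
the spanning set vanishes on the span.
\<close>

lemma zspan_linear:
  assumes "x \<in> zspan A Z E" "E \<subseteq> carrier A" "W \<subseteq> carrier A"
    and "\<psi> \<zero> \<in> zspan A Z W" "\<And>e. e \<in> E \<Longrightarrow> \<psi> e \<in> zspan A Z W"
    and "\<And>z x y. z \<in> Z \<Longrightarrow> x \<in> carrier A \<Longrightarrow> y \<in> carrier A \<Longrightarrow> \<psi> (z \<otimes> x \<oplus> y) = z \<otimes> \<psi> x \<oplus> \<psi> y"
  shows "\<psi> x \<in> zspan A Z W"
  using assms(1)
proof (induction rule: zspan.induct)
  case (step z e x)
  have "\<psi> (z \<otimes> e \<oplus> x) = z \<otimes> \<psi> e \<oplus> \<psi> x"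
    using step assms(2) zspan_closed[OF step(3) assms(2)] by (intro assms(6)) auto
  then show ?case using step assms by (simp add: zspan_add zspan_smult)
qed (rule assms(4))

lemma zspan_mult:
  assumes "x \<in> zspan A Z E" "y \<in> zspan A Z F" "E \<subseteq> carrier A" "F \<subseteq> carrier A"
  shows "x \<otimes> y \<in> zspan A Z {e \<otimes> f | e f. e \<in> E \<and> f \<in> F}"
proof -
  let ?W = "{e \<otimes> f | e f. e \<in> E \<and> f \<in> F}"
  have W: "?W \<subseteq> carrier A" using assms by auto
  have y: "y \<in> carrier A" using assms zspan_closed by blast
  have ey: "e \<otimes> y \<in> zspan A Z ?W" if e: "e \<in> E" for e
  proof (rule zspan_linear[OF assms(2,4) W, of "\<lambda>y. e \<otimes> y"])
    have ec: "e \<in> carrier A" using e assms by auto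
    then show "e \<otimes> \<zero> \<in> zspan A Z ?W" by (simp add: zspan.zero)
    show "e \<otimes> f \<in> zspan A Z ?W" if "f \<in> F" for f
      using W e that by (intro zspan_incl) auto
    fix z x y assume *: "z \<in> Z" "x \<in> carrier A" "y \<in> carrier A"
    then show "e \<otimes> (z \<otimes> x \<oplus> y) = z \<otimes> (e \<otimes> x) \<oplus> e \<otimes> y"
      using ec central[OF *(1) ec] by (simp add: r_distr m_assoc[symmetric])
  qed
  show ?thesis
  proof (rule zspan_linear[OF assms(1,3) W, of "\<lambda>x. x \<otimes> y"])
    show "\<zero> \<otimes> y \<in> zspan A Z ?W" using y by (simp add: zspan.zero)
    fix z x v assume *: "z \<in> Z" "x \<in> carrier A" "v \<in> carrier A"
    then show "(z \<otimes> x \<oplus> v) \<otimes> y = z \<otimes> (x \<otimes> y) \<oplus> v \<otimes> y"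
      using y by (simp add: l_distr m_assoc)
  qed (rule ey)
qed

lemma zspan_coordinates:
  fixes n :: nat
  assumes "x \<in> zspan A Z (e ` {..<n})" "e \<in> {..<n} \<rightarrow> carrier A"
  shows "\<exists>c. c \<in> {..<n} \<rightarrow> Z \<and> x = (\<Oplus>j\<in>{..<n}. c j \<otimes> e j)"
  using assms(1)
proof (induction rule: zspan.induct)
  case zero
  have "(\<Oplus>j\<in>{..<n}. \<zero> \<otimes> e j) = (\<Oplus>j\<in>{..<n}. \<zero>)"
    using assms(2) by (intro finsum_cong') (auto simp: Pi_iff)
  then show ?case using Z_zero by (intro exI[of _ "\<lambda>_. \<zero>"]) auto
next
  case (step z v x)
  then obtain k c where k: "k < n" "v = e k" and c: "c \<in> {..<n} \<rightarrow> Z"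
    "x = (\<Oplus>j\<in>{..<n}. c j \<otimes> e j)" by auto
  let ?d = "\<lambda>j. (if j = k then z else \<zero>)"
  have d: "?d \<in> {..<n} \<rightarrow> Z" using step Z_zero by auto
  have "(\<Oplus>j\<in>{..<n}. ?d j \<otimes> e j) = (\<Oplus>j\<in>{..<n}. if k = j then z \<otimes> e j else \<zero>)"
    using assms(2) step(1) by (intro finsum_cong') (auto simp: Pi_iff)
  also have "\<dots> = z \<otimes> e k"
    using assms(2) step(1) k by (intro add.finprod_singleton) (auto simp: Pi_iff)
  finally have "z \<otimes> v \<oplus> x = (\<Oplus>j\<in>{..<n}. ?d j \<otimes> e j) \<oplus> (\<Oplus>j\<in>{..<n}. c j \<otimes> e j)"
    using k c by simp
  also have "\<dots> = (\<Oplus>j\<in>{..<n}. ?d j \<otimes> e j \<oplus> c j \<otimes> e j)"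
    using c d assms(2) by (intro finsum_addf[symmetric]) (auto simp: Pi_iff)
  also have "\<dots> = (\<Oplus>j\<in>{..<n}. (?d j \<oplus> c j) \<otimes> e j)"
    using c d assms(2) by (intro finsum_cong') (auto simp: Pi_iff l_distr simp del: if_splits)
  finally have "z \<otimes> v \<oplus> x = (\<Oplus>j\<in>{..<n}. (?d j \<oplus> c j) \<otimes> e j)" .
  moreover have "(\<lambda>j. ?d j \<oplus> c j) \<in> {..<n} \<rightarrow> Z"
    by (rule Pi_I) (intro Z_add Pi_mem[OF d] Pi_mem[OF c(1)])
  ultimately show ?case by blast
qed

end

definition list_prod :: "('a, 'b) monoid_scheme \<Rightarrow> 'a list \<Rightarrow> 'a" where
  "list_prod A ws = foldr (\<lambda>x y. x \<otimes>\<^bsub>A\<^esub> y) ws \<one>\<^bsub>A\<^esub>"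

lemma list_prod_simps [simp]:
  "list_prod A [] = \<one>\<^bsub>A\<^esub>" "list_prod A (x # ws) = x \<otimes>\<^bsub>A\<^esub> list_prod A ws"
  by (simp_all add: list_prod_def)

context ring
begin

lemma list_prod_closed [simp]: "set ws \<subseteq> carrier R \<Longrightarrow> list_prod R ws \<in> carrier R"
  by (induction ws) auto

lemma list_prod_append:
  "set ws \<subseteq> carrier R \<Longrightarrow> set vs \<subseteq> carrier R \<Longrightarrow>
     list_prod R (ws @ vs) = list_prod R ws \<otimes> list_prod R vs"
  by (induction ws) (auto simp: m_assoc)

lemma list_prod_concat:
  "\<forall>ws\<in>set wss. set ws \<subseteq> carrier R \<Longrightarrow>
     list_prod R (concat wss) = list_prod R (map (list_prod R) wss)"
  by (induction wss) (auto simp: list_prod_append UN_subset_iff)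

definition standard_poly :: "nat \<Rightarrow> (nat \<Rightarrow> 'a) \<Rightarrow> 'a" where
  "standard_poly p g = (\<Oplus>\<sigma>\<in>{\<sigma>. \<sigma> permutes {..<p}}.
     if evenperm \<sigma> then list_prod R (map (\<lambda>i. g (\<sigma> i)) [0..<p])
     else \<ominus> list_prod R (map (\<lambda>i. g (\<sigma> i)) [0..<p]))"

lemma finite_perms: "finite {\<sigma>. \<sigma> permutes {..<p::nat}}"
  by (simp add: finite_permutations)

text \<open>
Composition with the transposition of the two equal arguments pairs each even permutation with an odd one whose
product is the same.
\<close>

lemma standard_poly_alternating:
  assumes g: "g \<in> {..<p} \<rightarrow> carrier R" and ij: "i < p" "j < p" "i \<noteq> j" "g i = g j"
  shows "standard_poly p g = \<zero>"
proof -
  define f where "f \<sigma> = list_prod R (map (\<lambda>i. g (\<sigma> i)) [0..<p])" for \<sigma>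
  let ?t = "transpose i j"
  let ?E = "{\<sigma>. \<sigma> permutes {..<p} \<and> evenperm \<sigma>}" and ?O = "{\<sigma>. \<sigma> permutes {..<p} \<and> \<not> evenperm \<sigma>}"
  have t: "?t permutes {..<p}" using ij by (intro permutes_swap_id) auto
  have fcl: "f \<sigma> \<in> carrier R" if "\<sigma> permutes {..<p}" for \<sigma>
  proof -
    have "\<sigma> k < p" if "k < p" for k using permutes_in_image[OF \<open>\<sigma> permutes {..<p}\<close>, of k] that by simp
    then show ?thesis unfolding f_def using g by (intro list_prod_closed) (auto simp: Pi_iff)
  qed
  have ft: "f (?t \<circ> \<sigma>) = f \<sigma>" for \<sigma>
  proof -
    have "g (?t k) = g k" for k using ij(4) by (auto simp: transpose_def)
    then show ?thesis by (simp add: f_def)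
  qed
  have even_t: "evenperm (?t \<circ> \<sigma>) \<longleftrightarrow> \<not> evenperm \<sigma>" if "\<sigma> permutes {..<p}" for \<sigma>
    using that ij(3) by (subst evenperm_comp)
      (auto simp: evenperm_swap permutation_swap_id permutes_imp_permutation[OF finite_lessThan])
  have inj: "inj_on ((\<circ>) ?t) ?E" by (rule inj_onI) (metis comp_assoc id_comp transpose_comp_involutory)
  have img: "((\<circ>) ?t) ` ?E = ?O"
  proof
    show "((\<circ>) ?t) ` ?E \<subseteq> ?O" using even_t permutes_compose[OF _ t] by auto
    show "?O \<subseteq> ((\<circ>) ?t) ` ?E"
    proof
      fix \<sigma> assume s: "\<sigma> \<in> ?O"
      then have "?t \<circ> \<sigma> \<in> ?E" using even_t permutes_compose[OF _ t] by auto
      moreover have "\<sigma> = ?t \<circ> (?t \<circ> \<sigma>)" by (simp add: fun_eq_iff)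
      ultimately show "\<sigma> \<in> ((\<circ>) ?t) ` ?E" by blast
    qed
  qed
  have fin: "finite ?E" "finite ?O" using finite_perms by auto
  have "standard_poly p g = (\<Oplus>\<sigma>\<in>?E \<union> ?O. if evenperm \<sigma> then f \<sigma> else \<ominus> f \<sigma>)"
    unfolding standard_poly_def f_def by (rule arg_cong[where f = "finsum R _"]) auto
  also have "\<dots> = (\<Oplus>\<sigma>\<in>?E. if evenperm \<sigma> then f \<sigma> else \<ominus> f \<sigma>)
      \<oplus> (\<Oplus>\<sigma>\<in>?O. if evenperm \<sigma> then f \<sigma> else \<ominus> f \<sigma>)"
    using fin fcl by (intro finsum_Un_disjoint) auto
  also have "(\<Oplus>\<sigma>\<in>?E. if evenperm \<sigma> then f \<sigma> else \<ominus> f \<sigma>) = (\<Oplus>\<sigma>\<in>?E. f \<sigma>)"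
    using fcl by (intro finsum_cong') auto
  also have "(\<Oplus>\<sigma>\<in>?O. if evenperm \<sigma> then f \<sigma> else \<ominus> f \<sigma>) = (\<Oplus>\<sigma>\<in>?O. \<ominus> f \<sigma>)"
    using fcl by (intro finsum_cong') auto
  also have "\<dots> = (\<Oplus>\<sigma>\<in>?E. \<ominus> f (?t \<circ> \<sigma>))"
    unfolding img[symmetric] using fcl inj permutes_compose[OF _ t] by (intro finsum_reindex) auto
  also have "(\<Oplus>\<sigma>\<in>?E. f \<sigma>) \<oplus> (\<Oplus>\<sigma>\<in>?E. \<ominus> f (?t \<circ> \<sigma>)) = (\<Oplus>\<sigma>\<in>?E. f \<sigma> \<oplus> \<ominus> f (?t \<circ> \<sigma>))"
    using fcl ft by (intro finsum_addf[symmetric]) auto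
  also have "\<dots> = (\<Oplus>\<sigma>\<in>?E. \<zero>)"
    using fcl ft by (intro finsum_cong') (auto simp: r_neg)
  finally show ?thesis by simp
qed

end

context central_subring
begin

lemma standard_poly_slot_linear:
  assumes g: "g \<in> {..<p} \<rightarrow> carrier A" and k: "k < p"
    and z: "z \<in> Z" and x: "x \<in> carrier A" and y: "y \<in> carrier A"
  shows "standard_poly p (g(k := z \<otimes> x \<oplus> y))
    = z \<otimes> standard_poly p (g(k := x)) \<oplus> standard_poly p (g(k := y))"
proof -
  let ?P = "{\<sigma>. \<sigma> permutes {..<p}}"
  define f where "f \<sigma> v = (if evenperm \<sigma> then list_prod A (map (\<lambda>i. (g(k := v)) (\<sigma> i)) [0..<p])
     else \<ominus> list_prod A (map (\<lambda>i. (g(k := v)) (\<sigma> i)) [0..<p]))" for \<sigma> v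
  have std: "standard_poly p (g(k := v)) = (\<Oplus>\<sigma>\<in>?P. f \<sigma> v)" for v
    by (simp add: standard_poly_def f_def)
  have f: "f \<sigma> v \<in> carrier A" if s: "\<sigma> \<in> ?P" and v: "v \<in> carrier A" for \<sigma> v
  proof -
    have "\<sigma> i < p" if "i < p" for i using permutes_in_image[of \<sigma> "{..<p}" i] s that by simp
    then have "set (map (\<lambda>i. (g(k := v)) (\<sigma> i)) [0..<p]) \<subseteq> carrier A"
      using g v by (auto simp: Pi_iff)
    then show ?thesis unfolding f_def using list_prod_closed a_inv_closed by presburger
  qed
  have lin: "f \<sigma> (z \<otimes> x \<oplus> y) = z \<otimes> f \<sigma> x \<oplus> f \<sigma> y" if s: "\<sigma> \<in> ?P" for \<sigma>
  proof -
    have s': "\<sigma> i < p" if "i < p" for i using permutes_in_image[of \<sigma> "{..<p}" i] s that by simp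
    define m where "m = inv_into UNIV \<sigma> k"
    have m: "\<sigma> m = k" "m < p"
      using s k permutes_inverses(1)[of \<sigma> "{..<p}" k] permutes_in_image[of \<sigma> "{..<p}" m]
      by (auto simp: m_def)
    have other: "\<sigma> i \<noteq> k" if "i \<noteq> m" for i
      using that m(1) s permutes_inj[of \<sigma> "{..<p}"] by (auto dest: injD)
    have up: "[0..<p] = [0..<m] @ m # [Suc m..<p]"
      using upt_add_eq_append[of 0 m "p - m"] upt_conv_Cons[OF m(2)] m(2) by simp
    define a b where "a = list_prod A (map (\<lambda>i. g (\<sigma> i)) [0..<m])"
      and "b = list_prod A (map (\<lambda>i. g (\<sigma> i)) [Suc m..<p])"
    have gm: "set (map (\<lambda>i. g (\<sigma> i)) [0..<m]) \<subseteq> carrier A"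
        "set (map (\<lambda>i. g (\<sigma> i)) [Suc m..<p]) \<subseteq> carrier A"
      using g s' m(2) by (auto simp: Pi_iff)
    then have ab: "a \<in> carrier A" "b \<in> carrier A" unfolding a_def b_def by auto
    have "list_prod A (map (\<lambda>i. (g(k := v)) (\<sigma> i)) [0..<p]) = a \<otimes> (v \<otimes> b)" if "v \<in> carrier A" for v
    proof -
      have "map (\<lambda>i. (g(k := v)) (\<sigma> i)) [0..<p]
          = map (\<lambda>i. g (\<sigma> i)) [0..<m] @ v # map (\<lambda>i. g (\<sigma> i)) [Suc m..<p]"
        unfolding up using other m(1) by auto
      then show ?thesis using gm that by (simp add: list_prod_append a_def b_def)
    qed
    moreover have "a \<otimes> ((z \<otimes> x \<oplus> y) \<otimes> b) = z \<otimes> (a \<otimes> (x \<otimes> b)) \<oplus> a \<otimes> (y \<otimes> b)"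
      using ab x y z central[OF z ab(1)] by (simp add: l_distr r_distr m_assoc[symmetric])
    ultimately show ?thesis
      using ab x y z by (simp add: f_def minus_add r_minus)
  qed
  have "(\<Oplus>\<sigma>\<in>?P. f \<sigma> (z \<otimes> x \<oplus> y)) = (\<Oplus>\<sigma>\<in>?P. z \<otimes> f \<sigma> x \<oplus> f \<sigma> y)"
    using f lin x y z by (intro finsum_cong') auto
  also have "\<dots> = (\<Oplus>\<sigma>\<in>?P. z \<otimes> f \<sigma> x) \<oplus> (\<Oplus>\<sigma>\<in>?P. f \<sigma> y)"
    using f x y z by (intro finsum_addf) auto
  also have "(\<Oplus>\<sigma>\<in>?P. z \<otimes> f \<sigma> x) = z \<otimes> (\<Oplus>\<sigma>\<in>?P. f \<sigma> x)"
    using f x z finite_perms by (intro finsum_rdistr[symmetric]) auto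
  finally show ?thesis unfolding std .
qed

text \<open>
By linearity the arguments can be replaced, one after the other, by elements of the spanning set \<open>E\<close>. Once all of
them lie in \<open>E\<close>, two of them are equal because there are more arguments than elements of \<open>E\<close>.
\<close>

theorem standard_identity:
  assumes E: "finite E" "E \<subseteq> carrier A" "carrier A \<subseteq> zspan A Z E" and p: "card E < p"
    and g: "g \<in> {..<p} \<rightarrow> carrier A"
  shows "standard_poly p g = \<zero>"
proof -
  have "standard_poly p g = \<zero>" if "k \<le> p" "g \<in> {..<p} \<rightarrow> carrier A" "\<forall>i. k \<le> i \<longrightarrow> i < p \<longrightarrow> g i \<in> E"
    for k and g :: "nat \<Rightarrow> 'a"
    using that
  proof (induction k arbitrary: g)
    case 0
    then have "g ` {..<p} \<subseteq> E" by auto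
    then have "\<not> inj_on g {..<p}" using p E(1) card_inj_on_le[of g "{..<p}" E] by auto
    then obtain i j where "i < p" "j < p" "i \<noteq> j" "g i = g j" by (auto simp: inj_on_def)
    with 0 show ?case using standard_poly_alternating[of g p i j] by simp
  next
    case (Suc k)
    have k: "k < p" using Suc.prems by simp
    have gk: "g k \<in> zspan A Z E" using Suc.prems(2) k E(3) by (auto simp: Pi_iff)
    have lin: "standard_poly p (g(k := z \<otimes> x \<oplus> y))
      = z \<otimes> standard_poly p (g(k := x)) \<oplus> standard_poly p (g(k := y))"
      if "z \<in> Z" "x \<in> carrier A" "y \<in> carrier A" for z x y
      using standard_poly_slot_linear[OF Suc.prems(2) k that] .
    have inE: "standard_poly p (g(k := e)) = \<zero>" if "e \<in> E" for e
      using that Suc.prems E(2) by (intro Suc.IH) (auto simp: Pi_iff le_Suc_eq Suc_le_eq)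
    have zero: "standard_poly p (g(k := \<zero>)) = \<zero>"
    proof -
      have c: "standard_poly p (g(k := \<zero>)) \<in> carrier A"
        unfolding standard_poly_def
      proof (intro finsum_closed, rule Pi_I)
        fix \<sigma> assume s: "\<sigma> \<in> {\<sigma>. \<sigma> permutes {..<p}}"
        have "\<sigma> i < p" if "i < p" for i using permutes_in_image[of \<sigma> "{..<p}" i] s that by simp
        then have "set (map (\<lambda>i. (g(k := \<zero>)) (\<sigma> i)) [0..<p]) \<subseteq> carrier A"
          using Suc.prems(2) by (auto simp: Pi_iff)
        then show "(if evenperm \<sigma> then list_prod A (map (\<lambda>i. (g(k := \<zero>)) (\<sigma> i)) [0..<p])
            else \<ominus> list_prod A (map (\<lambda>i. (g(k := \<zero>)) (\<sigma> i)) [0..<p])) \<in> carrier A"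
          using list_prod_closed a_inv_closed by presburger
      qed
      have "standard_poly p (g(k := \<zero>))
        = \<one> \<otimes> standard_poly p (g(k := \<zero>)) \<oplus> standard_poly p (g(k := \<zero>))"
        using lin[OF Z_one zero_closed zero_closed] by simp
      with c show ?thesis by (metis add.l_cancel_one l_one)
    qed
    have "standard_poly p (g(k := g k)) \<in> zspan A Z {}"
      using zspan_linear[OF gk E(2), of "{}" "\<lambda>v. standard_poly p (g(k := v))"] zero inE lin
      by (simp add: zspan.zero)
    moreover have "zspan A Z {} = {\<zero>}" by (auto elim: zspan.cases intro: zspan.zero)
    ultimately show ?case by simp
  qed
  from this[of p g] g show ?thesis by simp
qed

end

section \<open>Integrality over the central subring\<close>

context central_subring
begin

text \<open>
The elements of \<open>low u q\<close> are the polynomials in \<open>u\<close> of degree less than \<open>q\<close> over \<open>Z\<close>; a monic polynomial of degree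
\<open>q\<close> is \<open>u [^] q \<oplus> r\<close> with \<open>r\<close> in \<open>low u q\<close>. The next lemmas are the rules for degrees.
\<close>

abbreviation powers :: "'a \<Rightarrow> nat \<Rightarrow> 'a set" where
  "powers u q \<equiv> {u [^] j | j. j < q}"

abbreviation low :: "'a \<Rightarrow> nat \<Rightarrow> 'a set" where
  "low u q \<equiv> zspan A Z (powers u q)"

lemma powers_carrier: "u \<in> carrier A \<Longrightarrow> powers u q \<subseteq> carrier A"
  by auto

lemma low_closed: "u \<in> carrier A \<Longrightarrow> x \<in> low u q \<Longrightarrow> x \<in> carrier A"
  using zspan_closed powers_carrier by blast

lemma low_mono: "x \<in> low u q \<Longrightarrow> q \<le> r \<Longrightarrow> x \<in> low u r"
  by (erule zspan_mono) (auto intro: less_le_trans)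

lemma low_mult:
  assumes u: "u \<in> carrier A" and "x \<in> low u q" "y \<in> low u r" "q + r \<le> Suc s"
  shows "x \<otimes> y \<in> low u s"
proof -
  have "x \<otimes> y \<in> zspan A Z {e \<otimes> f | e f. e \<in> powers u q \<and> f \<in> powers u r}"
    using assms powers_carrier[OF u] by (intro zspan_mult) auto
  then show ?thesis
  proof (rule zspan_mono)
    show "{e \<otimes> f | e f. e \<in> powers u q \<and> f \<in> powers u r} \<subseteq> powers u s"
    proof safe
      fix i j assume "i < q" "j < r"
      moreover have "u [^] i \<otimes> u [^] j = u [^] (i + j)" using u by (simp add: nat_pow_mult)
      ultimately show "\<exists>k. u [^] i \<otimes> u [^] j = u [^] k \<and> k < s"
        using assms(4) by (intro exI[of _ "i + j"]) auto
    qed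
  qed
qed

lemma power_low: "u \<in> carrier A \<Longrightarrow> j < q \<Longrightarrow> u [^] j \<in> low u q"
  by (rule zspan_incl) auto

lemma low_commute:
  assumes u: "u \<in> carrier A" and x: "x \<in> low u q" and y: "y \<in> low u r"
  shows "x \<otimes> y = y \<otimes> x"
proof -
  have yc: "y \<in> carrier A" using low_closed[OF u y] .
  have pw: "u [^] i \<otimes> y = y \<otimes> u [^] i" for i :: nat
    using y
  proof (induction rule: zspan.induct)
    case zero
    then show ?case using u by simp
  next
    case (step z e x)
    then obtain j where j: "e = u [^] (j::nat)" by blast
    have "x \<in> carrier A" using low_closed[OF u step(3)] .
    moreover have "u [^] i \<otimes> u [^] j = u [^] j \<otimes> u [^] i" using u by (simp add: nat_pow_mult add.commute)
    moreover have "u [^] i \<otimes> (z \<otimes> u [^] j) = z \<otimes> (u [^] i \<otimes> u [^] j)"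
      using u step(1) central[OF step(1), of "u [^] i"] by (simp add: m_assoc[symmetric])
    ultimately show ?case
      using u step(1,4) j by (simp add: l_distr r_distr m_assoc)
  qed
  show ?thesis using x
  proof (induction rule: zspan.induct)
    case zero
    then show ?case using yc by simp
  next
    case (step z e x)
    then obtain j where j: "e = u [^] (j::nat)" by blast
    have xc: "x \<in> carrier A" using low_closed[OF u step(3)] .
    have "(z \<otimes> u [^] j) \<otimes> y = z \<otimes> (y \<otimes> u [^] j)"
      using u yc step(1) pw[of j] by (simp add: m_assoc)
    also have "\<dots> = y \<otimes> (z \<otimes> u [^] j)"
      using u yc step(1) central[OF step(1) yc] by (simp add: m_assoc[symmetric])
    finally show ?case
      using u yc step(1,4) j xc by (simp add: l_distr r_distr)
  qed
qed

text \<open>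
A determinant-free form of the Cayley-Hamilton argument. A square system of relations whose diagonal entries are monic
of degree \<open>q\<close> and whose other entries have lower degree is reduced by eliminating the last unknown: with
\<open>D = N n n\<close>, the new coefficients $D N_{ij} - N_{in} N_{nj}$ form a smaller system of the same shape with \<open>2 * q\<close> in place of \<open>q\<close>.
If \<open>F\<close> annihilates the remaining unknowns, then \<open>F \<otimes> D\<close> annihilates the last one as well.
\<close>

lemma elimination:
  fixes n q :: nat
  assumes u: "u \<in> carrier A" and "1 \<le> q" "e \<in> {..<n} \<rightarrow> carrier A"
    and "\<And>i. i < n \<Longrightarrow> \<exists>r\<in>low u q. N i i = u [^] q \<oplus> r"
    and "\<And>i j. i < n \<Longrightarrow> j < n \<Longrightarrow> i \<noteq> j \<Longrightarrow> N i j \<in> low u q"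
    and "\<And>i. i < n \<Longrightarrow> (\<Oplus>j\<in>{..<n}. N i j \<otimes> e j) = \<zero>"
  shows "\<exists>Q. \<exists>r\<in>low u Q. \<forall>j<n. (u [^] Q \<oplus> r) \<otimes> e j = \<zero>"
  using assms(2-)
proof (induction n arbitrary: q N)
  case 0
  show ?case by (intro exI[of _ 0] bexI[of _ \<zero>]) (auto intro: zspan.zero)
next
  case (Suc n)
  note P = powers_carrier[OF u]
  obtain r where r: "r \<in> low u q" "N n n = u [^] q \<oplus> r" using Suc.prems(3)[of n] by auto
  define D where "D = N n n"
  have lowS: "x \<in> low u (Suc q)" if "x \<in> low u q" for x using low_mono[OF that] by simp
  have Dlow: "D \<in> low u (Suc q)"
    unfolding D_def r(2) using lowS[OF r(1)] power_low[OF u, of q "Suc q"] P by (intro zspan_add) auto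
  have Nlow: "N i j \<in> low u (Suc q)" if ij: "i < Suc n" "j < Suc n" for i j
  proof (cases "i = j")
    case True
    obtain r' where "r' \<in> low u q" "N i i = u [^] q \<oplus> r'" using Suc.prems(3)[OF ij(1)] by auto
    then show ?thesis using True lowS power_low[OF u, of q "Suc q"] P by (simp add: zspan_add)
  next
    case False
    then show ?thesis using Suc.prems(4) ij lowS by blast
  qed
  have Nc: "N i j \<in> carrier A" if "i < Suc n" "j < Suc n" for i j
    using low_closed[OF u Nlow[OF that]] .
  have ec: "e j \<in> carrier A" if "j < Suc n" for j using Suc.prems(2) that by (auto simp: Pi_iff)
  have Dc: "D \<in> carrier A" using Nc by (simp add: D_def)
  define s where "s i = (\<Oplus>j\<in>{..<n}. N i j \<otimes> e j)" for i
  have sc: "s i \<in> carrier A" if "i < Suc n" for i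
    unfolding s_def using Nc[OF that] ec by (intro finsum_closed) auto
  have rel: "N i n \<otimes> e n \<oplus> s i = \<zero>" if "i < Suc n" for i
  proof -
    have "(\<Oplus>j\<in>{..<Suc n}. N i j \<otimes> e j) = N i n \<otimes> e n \<oplus> s i"
      unfolding s_def lessThan_Suc using Nc[OF that] ec by (intro finsum_insert) auto
    then show ?thesis using Suc.prems(5)[OF that] by simp
  qed
  define M where "M i j = D \<otimes> N i j \<ominus> N i n \<otimes> N n j" for i j
  have Mc: "M i j \<in> carrier A" if "i < n" "j < n" for i j
    using that Nc Dc by (simp add: M_def)
  have sumM: "(\<Oplus>j\<in>{..<n}. M i j \<otimes> e j) = \<zero>" if i: "i < n" for i
  proof -
    have "(\<Oplus>j\<in>{..<n}. M i j \<otimes> e j)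
        = (\<Oplus>j\<in>{..<n}. D \<otimes> (N i j \<otimes> e j) \<oplus> (\<ominus> N i n) \<otimes> (N n j \<otimes> e j))"
      using i Nc Dc ec by (intro finsum_cong')
        (auto simp: M_def a_minus_def l_distr r_distr m_assoc l_minus)
    also have "\<dots> = (\<Oplus>j\<in>{..<n}. D \<otimes> (N i j \<otimes> e j)) \<oplus> (\<Oplus>j\<in>{..<n}. (\<ominus> N i n) \<otimes> (N n j \<otimes> e j))"
      using i Nc Dc ec by (intro finsum_addf) auto
    also have "(\<Oplus>j\<in>{..<n}. D \<otimes> (N i j \<otimes> e j)) = D \<otimes> s i"
      unfolding s_def using i Nc Dc ec by (intro finsum_rdistr[symmetric]) auto
    also have "(\<Oplus>j\<in>{..<n}. (\<ominus> N i n) \<otimes> (N n j \<otimes> e j)) = (\<ominus> N i n) \<otimes> s n"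
      unfolding s_def using i Nc Dc ec by (intro finsum_rdistr[symmetric]) auto
    also have "s i = \<ominus> (N i n \<otimes> e n)"
      using rel[of i] i sc[of i] Nc[of i n] ec[of n] by (intro minus_equality[symmetric]) (auto simp: a_comm)
    also have "s n = \<ominus> (D \<otimes> e n)"
      using rel[of n] sc[of n] Dc ec[of n] unfolding D_def
      by (intro minus_equality[symmetric]) (auto simp: a_comm)
    also have "D \<otimes> \<ominus> (N i n \<otimes> e n) \<oplus> (\<ominus> N i n) \<otimes> \<ominus> (D \<otimes> e n) = \<zero>"
    proof -
      have "D \<otimes> N i n = N i n \<otimes> D" using low_commute[OF u Dlow Nlow[of i n]] i by simp
      then show ?thesis using Dc Nc[of i n] ec[of n] i
        by (simp add: r_minus l_minus m_assoc[symmetric] l_neg)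
    qed
    finally show ?thesis .
  qed
  have diag: "\<exists>r\<in>low u (2 * q). M i i = u [^] (2 * q) \<oplus> r" if i: "i < n" for i
  proof -
    obtain r' where r': "r' \<in> low u q" "N i i = u [^] q \<oplus> r'" using Suc.prems(3)[of i] i by auto
    note cl = low_closed[OF u r(1)] low_closed[OF u r'(1)] Nc[of i n] Nc[of n i]
    define t where "t = u [^] q \<otimes> r' \<oplus> r \<otimes> u [^] q \<oplus> r \<otimes> r' \<ominus> N i n \<otimes> N n i"
    have "(u [^] q \<oplus> r) \<otimes> (u [^] q \<oplus> r')
        = u [^] q \<otimes> u [^] q \<oplus> (u [^] q \<otimes> r' \<oplus> r \<otimes> u [^] q \<oplus> r \<otimes> r')"
      using u cl(1,2) by (simp add: l_distr r_distr a_ac)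
    then have "M i i = u [^] q \<otimes> u [^] q \<oplus> t"
      unfolding M_def D_def r(2) r'(2) t_def using u cl i by (simp add: a_minus_def a_assoc)
    then have "M i i = u [^] (2 * q) \<oplus> t" using u by (simp add: nat_pow_mult mult_2)
    moreover have "t \<in> low u (2 * q)"
    proof -
      have "u [^] q \<in> low u (Suc q)" using power_low[OF u] by simp
      then have "u [^] q \<otimes> r' \<in> low u (2 * q)" "r \<otimes> u [^] q \<in> low u (2 * q)"
        using low_mult[OF u _ r'(1)] low_mult[OF u r(1)] by (simp_all add: mult_2)
      moreover have "r \<otimes> r' \<in> low u (2 * q)" using low_mult[OF u r(1) r'(1)] by simp
      moreover have "N i n \<otimes> N n i \<in> low u (2 * q)"
        using low_mult[OF u Suc.prems(4)[of i n] Suc.prems(4)[of n i]] i by simp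
      ultimately show ?thesis
        unfolding t_def a_minus_def using P by (intro zspan_add zspan_uminus) auto
    qed
    ultimately show ?thesis by blast
  qed
  have off: "M i j \<in> low u (2 * q)" if "i < n" "j < n" "i \<noteq> j" for i j
  proof -
    have "D \<otimes> N i j \<in> low u (2 * q)"
      using low_mult[OF u Dlow Suc.prems(4)[of i j]] that by simp
    moreover have "N i n \<otimes> N n j \<in> low u (2 * q)"
      using low_mult[OF u Suc.prems(4)[of i n] Suc.prems(4)[of n j]] that by simp
    ultimately show ?thesis
      unfolding M_def a_minus_def using P by (intro zspan_add zspan_uminus) auto
  qed
  obtain Q f where f: "f \<in> low u Q" "\<forall>j<n. (u [^] Q \<oplus> f) \<otimes> e j = \<zero>"
  proof -
    have "1 \<le> 2 * q" "e \<in> {..<n} \<rightarrow> carrier A" using Suc.prems(1) ec by auto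
    from Suc.IH[OF this diag off sumM] that show thesis by blast
  qed
  define F where "F = u [^] Q \<oplus> f"
  have Flow: "F \<in> low u (Suc Q)"
    unfolding F_def using low_mono[OF f(1)] power_low[OF u, of Q "Suc Q"] P by (intro zspan_add) auto
  have Fc: "F \<in> carrier A" using low_closed[OF u Flow] .
  have FD: "F \<otimes> D = D \<otimes> F" using low_commute[OF u Flow Dlow] .
  have kill: "(F \<otimes> D) \<otimes> e j = \<zero>" if j: "j < Suc n" for j
  proof (cases "j = n")
    case False
    with j have "F \<otimes> e j = \<zero>" using f(2) by (simp add: F_def)
    then show ?thesis unfolding FD using Dc Fc ec[OF j] by (simp add: m_assoc)
  next
    case True
    have "F \<otimes> s n = (\<Oplus>j\<in>{..<n}. F \<otimes> (N n j \<otimes> e j))"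
      unfolding s_def using Nc ec Fc by (intro finsum_rdistr) auto
    also have "\<dots> = (\<Oplus>j\<in>{..<n}. \<zero>)"
    proof (intro finsum_cong')
      fix j assume j: "j \<in> {..<n}"
      have "F \<otimes> (N n j \<otimes> e j) = N n j \<otimes> (F \<otimes> e j)"
        using low_commute[OF u Flow Nlow[of n j]] j Fc Nc[of n j] ec[of j] by (simp add: m_assoc[symmetric])
      then show "F \<otimes> (N n j \<otimes> e j) = \<zero>" using f(2) j Nc[of n j] by (simp add: F_def)
    qed auto
    finally have "F \<otimes> s n = \<zero>" by simp
    moreover have "D \<otimes> e n = \<ominus> s n"
      using rel[of n] sc[of n] Dc ec[of n] unfolding D_def by (intro minus_equality[symmetric]) auto
    ultimately show ?thesis using True Fc Dc ec[of n] sc[of n] by (simp add: m_assoc r_minus)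
  qed
  define t where "t = u [^] Q \<otimes> r \<oplus> f \<otimes> D"
  have "t \<in> low u (Q + q)"
  proof -
    have "u [^] Q \<otimes> r \<in> low u (Q + q)"
      using low_mult[OF u power_low[OF u, of Q "Suc Q"] r(1)] by simp
    moreover have "f \<otimes> D \<in> low u (Q + q)" using low_mult[OF u f(1) Dlow] by simp
    ultimately show ?thesis unfolding t_def using P by (intro zspan_add) auto
  qed
  moreover have "F \<otimes> D = u [^] (Q + q) \<oplus> t"
  proof -
    have "F \<otimes> D = u [^] Q \<otimes> D \<oplus> f \<otimes> D"
      unfolding F_def using u Dc low_closed[OF u f(1)] by (simp add: l_distr)
    also have "u [^] Q \<otimes> D = u [^] (Q + q) \<oplus> u [^] Q \<otimes> r"
      unfolding D_def r(2) using u low_closed[OF u r(1)] by (simp add: r_distr nat_pow_mult)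
    finally show ?thesis
      unfolding t_def using u Dc low_closed[OF u f(1)] low_closed[OF u r(1)] by (simp add: a_assoc)
  qed
  ultimately show ?case using kill by (intro exI[of _ "Q + q"] bexI[of _ t]) auto
qed

text \<open>
Multiplication by \<open>u\<close> sends each spanning element to a combination of the spanning elements. These equations form a system as in
\<open>elimination\<close> with \<open>q = 1\<close>. The monic polynomial obtained kills the spanning set, hence also the unit, hence it is zero.
\<close>

theorem integral_over_center:
  assumes E: "finite E" "E \<subseteq> carrier A" "carrier A \<subseteq> zspan A Z E" and u: "u \<in> carrier A"
  shows "\<exists>Q::nat. u [^] Q \<in> zspan A Z {u [^] j | j. j < Q}"
proof -
  obtain n and e :: "nat \<Rightarrow> 'a" where e: "E = e ` {..<n}"
    using finite_imp_nat_seg_image_inj_on[OF E(1)] unfolding lessThan_def by metis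
  have ec: "e \<in> {..<n} \<rightarrow> carrier A" using E(2) e by auto
  have "\<exists>c. c \<in> {..<n} \<rightarrow> Z \<and> u \<otimes> e i = (\<Oplus>j\<in>{..<n}. c j \<otimes> e j)" if "i < n" for i
  proof (rule zspan_coordinates[OF _ ec])
    have "u \<otimes> e i \<in> carrier A" using u ec that by auto
    then show "u \<otimes> e i \<in> zspan A Z (e ` {..<n})" using E(3) e by auto
  qed
  then obtain c where c: "\<And>i. i < n \<Longrightarrow> c i \<in> {..<n} \<rightarrow> Z"
    "\<And>i. i < n \<Longrightarrow> u \<otimes> e i = (\<Oplus>j\<in>{..<n}. c i j \<otimes> e j)" by metis
  have cZ: "c i j \<in> Z" if "i < n" "j < n" for i j using c(1)[OF that(1)] that(2) by auto
  note P = powers_carrier[OF u]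
  have Zlow: "z \<in> low u 1" if "z \<in> Z" for z
    using zspan_smult[OF that power_low[OF u, of 0 1]] P that by simp
  define N where "N i j = (if i = j then u \<ominus> c i j else \<ominus> c i j)" for i j
  have "\<exists>Q. \<exists>r\<in>low u Q. \<forall>j<n. (u [^] Q \<oplus> r) \<otimes> e j = \<zero>"
  proof (rule elimination[OF u, of 1 e n N])
    show "\<exists>r\<in>low u 1. N i i = u [^] (1::nat) \<oplus> r" if "i < n" for i
      using zspan_uminus[OF Zlow[OF cZ[OF that that]] P] u
      by (intro bexI[of _ "\<ominus> c i i"]) (auto simp: N_def a_minus_def)
    show "N i j \<in> low u 1" if "i < n" "j < n" "i \<noteq> j" for i j
      using zspan_uminus[OF Zlow[OF cZ[OF that(1,2)]] P] that(3) by (simp add: N_def)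
    fix i assume i: "i < n"
    have "(\<Oplus>j\<in>{..<n}. N i j \<otimes> e j)
        = (\<Oplus>j\<in>{..<n}. (if i = j then u \<otimes> e j else \<zero>) \<oplus> (\<ominus> \<one>) \<otimes> (c i j \<otimes> e j))"
      using u cZ[OF i] ec by (intro finsum_cong') (auto simp: N_def Pi_iff a_minus_def l_distr l_minus)
    also have "\<dots> = (\<Oplus>j\<in>{..<n}. (if i = j then u \<otimes> e j else \<zero>))
        \<oplus> (\<Oplus>j\<in>{..<n}. (\<ominus> \<one>) \<otimes> (c i j \<otimes> e j))"
      using u cZ[OF i] ec by (intro finsum_addf) (auto simp: Pi_iff)
    also have "(\<Oplus>j\<in>{..<n}. (if i = j then u \<otimes> e j else \<zero>)) = u \<otimes> e i"
      using u ec i by (intro add.finprod_singleton) (auto simp: Pi_iff)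
    also have "(\<Oplus>j\<in>{..<n}. (\<ominus> \<one>) \<otimes> (c i j \<otimes> e j)) = (\<ominus> \<one>) \<otimes> (u \<otimes> e i)"
      unfolding c(2)[OF i] using cZ[OF i] ec by (intro finsum_rdistr[symmetric]) (auto simp: Pi_iff)
    also have "u \<otimes> e i \<oplus> (\<ominus> \<one>) \<otimes> (u \<otimes> e i) = \<zero>"
      using u ec i by (simp add: Pi_iff l_minus r_neg)
    finally show "(\<Oplus>j\<in>{..<n}. N i j \<otimes> e j) = \<zero>" .
  qed (use ec in auto)
  then obtain Q r where r: "r \<in> low u Q" and kill: "\<forall>j<n. (u [^] Q \<oplus> r) \<otimes> e j = \<zero>" by blast
  define F where "F = u [^] Q \<oplus> r"
  have rc: "r \<in> carrier A" using low_closed[OF u r] .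
  have Fc: "F \<in> carrier A" unfolding F_def using u rc by simp
  have "F \<otimes> x = \<zero>" if "x \<in> zspan A Z E" for x
    using that
  proof (induction rule: zspan.induct)
    case zero
    then show ?case using Fc by simp
  next
    case (step z v x)
    then have v: "v \<in> carrier A" "F \<otimes> v = \<zero>" "x \<in> carrier A"
      using kill E(2) e zspan_closed[OF step(3) E(2)] by (auto simp: F_def)
    have "F \<otimes> (z \<otimes> v \<oplus> x) = z \<otimes> (F \<otimes> v) \<oplus> F \<otimes> x"
      using Fc v(1,3) step(1) central[OF step(1) Fc] by (simp add: r_distr m_assoc[symmetric])
    then show ?case using step v by simp
  qed
  moreover have "\<one> \<in> zspan A Z E" using E(3) by auto
  ultimately have "F \<otimes> \<one> = \<zero>" by blast
  then have "F = \<zero>" using Fc by simp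
  then have "u [^] Q = \<ominus> r" unfolding F_def using u rc by (intro minus_equality[symmetric]) auto
  with zspan_uminus[OF r P] have "u [^] Q \<in> low u Q" by (simp only:)
  then show ?thesis by (rule exI)
qed

end

section \<open>Growth of the spaces of power products\<close>

context vectorspace
begin

lemma span_finsum_mem:
  assumes "finite I" "X \<subseteq> carrier V" "\<And>i. i \<in> I \<Longrightarrow> f i \<in> span X"
  shows "(\<Oplus>\<^bsub>V\<^esub>i\<in>I. f i) \<in> span X"
proof -
  note S = span_is_submodule[OF assms(2)]
  from assms(1,3) show ?thesis
  proof (induction I rule: finite_induct)
    case empty
    show ?case using submodule.zero_closed[OF S] by (simp only: M.finsum_empty)
  next
    case (insert i I)
    then have "f j \<in> carrier V" if "j \<in> insert i I" for j
      using that submodule.subset[OF S] by blast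
    then have "(\<Oplus>\<^bsub>V\<^esub>j\<in>insert i I. f j) = f i \<oplus>\<^bsub>V\<^esub> (\<Oplus>\<^bsub>V\<^esub>j\<in>I. f j)"
      using insert by (intro M.finsum_insert) auto
    moreover have "f i \<oplus>\<^bsub>V\<^esub> (\<Oplus>\<^bsub>V\<^esub>j\<in>I. f j) \<in> span X"
      using insert by (intro submodule.m_closed[OF S]) auto
    ultimately show ?case by (simp only:)
  qed
qed

lemma in_span_if_relation:
  assumes I: "finite I" "k \<in> I" and X: "X \<subseteq> carrier V"
    and c: "c \<in> I \<rightarrow> carrier K" "c k \<noteq> \<zero>\<^bsub>K\<^esub>" and v: "\<And>i. i \<in> I \<Longrightarrow> v i \<in> carrier V"
    and rel: "(\<Oplus>\<^bsub>V\<^esub>i\<in>I. c i \<odot>\<^bsub>V\<^esub> v i) = \<zero>\<^bsub>V\<^esub>"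
    and other: "\<And>i. i \<in> I \<Longrightarrow> i \<noteq> k \<Longrightarrow> c i \<noteq> \<zero>\<^bsub>K\<^esub> \<Longrightarrow> v i \<in> span X"
  shows "v k \<in> span X"
proof -
  interpret S: submodule K "span X" V using X by (rule span_is_submodule)
  have ci: "c i \<in> carrier K" if "i \<in> I" for i using c(1) that by auto
  define s where "s = (\<Oplus>\<^bsub>V\<^esub>i\<in>I - {k}. c i \<odot>\<^bsub>V\<^esub> v i)"
  have "c i \<odot>\<^bsub>V\<^esub> v i \<in> span X" if "i \<in> I - {k}" for i
  proof (cases "c i = \<zero>\<^bsub>K\<^esub>")
    case True
    then show ?thesis using v[of i] that by simp
  next
    case False
    then show ?thesis using other[of i] ci[of i] that by simp
  qed
  then have s: "s \<in> span X" unfolding s_def using I X by (intro span_finsum_mem) auto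
  have sc: "s \<in> carrier V" using s S.subset by blast
  have ck: "c k \<odot>\<^bsub>V\<^esub> v k \<in> carrier V" using ci v I by simp
  have "(\<Oplus>\<^bsub>V\<^esub>i\<in>insert k (I - {k}). c i \<odot>\<^bsub>V\<^esub> v i) = c k \<odot>\<^bsub>V\<^esub> v k \<oplus>\<^bsub>V\<^esub> s"
    unfolding s_def using I v ci ck by (intro M.finsum_insert) auto
  then have "c k \<odot>\<^bsub>V\<^esub> v k \<oplus>\<^bsub>V\<^esub> s = \<zero>\<^bsub>V\<^esub>" using rel I(2) by (simp add: insert_absorb)
  then have eq: "c k \<odot>\<^bsub>V\<^esub> v k = \<ominus>\<^bsub>V\<^esub> s"
    using M.minus_equality[OF _ sc ck] by simp
  have "\<ominus>\<^bsub>V\<^esub> s = (\<ominus>\<^bsub>K\<^esub> \<one>\<^bsub>K\<^esub>) \<odot>\<^bsub>V\<^esub> s" using sc by (simp add: smult_minus_1)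
  then have "c k \<odot>\<^bsub>V\<^esub> v k \<in> span X" using eq s by simp
  moreover have "c k \<in> Units K" using ci I(2) c(2) by (simp add: field_Units)
  then have "inv\<^bsub>K\<^esub> (c k) \<in> carrier K" by simp
  moreover have "v k = inv\<^bsub>K\<^esub> (c k) \<odot>\<^bsub>V\<^esub> (c k \<odot>\<^bsub>V\<^esub> v k)"
    using mult_inverse[OF ci[OF I(2)] v[OF I(2)] refl c(2)] .
  ultimately show ?thesis using S.smult_closed by metis
qed

end

lemma deglex_max:
  assumes "finite S" "S \<noteq> {}"
  shows "\<exists>M\<in>S. \<forall>M'\<in>S. M' \<noteq> M \<longrightarrow> deglex M' M"
  using assms
proof (induction S rule: finite_ne_induct)
  case (insert x S)
  then obtain M where M: "M \<in> S" "\<forall>M'\<in>S. M' \<noteq> M \<longrightarrow> deglex M' M" by blast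
  show ?case
  proof (cases "deglex M x")
    case True
    then show ?thesis using M deglex_trans by (intro bexI[of _ x]) auto
  next
    case False
    then show ?thesis using M deglex_total[of M x] by (intro bexI[of _ M]) auto
  qed
qed simp

text \<open>
The value of \<open>power_form\<close> when the words are replaced by elements of the algebra. For fixed pairs
it is regarded as a function of the monomial whose exponents are given by \<open>k\<close>.
\<close>

fun power_product :: "('a, 'b) ring_scheme \<Rightarrow> ('a \<times> 'a) list \<Rightarrow> (nat \<Rightarrow> nat) \<Rightarrow> 'a" where
  "power_product A [] k = \<one>\<^bsub>A\<^esub>"
| "power_product A (ug # ps) k =
     (fst ug [^]\<^bsub>A\<^esub> k 0) \<otimes>\<^bsub>A\<^esub> (snd ug \<otimes>\<^bsub>A\<^esub> power_product A ps (\<lambda>i. k (Suc i)))"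

context ring
begin

lemma power_product_closed [simp]: "set ps \<subseteq> carrier R \<times> carrier R \<Longrightarrow> power_product R ps k \<in> carrier R"
  by (induction ps arbitrary: k) auto

text \<open>
Changing a single exponent by \<open>b\<close> only inserts a factor \<open>u [^] b\<close> at a fixed place. An integrality relation for \<open>u\<close> can therefore be
applied inside a power product.
\<close>

lemma power_product_slot:
  assumes "set ps \<subseteq> carrier R \<times> carrier R" "i < length ps"
  shows "\<exists>\<alpha> \<beta>. \<alpha> \<in> carrier R \<and> \<beta> \<in> carrier R \<and>
    (\<forall>b::nat. power_product R ps (\<lambda>j. k j + (if j = i then b else 0)) = \<alpha> \<otimes> ((fst (ps ! i) [^] b) \<otimes> \<beta>))"
  using assms
proof (induction ps arbitrary: i k)
  case (Cons ug ps)
  then have c: "fst ug \<in> carrier R" "snd ug \<in> carrier R" "set ps \<subseteq> carrier R \<times> carrier R" by auto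
  show ?case
  proof (cases i)
    case 0
    let ?\<beta> = "(fst ug [^] k 0) \<otimes> (snd ug \<otimes> power_product R ps (\<lambda>i. k (Suc i)))"
    have "power_product R (ug # ps) (\<lambda>j. k j + (if j = i then b else 0)) = \<one> \<otimes> ((fst ug [^] b) \<otimes> ?\<beta>)" for b
    proof -
      have "fst ug [^] (k 0 + b) = fst ug [^] b \<otimes> fst ug [^] k 0"
        using c by (simp add: nat_pow_mult add.commute)
      then show ?thesis using 0 c by (simp add: m_assoc)
    qed
    then show ?thesis using 0 c by (intro exI[of _ \<one>] exI[of _ ?\<beta>]) auto
  next
    case (Suc i')
    then have "i' < length ps" using Cons.prems by simp
    from Cons.IH[OF c(3) this, of "\<lambda>j. k (Suc j)"] obtain \<alpha> \<beta> where
      ab: "\<alpha> \<in> carrier R" "\<beta> \<in> carrier R"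
      "\<And>b::nat. power_product R ps (\<lambda>j. k (Suc j) + (if j = i' then b else 0)) = \<alpha> \<otimes> ((fst (ps ! i') [^] b) \<otimes> \<beta>)"
      by blast
    let ?\<alpha> = "(fst ug [^] k 0) \<otimes> (snd ug \<otimes> \<alpha>)"
    have u: "fst (ps ! i') \<in> carrier R" using c(3) \<open>i' < length ps\<close> nth_mem by fastforce
    have "power_product R (ug # ps) (\<lambda>j. k j + (if j = i then b else 0))
        = ?\<alpha> \<otimes> ((fst ((ug # ps) ! i) [^] b) \<otimes> \<beta>)" for b
      using Suc c ab u by (simp add: m_assoc)
    then show ?thesis using c ab by (intro exI[of _ ?\<alpha>] exI[of _ \<beta>]) auto
  qed
qed simp

end

text \<open>
The setting of the main argument: an algebra that is spanned by a finite set over a central subring. The central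
elements need not be scalars from the base field.
\<close>

locale finite_central_algebra = unital_algebra K A + central_subring A Z
  for K :: "'k ring" and A :: "('k, 'a) module" (structure) and Z +
  fixes E :: "'a set"
  assumes E: "finite E" "E \<subseteq> carrier A" "carrier A \<subseteq> zspan A Z E"
begin

abbreviation pprod :: "('a \<times> 'a) list \<Rightarrow> nat multiset \<Rightarrow> 'a" where
  "pprod ps M \<equiv> power_product A ps (count M)"

text \<open>
A relation between power products over the base field that persists under multiplication by all monomials of a finite box
persists under multiplication by every monomial. Indeed, once some exponent of the multiplier reaches the degree of an
integrality relation of the corresponding \<open>u\<close>, the shifted relation is a combination over \<open>Z\<close> of
shifted relations with smaller multipliers. The coefficients in \<open>Z\<close> pass through because \<open>Z\<close> is central.
\<close>

lemma relation_box:
  assumes ps: "set ps \<subseteq> carrier A \<times> carrier A"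
  shows "\<exists>G. finite G \<and> (\<forall>g\<in>G. set_mset g \<subseteq> {..<length ps}) \<and>
    (\<forall>T c. finite T \<longrightarrow> c \<in> T \<rightarrow> carrier K \<longrightarrow> (\<forall>g\<in>G. (\<Oplus>M\<in>T. c M \<odot> pprod ps (M + g)) = \<zero>) \<longrightarrow>
       (\<forall>g. set_mset g \<subseteq> {..<length ps} \<longrightarrow> (\<Oplus>M\<in>T. c M \<odot> pprod ps (M + g)) = \<zero>))"
proof -
  let ?H = "{..<length ps}"
  let ?u = "\<lambda>i. fst (ps ! i)"
  have u: "?u i \<in> carrier A" if "i \<in> ?H" for i
  proof -
    have "ps ! i \<in> carrier A \<times> carrier A" using ps that nth_mem by (metis lessThan_iff subsetD)
    then show ?thesis by (metis mem_Times_iff)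
  qed
  have "\<forall>i\<in>?H. \<exists>D::nat. ?u i [^] D \<in> zspan A Z {?u i [^] j | j. j < D}"
    using integral_over_center[OF E u] by blast
  from bchoice[OF this] obtain D :: "nat \<Rightarrow> nat" where
    D: "\<forall>i\<in>?H. ?u i [^] D i \<in> zspan A Z {?u i [^] j | j. j < D i}" ..
  define G where "G = {g. set_mset g \<subseteq> ?H \<and> (\<forall>i\<in>?H. count g i < D i)}"
  have "G \<subseteq> monomials ?H (\<Sum>i\<in>?H. D i)"
  proof
    fix g assume g: "g \<in> G"
    have "size g = (\<Sum>i\<in>set_mset g. count g i)" by (simp add: size_multiset_overloaded_eq)
    also have "\<dots> \<le> (\<Sum>i\<in>?H. count g i)" using g by (intro sum_mono2) (auto simp: G_def)
    also have "\<dots> \<le> (\<Sum>i\<in>?H. D i)" using g by (intro sum_mono) (auto simp: G_def less_imp_le)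
    finally show "g \<in> monomials ?H (\<Sum>i\<in>?H. D i)" using g by (simp add: G_def monomials_def)
  qed
  then have finG: "finite G" using finite_monomials[of ?H] finite_subset by blast
  have box: "(\<Oplus>M\<in>T. c M \<odot> pprod ps (M + g)) = \<zero>"
    if T: "finite T" "c \<in> T \<rightarrow> carrier K" "\<forall>g\<in>G. (\<Oplus>M\<in>T. c M \<odot> pprod ps (M + g)) = \<zero>"
      and g: "set_mset g \<subseteq> ?H" for T c g
    using g
  proof (induction "size g" arbitrary: g rule: less_induct)
    case less
    show ?case
    proof (cases "g \<in> G")
      case True
      then show ?thesis using T(3) by blast
    next
      case False
      then obtain i where i: "i \<in> ?H" "D i \<le> count g i" using less.prems by (auto simp: G_def)
      define g0 where "g0 = g - replicate_mset (D i) i"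
      have g: "g = g0 + replicate_mset (D i) i"
        using i(2) by (simp add: g0_def count_le_replicate_mset_subset_eq)
      have "\<exists>\<alpha> \<beta>. \<alpha> \<in> carrier A \<and> \<beta> \<in> carrier A \<and>
          (\<forall>b. pprod ps (M + (g0 + replicate_mset b i)) = \<alpha> \<otimes> ((?u i [^] b) \<otimes> \<beta>))" for M
      proof -
        have "count (M + (g0 + replicate_mset b i))
            = (\<lambda>j. count (M + g0) j + (if j = i then b else 0))" for b by auto
        then show ?thesis using power_product_slot[OF ps, of i "count (M + g0)"] i(1) by simp
      qed
      then obtain \<alpha> \<beta> where ab: "\<And>M. \<alpha> M \<in> carrier A" "\<And>M. \<beta> M \<in> carrier A"
        "\<And>M b. pprod ps (M + (g0 + replicate_mset b i)) = \<alpha> M \<otimes> ((?u i [^] b) \<otimes> \<beta> M)" by metis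
      \<comment> \<open>The shifted relation as a \<open>Z\<close>-linear function of the power of \<open>?u i\<close> that stands in slot \<open>i\<close>.\<close>
      define Y where "Y x = (\<Oplus>M\<in>T. c M \<odot> (\<alpha> M \<otimes> (x \<otimes> \<beta> M)))" for x
      have cK: "c M \<in> carrier K" if "M \<in> T" for M using T(2) that by auto
      have Y_lin: "Y (z \<otimes> x \<oplus> y) = z \<otimes> Y x \<oplus> Y y"
        if z: "z \<in> Z" and xy: "x \<in> carrier A" "y \<in> carrier A" for z x y
      proof -
        have "Y (z \<otimes> x \<oplus> y) = (\<Oplus>M\<in>T. z \<otimes> (c M \<odot> (\<alpha> M \<otimes> (x \<otimes> \<beta> M))) \<oplus> c M \<odot> (\<alpha> M \<otimes> (y \<otimes> \<beta> M)))"
          unfolding Y_def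
        proof (intro M.finsum_cong')
          fix M assume M: "M \<in> T"
          have "\<alpha> M \<otimes> ((z \<otimes> x \<oplus> y) \<otimes> \<beta> M) = z \<otimes> (\<alpha> M \<otimes> (x \<otimes> \<beta> M)) \<oplus> \<alpha> M \<otimes> (y \<otimes> \<beta> M)"
            using ab(1,2)[of M] z xy central[OF z ab(1)[of M]]
            by (simp add: alg.l_distr alg.r_distr alg.m_assoc[symmetric])
          then show "c M \<odot> (\<alpha> M \<otimes> ((z \<otimes> x \<oplus> y) \<otimes> \<beta> M))
              = z \<otimes> (c M \<odot> (\<alpha> M \<otimes> (x \<otimes> \<beta> M))) \<oplus> c M \<odot> (\<alpha> M \<otimes> (y \<otimes> \<beta> M))"
            using ab(1,2)[of M] z xy cK[OF M] by (simp add: smult_r_distr smult_mult_right)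
        qed (use ab z xy cK in auto)
        also have "\<dots> = (\<Oplus>M\<in>T. z \<otimes> (c M \<odot> (\<alpha> M \<otimes> (x \<otimes> \<beta> M)))) \<oplus> Y y"
          unfolding Y_def using ab z xy cK by (intro M.finsum_addf) auto
        also have "(\<Oplus>M\<in>T. z \<otimes> (c M \<odot> (\<alpha> M \<otimes> (x \<otimes> \<beta> M)))) = z \<otimes> Y x"
          unfolding Y_def using ab z xy cK T(1) by (intro alg.finsum_rdistr[symmetric]) auto
        finally show ?thesis .
      qed
      have Y_eq: "Y (?u i [^] b) = (\<Oplus>M\<in>T. c M \<odot> pprod ps (M + (g0 + replicate_mset b i)))" for b :: nat
        unfolding Y_def ab(3) ..
      have Y_low: "Y (?u i [^] j) = \<zero>" if "j < D i" for j
      proof -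
        have "size (g0 + replicate_mset j i) < size g" using that by (subst g) simp
        moreover have "set_mset (g0 + replicate_mset j i) \<subseteq> ?H"
          using less.prems i(1) by (auto simp: g0_def dest: in_diffD)
        ultimately show ?thesis unfolding Y_eq by (rule less.hyps)
      qed
      have "Y (?u i [^] D i) \<in> zspan A Z {}"
      proof (rule zspan_linear[OF bspec[OF D i(1)], where W = "{}" and \<psi> = Y])
        show "Y \<zero> \<in> zspan A Z {}"
        proof -
          have "Y \<zero> = (\<Oplus>M\<in>T. \<zero>)"
            unfolding Y_def using ab cK by (intro M.finsum_cong') auto
          then show ?thesis by (simp add: zspan.zero)
        qed
        show "Y e \<in> zspan A Z {}" if e: "e \<in> {?u i [^] j | j. j < D i}" for e
        proof -
          obtain j where "e = ?u i [^] j" "j < D i" using e by blast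
          then have "Y e = \<zero>" using Y_low by simp
          then show ?thesis by (simp only: zspan.zero)
        qed
        show "{?u i [^] j | j. j < D i} \<subseteq> carrier A" using u[OF i(1)] by auto
        show "Y (z \<otimes> x \<oplus> y) = z \<otimes> Y x \<oplus> Y y"
          if "z \<in> Z" "x \<in> carrier A" "y \<in> carrier A" for z x y using that by (rule Y_lin)
      qed simp
      then have "Y (?u i [^] D i) = \<zero>" by (auto elim: zspan.cases)
      then show ?thesis using Y_eq[of "D i"] g by (simp only:)
    qed
  qed
  show ?thesis
  proof (intro exI[of _ G] conjI allI impI)
    show "finite G" by (rule finG)
    show "\<forall>g\<in>G. set_mset g \<subseteq> ?H" by (simp add: G_def)
  qed (rule box)
qed

text \<open>
A monomial is reducible if it is the leading monomial of a polynomial in the largest ideal on which the map from polynomials to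
power products vanishes: the relation has to hold after multiplication by every monomial \<open>g\<close>. Terms with coefficient zero are
permitted to be large so that relations indexed by an arbitrary finite set can be used directly.
\<close>

definition reducible :: "('a \<times> 'a) list \<Rightarrow> nat multiset \<Rightarrow> bool" where
  "reducible ps M \<longleftrightarrow> (\<exists>T c. finite T \<and> M \<in> T \<and> (\<forall>M'\<in>T. set_mset M' \<subseteq> {..<length ps}) \<and>
     c \<in> T \<rightarrow> carrier K \<and> c M \<noteq> \<zero>\<^bsub>K\<^esub> \<and>
     (\<forall>M'\<in>T. c M' \<noteq> \<zero>\<^bsub>K\<^esub> \<longrightarrow> M' \<noteq> M \<longrightarrow> deglex M' M) \<and>
     (\<forall>g. set_mset g \<subseteq> {..<length ps} \<longrightarrow> (\<Oplus>M'\<in>T. c M' \<odot> pprod ps (M' + g)) = \<zero>))"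

lemma reducible_add:
  assumes ps: "set ps \<subseteq> carrier A \<times> carrier A"
    and "reducible ps M" "set_mset G \<subseteq> {..<length ps}"
  shows "reducible ps (M + G)"
proof -
  let ?H = "{..<length ps}"
  from assms(2) obtain T c where T: "finite T" "M \<in> T" "\<forall>M'\<in>T. set_mset M' \<subseteq> ?H"
    "c \<in> T \<rightarrow> carrier K" "c M \<noteq> \<zero>\<^bsub>K\<^esub>"
    "\<forall>M'\<in>T. c M' \<noteq> \<zero>\<^bsub>K\<^esub> \<longrightarrow> M' \<noteq> M \<longrightarrow> deglex M' M"
    "\<And>g. set_mset g \<subseteq> ?H \<Longrightarrow> (\<Oplus>M'\<in>T. c M' \<odot> pprod ps (M' + g)) = \<zero>"
    unfolding reducible_def by blast
  let ?T = "(\<lambda>M'. M' + G) ` T" and ?c = "\<lambda>M'. c (M' - G)"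
  have "(\<Oplus>M'\<in>?T. ?c M' \<odot> pprod ps (M' + g)) = \<zero>" if g: "set_mset g \<subseteq> ?H" for g
  proof -
    have "(\<Oplus>M'\<in>?T. ?c M' \<odot> pprod ps (M' + g)) = (\<Oplus>M'\<in>T. ?c (M' + G) \<odot> pprod ps (M' + G + g))"
      using T(4) ps by (intro M.add.finprod_reindex) (auto simp: inj_on_def Pi_iff)
    also have "\<dots> = \<zero>" using T(7)[of "G + g"] g assms(3) by (simp add: add.assoc)
    finally show ?thesis .
  qed
  then show ?thesis unfolding reducible_def
    using T(1-6) assms(3) by (intro exI[of _ ?T] exI[of _ ?c]) (auto simp: deglex_add)
qed

lemma power_product_span_irreducible:
  assumes ps: "set ps \<subseteq> carrier A \<times> carrier A" and "M \<in> monomials {..<length ps} n"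
  shows "pprod ps M \<in> span (pprod ps ` {M \<in> monomials {..<length ps} n. \<not> reducible ps M})"
  using assms(2)
proof (induction "card {M' \<in> monomials {..<length ps} n. deglex M' M}" arbitrary: M rule: less_induct)
  case less
  let ?H = "{..<length ps}"
  let ?X = "pprod ps ` {M \<in> monomials ?H n. \<not> reducible ps M}"
  have X: "?X \<subseteq> carrier A" using ps by auto
  show ?case
  proof (cases "reducible ps M")
    case False
    then show ?thesis using less.prems X by (intro span_mem) auto
  next
    case True
    then obtain T c where T: "finite T" "M \<in> T" "\<forall>M'\<in>T. set_mset M' \<subseteq> ?H"
      "c \<in> T \<rightarrow> carrier K" "c M \<noteq> \<zero>\<^bsub>K\<^esub>"
      "\<forall>M'\<in>T. c M' \<noteq> \<zero>\<^bsub>K\<^esub> \<longrightarrow> M' \<noteq> M \<longrightarrow> deglex M' M"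
      "\<And>g. set_mset g \<subseteq> ?H \<Longrightarrow> (\<Oplus>M'\<in>T. c M' \<odot> pprod ps (M' + g)) = \<zero>"
      unfolding reducible_def by blast
    show ?thesis
    proof (rule in_span_if_relation[OF T(1,2) X T(4,5)])
      show "(\<Oplus>M'\<in>T. c M' \<odot> pprod ps M') = \<zero>" using T(7)[of "{#}"] by simp
      fix M' assume M': "M' \<in> T" "M' \<noteq> M" "c M' \<noteq> \<zero>\<^bsub>K\<^esub>"
      then have lt: "deglex M' M" using T(6) by blast
      then have mem: "M' \<in> monomials ?H n"
        using T(3) M'(1) deglex_size[OF lt] less.prems by (auto simp: monomials_def)
      have "{L \<in> monomials ?H n. deglex L M'} \<subset> {L \<in> monomials ?H n. deglex L M}"
        using mem lt deglex_irrefl deglex_trans by blast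
      then have "card {L \<in> monomials ?H n. deglex L M'} < card {L \<in> monomials ?H n. deglex L M}"
        using finite_monomials[of ?H n] by (intro psubset_card_mono) auto
      then show "pprod ps M' \<in> span ?X" using mem by (rule less.hyps)
    qed (use ps in auto)
  qed
qed

text \<open>
The irreducible monomials form an order ideal \<open>N\<close>. Reduction shows that the power products with exponents in \<open>N\<close> span, which
is the upper bound. For the lower bound, if there were many more irreducible monomials of degree at most \<open>n\<close> than
the dimension, a common relation would hold for all multipliers in the finite box; it would then hold for all
multipliers, making its leading monomial reducible.
\<close>

lemma power_product_growth:
  assumes ps: "set ps \<subseteq> carrier A \<times> carrier A"
  defines "\<delta> \<equiv> \<lambda>n. span_dim (pprod ps ` monomials {..<length ps} n)"
  shows "(\<forall>n. \<delta> n = 0) \<or> (\<exists>m d c1 c2. 0 < c1 \<and>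
    (\<forall>n\<ge>1. real (\<delta> n) \<le> c2 * real n ^ m \<and> c1 * real n ^ m \<le> real (\<delta> (n + d))))"
proof -
  let ?H = "{..<length ps}"
  define N where "N = {M. set_mset M \<subseteq> ?H \<and> \<not> reducible ps M}"
  have N_eq: "N \<inter> monomials ?H n = {M \<in> monomials ?H n. \<not> reducible ps M}" for n
    by (auto simp: N_def monomials_def)
  have fin: "finite (monomials ?H n)" for n by (rule finite_monomials) simp
  have thc: "pprod ps ` S \<subseteq> carrier A" for S using ps by auto
  have upper: "\<delta> n \<le> card (N \<inter> monomials ?H n)" for n
  proof -
    have "\<delta> n \<le> card (pprod ps ` (N \<inter> monomials ?H n))"
      unfolding \<delta>_def N_eq using fin thc power_product_span_irreducible[OF ps]
      by (intro dim_span_le_card) auto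
    also have "\<dots> \<le> card (N \<inter> monomials ?H n)" using fin by (intro card_image_le) auto
    finally show ?thesis .
  qed
  obtain G where box: "finite G \<and> (\<forall>g\<in>G. set_mset g \<subseteq> ?H) \<and>
    (\<forall>T c. finite T \<longrightarrow> c \<in> T \<rightarrow> carrier K \<longrightarrow> (\<forall>g\<in>G. (\<Oplus>M\<in>T. c M \<odot> pprod ps (M + g)) = \<zero>) \<longrightarrow>
       (\<forall>g. set_mset g \<subseteq> ?H \<longrightarrow> (\<Oplus>M\<in>T. c M \<odot> pprod ps (M + g)) = \<zero>))"
    using relation_box[OF ps] ..
  note G = conjunct1[OF box] conjunct1[OF conjunct2[OF box]]
  have G_all: "\<forall>g. set_mset g \<subseteq> ?H \<longrightarrow> (\<Oplus>M\<in>T. c M \<odot> pprod ps (M + g)) = \<zero>"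
    if "finite T" "c \<in> T \<rightarrow> carrier K" "\<forall>g\<in>G. (\<Oplus>M\<in>T. c M \<odot> pprod ps (M + g)) = \<zero>" for T c
    by (rule conjunct2[OF conjunct2[OF box], THEN spec, THEN spec, THEN mp, THEN mp, THEN mp, OF that])
  define d where "d = (\<Sum>g\<in>G. size g)"
  have d: "size g \<le> d" if "g \<in> G" for g unfolding d_def using G(1) that by (intro member_le_sum) auto
  have lower: "card (N \<inter> monomials ?H n) \<le> card G * \<delta> (n + d)" for n
  proof (rule ccontr)
    assume "\<not> ?thesis"
    then have less: "card G * \<delta> (n + d) < card (N \<inter> monomials ?H n)" by simp
    let ?I = "N \<inter> monomials ?H n"
    have I: "finite ?I" using fin by simp
    have "\<exists>c. c \<in> ?I \<rightarrow> carrier K \<and> (\<exists>i\<in>?I. c i \<noteq> \<zero>\<^bsub>K\<^esub>) \<and>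
      (\<forall>g\<in>G. (\<Oplus>M\<in>?I. c M \<odot> pprod ps (M + g)) = \<zero>)"
    proof (rule common_linear_relation[of ?I G "pprod ps ` monomials ?H (n + d)" "\<lambda>M g. pprod ps (M + g)",
          OF I G(1) _ thc])
      show "pprod ps (M + g) \<in> span (pprod ps ` monomials ?H (n + d))" if "M \<in> ?I" "g \<in> G" for M g
        using that G(2) d[OF that(2)] thc
        by (intro span_mem) (auto simp: monomials_def intro!: imageI)
    qed (use fin less \<delta>_def in auto)
    then obtain c where c: "c \<in> ?I \<rightarrow> carrier K" "\<exists>i\<in>?I. c i \<noteq> \<zero>\<^bsub>K\<^esub>"
      "\<forall>g\<in>G. (\<Oplus>M\<in>?I. c M \<odot> pprod ps (M + g)) = \<zero>" by blast
    let ?S = "{M \<in> ?I. c M \<noteq> \<zero>\<^bsub>K\<^esub>}"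
    have "finite ?S" by (rule finite_subset[OF _ I]) blast
    moreover have "?S \<noteq> {}" using c(2) by blast
    ultimately have "\<exists>M\<in>?S. \<forall>M'\<in>?S. M' \<noteq> M \<longrightarrow> deglex M' M" by (rule deglex_max)
    then obtain M where M: "M \<in> ?S" "\<forall>M'\<in>?S. M' \<noteq> M \<longrightarrow> deglex M' M" by (elim bexE) (rule that)
    have "reducible ps M" unfolding reducible_def
    proof (intro exI[of _ ?I] exI[of _ c] conjI)
      show "\<forall>g. set_mset g \<subseteq> ?H \<longrightarrow> (\<Oplus>M\<in>?I. c M \<odot> pprod ps (M + g)) = \<zero>"
        by (rule G_all[OF I c(1) c(3)])
    qed (use I c(1) M in \<open>auto simp: N_def\<close>)
    with M(1) show False by (simp add: N_def)
  qed
  show ?thesis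
  proof (cases "{#} \<in> N")
    case False
    then have "reducible ps {#}" by (simp add: N_def)
    then have "N = {}" using reducible_add[OF ps, of "{#}"] by (auto simp: N_def)
    then show ?thesis using upper by simp
  next
    case True
    have down: "M \<in> N" if "M + L \<in> N" for M L
      using that reducible_add[OF ps, of M L] by (auto simp: N_def)
    have "\<exists>m c1 c2. 0 < c1 \<and> (\<forall>n\<ge>1. c1 * real n ^ m \<le> real (card (N \<inter> monomials ?H n))
        \<and> real (card (N \<inter> monomials ?H n)) \<le> c2 * real n ^ m)"
    proof (rule order_ideal_growth)
      show "set_mset M \<subseteq> ?H" if "M \<in> N" for M using that by (simp add: N_def)
      show "M \<in> N" if "M + L \<in> N" for M L using that by (rule down)
    qed (simp_all add: True)
    then obtain m c1 c2 where c1: "0 < c1" and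
      m: "\<forall>n\<ge>1. c1 * real n ^ m \<le> real (card (N \<inter> monomials ?H n))
        \<and> real (card (N \<inter> monomials ?H n)) \<le> c2 * real n ^ m" by (elim exE conjE) (rule that)
    have G0: "0 < card G"
    proof (rule ccontr)
      assume "\<not> ?thesis"
      then have "card (N \<inter> monomials ?H 0) = 0" using lower[of 0] by simp
      moreover have "{#} \<in> N \<inter> monomials ?H 0" using True by (simp add: monomials_def)
      ultimately show False using fin by (simp add: card_eq_0_iff)
    qed
    have "c1 / real (card G) * real n ^ m \<le> real (\<delta> (n + d))" if "1 \<le> n" for n
    proof -
      have "c1 * real n ^ m \<le> real (card G * \<delta> (n + d))"
        using m that lower[of n] by (meson of_nat_le_iff order.trans)
      then show ?thesis using G0 by (simp add: field_simps)
    qed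
    moreover have "real (\<delta> n) \<le> c2 * real n ^ m" if "1 \<le> n" for n
      using m that upper[of n] by (meson of_nat_le_iff order.trans)
    ultimately show ?thesis using c1 G0
      by (intro disjI2 exI[of _ m] exI[of _ d] exI[of _ "c1 / real (card G)"] exI[of _ c2]) simp
  qed
qed

end

section \<open>From words to power products\<close>

context vectorspace
begin

lemma dim_span_Un_le:
  assumes "finite X" "X \<subseteq> carrier V" "finite Y" "Y \<subseteq> carrier V"
  shows "span_dim (X \<union> Y)
    \<le> span_dim X + span_dim Y"
proof -
  obtain B where B: "finite B" "B \<subseteq> span X" "span B = span X"
    "span_dim X = card B" using span_basis[OF assms(1,2)] by metis
  obtain C where C: "finite C" "C \<subseteq> span Y" "span C = span Y"
    "span_dim Y = card C" using span_basis[OF assms(3,4)] by metis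
  have BC: "B \<union> C \<subseteq> carrier V"
    using B(2) C(2) span_is_subset2[OF assms(2)] span_is_subset2[OF assms(4)] by blast
  have "X \<subseteq> span B" "Y \<subseteq> span C"
    using in_own_span[OF assms(2)] in_own_span[OF assms(4)] B(3) C(3) by auto
  moreover have "span B \<subseteq> span (B \<union> C)" "span C \<subseteq> span (B \<union> C)"
    by (intro span_is_monotone Un_upper1, intro span_is_monotone Un_upper2)
  ultimately have "X \<union> Y \<subseteq> span (B \<union> C)" by blast
  then have "span_dim (X \<union> Y) \<le> card (B \<union> C)"
    using assms B(1) C(1) BC by (intro dim_span_le_card) auto
  also have "\<dots> \<le> card B + card C" by (rule card_Un_le)
  finally show ?thesis by (simp add: B(4) C(4))
qed

lemma dim_span_UN_le:
  assumes "finite I" "\<And>i. i \<in> I \<Longrightarrow> finite (X i)" "\<And>i. i \<in> I \<Longrightarrow> X i \<subseteq> carrier V"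
  shows "span_dim (\<Union>i\<in>I. X i) \<le> (\<Sum>i\<in>I. span_dim (X i))"
  using assms
proof (induction I rule: finite_induct)
  case empty
  show ?case using dim_span_le_card[of "{}" "{}"] by simp
next
  case (insert i I)
  have "span_dim (X i \<union> (\<Union>i\<in>I. X i))
      \<le> span_dim (X i) + span_dim (\<Union>i\<in>I. X i)"
    using insert by (intro dim_span_Un_le) auto
  also have "\<dots> \<le> span_dim (X i) + (\<Sum>i\<in>I. span_dim (X i))"
    using insert by auto
  finally show ?case using insert by simp
qed

end

text \<open>
A monotone function that is bounded below by a multiple of $n^m$ along an arithmetic progression is so everywhere. The \<open>min\<close> with 1
takes care of the arguments before the progression starts.
\<close>

lemma polynomial_lower_bound:
  fixes g :: "nat \<Rightarrow> nat"
  assumes mono: "\<And>a b. a \<le> b \<Longrightarrow> g a \<le> g b" and pos: "\<And>n. 1 \<le> g n"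
    and c: "0 < c" and P: "1 \<le> P" and low: "\<And>n. 1 \<le> n \<Longrightarrow> c * real n ^ m \<le> real (g (P * n + e))"
  shows "\<exists>c'>0. \<forall>n\<ge>1. c' * real n ^ m \<le> real (g n)"
proof -
  define q where "q = real (e + 2 * P)"
  have q: "0 < q" using P by (simp add: q_def)
  define c' where "c' = min c 1 / q ^ m"
  have c': "0 < c'" using c q by (simp add: c'_def)
  have "c' * real N ^ m \<le> real (g N)" if N: "1 \<le> N" for N
  proof (cases "P + e \<le> N")
    case False
    then have "real N \<le> q" by (simp add: q_def)
    then have "real N ^ m \<le> q ^ m" by (intro power_mono) auto
    then have "min c 1 * real N ^ m \<le> 1 * q ^ m" using c by (intro mult_mono) auto
    then have "c' * real N ^ m \<le> 1" using q by (simp add: c'_def field_simps)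
    also have "1 \<le> real (g N)" using pos[of N] by simp
    finally show ?thesis .
  next
    case True
    define n where "n = (N - e) div P"
    have n: "1 \<le> n" using True P by (simp add: n_def Suc_le_eq div_greater_zero_iff)
    have "P * n \<le> N - e" by (simp add: n_def)
    then have le: "P * n + e \<le> N" using True by simp
    have "N - e < P * (n + 1)" using P by (simp add: n_def dividend_less_times_div)
    then have "N \<le> e + P * (n + 1)" by simp
    also have "\<dots> \<le> (e + 2 * P) * n"
    proof -
      have "e * 1 \<le> e * n" "P * 1 \<le> P * n" using n by (rule mult_le_mono2)+
      moreover have "(e + 2 * P) * n = e * n + P * n + P * n" "P * (n + 1) = P * n + P"
        by (simp_all add: algebra_simps)
      ultimately show ?thesis by linarith
    qed
    finally have "real N \<le> q * real n" unfolding q_def of_nat_mult[symmetric] of_nat_le_iff .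
    then have "real N ^ m \<le> (q * real n) ^ m" by (intro power_mono) auto
    then have "real N ^ m \<le> q ^ m * real n ^ m" by (simp only: power_mult_distrib)
    then have "min c 1 * real N ^ m \<le> c * (q ^ m * real n ^ m)" using c by (intro mult_mono) auto
    then have "c' * real N ^ m \<le> c * real n ^ m" using q by (simp add: c'_def field_simps)
    also have "\<dots> \<le> real (g (P * n + e))" by (rule low[OF n])
    also have "\<dots> \<le> real (g N)" using mono[OF le] by simp
    finally show ?thesis .
  qed
  with c' show ?thesis by blast
qed

lemma power_product_cong:
  assumes "\<And>i. i < length ps \<Longrightarrow> k i = k' i"
  shows "power_product A ps k = power_product A ps k'"
  using assms
proof (induction ps arbitrary: k k')
  case (Cons ug ps)
  have "power_product A ps (\<lambda>i. k (Suc i)) = power_product A ps (\<lambda>i. k' (Suc i))"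
    using Cons.prems by (intro Cons.IH) auto
  then show ?case using Cons.prems[of 0] by simp
qed simp

lemma (in ring) list_prod_replicate:
  assumes "set u \<subseteq> carrier R"
  shows "list_prod R (concat (replicate k u)) = list_prod R u [^] k"
proof (induction k)
  case (Suc k)
  have "set (concat (replicate k u)) \<subseteq> carrier R" using assms by (induction k) auto
  then have "list_prod R (concat (replicate (Suc k) u)) = list_prod R u \<otimes> (list_prod R u [^] k)"
    using assms Suc by (simp add: list_prod_append)
  also have "\<dots> = list_prod R u [^] Suc k"
    using assms by (simp only: nat_pow_Suc2 list_prod_closed)
  finally show ?case .
qed simp

lemma set_power_form:
  assumes "\<forall>ug\<in>set ps. set (fst ug) \<subseteq> S \<and> set (snd ug) \<subseteq> S"
  shows "set (power_form ps k) \<subseteq> S"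
  using assms
proof (induction ps arbitrary: k)
  case (Cons ug ps)
  have "set (concat (replicate j u)) \<subseteq> set u" for j and u :: "'a list" by (induction j) auto
  then have "set (concat (replicate (k 0) (fst ug))) \<subseteq> S" using Cons.prems by (meson list.set_intros(1) subset_trans)
  moreover have "set (power_form ps (\<lambda>i. k (Suc i))) \<subseteq> S" using Cons.prems by (intro Cons.IH) simp
  moreover have "set (snd ug) \<subseteq> S" using Cons.prems by simp
  ultimately show ?case unfolding power_form.simps set_append by blast
qed simp

lemma length_power_form:
  assumes "\<forall>ug\<in>set ps. length (fst ug) \<le> P \<and> length (snd ug) \<le> Q"
  shows "length (power_form ps k) \<le> P * sum k {..<length ps} + Q * length ps"
  using assms
proof (induction ps arbitrary: k)
  case (Cons ug ps)
  have "length (power_form ps (\<lambda>i. k (Suc i))) \<le> P * sum (\<lambda>i. k (Suc i)) {..<length ps} + Q * length ps"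
    using Cons by auto
  moreover have "length (fst ug) * k 0 \<le> P * k 0" "length (snd ug) \<le> Q" using Cons.prems by simp_all
  moreover have "length (power_form (ug # ps) k)
      = length (fst ug) * k 0 + length (snd ug) + length (power_form ps (\<lambda>i. k (Suc i)))"
    by (simp add: length_concat sum_list_replicate)
  moreover have "P * sum k {..<length (ug # ps)} = P * k 0 + P * sum (\<lambda>i. k (Suc i)) {..<length ps}"
    by (simp add: sum.lessThan_Suc_shift distrib_left del: sum.lessThan_Suc)
  moreover have "Q * length (ug # ps) = Q + Q * length ps" by simp
  ultimately show ?case by linarith
qed simp

lemma (in ring) list_prod_power_form:
  assumes "\<forall>ug\<in>set ps. v ` set (fst ug) \<subseteq> carrier R \<and> v ` set (snd ug) \<subseteq> carrier R"
  shows "list_prod R (map v (power_form ps k))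
    = power_product R (map (\<lambda>ug. (list_prod R (map v (fst ug)), list_prod R (map v (snd ug)))) ps) k"
  using assms
proof (induction ps arbitrary: k)
  case (Cons ug ps)
  let ?S = "{x. v x \<in> carrier R}"
  have a: "set (map v (fst ug)) \<subseteq> carrier R" "set (map v (snd ug)) \<subseteq> carrier R" using Cons.prems by auto
  have "\<forall>ug\<in>set ps. set (fst ug) \<subseteq> ?S \<and> set (snd ug) \<subseteq> ?S"
    using Cons.prems by (simp add: image_subset_iff subset_iff)
  then have "set (power_form ps (\<lambda>i. k (Suc i))) \<subseteq> ?S" by (rule set_power_form)
  then have b: "set (map v (power_form ps (\<lambda>i. k (Suc i)))) \<subseteq> carrier R" by auto
  have c: "map v (concat (replicate (k 0) (fst ug))) = concat (replicate (k 0) (map v (fst ug)))"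
    by (simp add: map_concat map_replicate)
  have "set (concat (replicate j u)) \<subseteq> set u" for j and u :: "'a list" by (induction j) auto
  then have d: "set (concat (replicate (k 0) (map v (fst ug)))) \<subseteq> carrier R"
    using a(1) by (meson subset_trans)
  have "list_prod R (map v (power_form (ug # ps) k))
    = list_prod R (concat (replicate (k 0) (map v (fst ug)))) \<otimes>
      (list_prod R (map v (snd ug)) \<otimes> list_prod R (map v (power_form ps (\<lambda>i. k (Suc i)))))"
    using a b d by (simp only: power_form.simps map_append c list_prod_append set_append Un_subset_iff simp_thms)
  then show ?case using Cons a by (simp add: list_prod_replicate)
qed simp

lemma word_products_eq: "word_products A S n = list_prod A ` {ws. set ws \<subseteq> S \<and> length ws \<le> n}"
  by (auto simp: word_products_def list_prod_def)

lemma finite_word_products: "finite S \<Longrightarrow> finite (word_products A S n)"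
  unfolding word_products_eq by (intro finite_imageI finite_lists_length_le)

context unital_algebra
begin

lemma word_products_closed: "S \<subseteq> carrier A \<Longrightarrow> word_products A S n \<subseteq> carrier A"
  unfolding word_products_eq by (auto intro!: list_prod_closed)

lemma growth_eq: "growth K A S n = span_dim (word_products A S n)"
  by (simp add: growth_def word_space_def)

lemma growth_mono:
  assumes "finite S" "S \<subseteq> carrier A" "a \<le> b"
  shows "growth K A S a \<le> growth K A S b"
proof -
  have "word_products A S a \<subseteq> word_products A S b" unfolding word_products_eq using assms(3) by auto
  then have "word_products A S a \<subseteq> span (word_products A S b)"
    using in_own_span[OF word_products_closed[OF assms(2)]] by blast
  then show ?thesis unfolding growth_eq
    using assms by (intro dim_span_mono finite_word_products word_products_closed)
qed

lemma growth_pos: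
  assumes "finite S" "S \<subseteq> carrier A" "\<one> \<noteq> \<zero>"
  shows "1 \<le> growth K A S n"
proof -
  have one: "\<one> \<in> word_products A S n" unfolding word_products_eq by (rule image_eqI[of _ _ "[]"]) auto
  have "lin_indpt {\<one>}"
  proof (rule finite_lin_indpt2)
    fix a assume a: "a \<in> {\<one>} \<rightarrow> carrier K" "lincomb a {\<one>} = \<zero>"
    then have "a \<one> \<odot> \<one> = \<zero>" by (simp add: lincomb_def)
    with a(1) assms(3) mult_inverse[of "a \<one>" \<one> \<zero>] show "\<forall>v\<in>{\<one>}. a v = \<zero>\<^bsub>K\<^esub>"
      by (auto simp: Pi_iff)
  qed auto
  moreover have "{\<one>} \<subseteq> span (word_products A S n)"
    using one in_own_span[OF word_products_closed[OF assms(2)]] by blast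
  ultimately have "card {\<one>} \<le> growth K A S n" unfolding growth_eq
    using assms by (intro lin_indpt_card_le_dim finite_word_products word_products_closed) auto
  then show ?thesis by simp
qed

end

context finite_central_algebra
begin

text \<open>
The standard identity, multiplied by the parts of the word before and after the pattern, expresses the value of a decomposable word by the values of
the words with permuted blocks. They have the same length and are lexicographically smaller, so the process ends.
\<close>

lemma word_in_span_indecomposable:
  fixes v :: "nat \<Rightarrow> 'a" and w :: "nat list"
  assumes p: "card E < p" and v: "v ` {..<s} \<subseteq> carrier A" and w: "set w \<subseteq> {..<s}"
  shows "list_prod A (map v w) \<in> span ((\<lambda>w. list_prod A (map v w)) `
    {x. set x \<subseteq> {..<s} \<and> length x = length w \<and> \<not> decomposable l p x})"
  using w
proof (induction "card {x. set x \<subseteq> {..<s} \<and> length x = length w \<and> x < w}" arbitrary: w rule: less_induct)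
  case less
  let ?ev = "\<lambda>w. list_prod A (map v w)"
  let ?X = "?ev ` {x. set x \<subseteq> {..<s} \<and> length x = length w \<and> \<not> decomposable l p x}"
  have evc: "?ev x \<in> carrier A" if "set x \<subseteq> {..<s}" for x using that v by (intro list_prod_closed) auto
  have X: "?X \<subseteq> carrier A" using evc by auto
  show ?case
  proof (cases "decomposable l p w")
    case False
    then show ?thesis using less.prems X by (intro span_mem) auto
  next
    case True
    obtain a ws b where d: "w = a @ concat ws @ b" "length ws = p"
      "\<And>\<sigma>. \<sigma> permutes {..<p} \<Longrightarrow> \<sigma> \<noteq> id \<Longrightarrow> a @ concat (map (\<lambda>i. ws ! \<sigma> i) [0..<p]) @ b < w"
      "\<And>\<sigma>. \<sigma> permutes {..<p} \<Longrightarrow> mset (a @ concat (map (\<lambda>i. ws ! \<sigma> i) [0..<p]) @ b) = mset w"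
      by (rule decomposable_smaller[OF True]) (rule that, assumption+)
    let ?P = "{\<sigma>. \<sigma> permutes {..<p}}"
    define x where "x \<sigma> = a @ concat (map (\<lambda>i. ws ! \<sigma> i) [0..<p]) @ b" for \<sigma>
    have x: "set (x \<sigma>) \<subseteq> {..<s}" "length (x \<sigma>) = length w" if "\<sigma> \<in> ?P" for \<sigma>
      using d(4)[of \<sigma>] that less.prems mset_eq_setD[of "x \<sigma>" w] mset_eq_length[of "x \<sigma>" w]
      by (auto simp: x_def)
    have x_id: "x id = w" by (simp add: x_def d(1,2) map_nth[of ws, unfolded d(2)])
    define g where "g i = ?ev (ws ! i)" for i
    have wsl: "set (ws ! i) \<subseteq> {..<s}" if "i < p" for i
    proof -
      have "ws ! i \<in> set ws" using that d(2) by simp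
      then have "set (ws ! i) \<subseteq> set w" using d(1) by auto
      then show ?thesis using less.prems by blast
    qed
    have abl: "set a \<subseteq> {..<s}" "set b \<subseteq> {..<s}" using less.prems d(1) by auto
    have gc: "g \<in> {..<p} \<rightarrow> carrier A" using wsl evc by (auto simp: g_def)
    define f where "f \<sigma> = list_prod A (map (\<lambda>i. g (\<sigma> i)) [0..<p])" for \<sigma>
    have s': "\<sigma> i < p" if "\<sigma> \<in> ?P" "i < p" for \<sigma> i
      using permutes_in_image[of \<sigma> "{..<p}" i] that by simp
    have fc: "f \<sigma> \<in> carrier A" if "\<sigma> \<in> ?P" for \<sigma>
      unfolding f_def using gc s'[OF that] by (intro list_prod_closed) auto
    have ev_x: "?ev (x \<sigma>) = ?ev a \<otimes> (f \<sigma> \<otimes> ?ev b)" if \<sigma>: "\<sigma> \<in> ?P" for \<sigma>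
    proof -
      have wc: "v y \<in> carrier A" if "i < p" "y \<in> set (ws ! \<sigma> i)" for i y
        using wsl[OF s'[OF \<sigma> that(1)]] that(2) v by auto
      have "list_prod A (concat (map (\<lambda>i. map v (ws ! \<sigma> i)) [0..<p]))
          = list_prod A (map (list_prod A) (map (\<lambda>i. map v (ws ! \<sigma> i)) [0..<p]))"
        using wc by (intro list_prod_concat) auto
      also have "\<dots> = f \<sigma>" by (simp add: f_def g_def comp_def)
      finally have "list_prod A (concat (map (\<lambda>i. map v (ws ! \<sigma> i)) [0..<p])) = f \<sigma>" .
      moreover have "set (map v a) \<subseteq> carrier A" "set (map v b) \<subseteq> carrier A" using abl v by auto
      moreover have "set (concat (map (\<lambda>i. map v (ws ! \<sigma> i)) [0..<p])) \<subseteq> carrier A" using wc by auto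
      moreover have "map v (x \<sigma>) = map v a @ concat (map (\<lambda>i. map v (ws ! \<sigma> i)) [0..<p]) @ map v b"
        by (simp add: x_def map_concat comp_def)
      ultimately show ?thesis by (simp only: list_prod_append set_append Un_subset_iff simp_thms)
    qed
    define c where "c \<sigma> = (if evenperm \<sigma> then \<one>\<^bsub>K\<^esub> else \<ominus>\<^bsub>K\<^esub> \<one>\<^bsub>K\<^esub>)" for \<sigma> :: "nat \<Rightarrow> nat"
    have c: "c \<sigma> \<in> carrier K" for \<sigma> by (simp add: c_def)
    have rel: "(\<Oplus>\<sigma>\<in>?P. c \<sigma> \<odot> ?ev (x \<sigma>)) = \<zero>"
    proof -
      have "(\<Oplus>\<sigma>\<in>?P. c \<sigma> \<odot> f \<sigma>) = standard_poly p g"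
        unfolding standard_poly_def f_def[symmetric] using fc
        by (intro M.finsum_cong') (auto simp: c_def smult_minus_1)
      then have 0: "(\<Oplus>\<sigma>\<in>?P. c \<sigma> \<odot> f \<sigma>) = \<zero>"
        using standard_identity[OF E p gc] by simp
      have "(\<Oplus>\<sigma>\<in>?P. c \<sigma> \<odot> ?ev (x \<sigma>)) = (\<Oplus>\<sigma>\<in>?P. ?ev a \<otimes> ((c \<sigma> \<odot> f \<sigma>) \<otimes> ?ev b))"
        using fc c evc abl ev_x by (intro M.finsum_cong') (auto simp: smult_mult_left smult_mult_right)
      also have "\<dots> = ?ev a \<otimes> (\<Oplus>\<sigma>\<in>?P. (c \<sigma> \<odot> f \<sigma>) \<otimes> ?ev b)"
        using fc c evc[OF abl(1)] evc[OF abl(2)] finite_perms by (intro alg.finsum_rdistr[symmetric]) auto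
      also have "(\<Oplus>\<sigma>\<in>?P. (c \<sigma> \<odot> f \<sigma>) \<otimes> ?ev b) = (\<Oplus>\<sigma>\<in>?P. c \<sigma> \<odot> f \<sigma>) \<otimes> ?ev b"
        using fc c evc[OF abl(2)] finite_perms by (intro alg.finsum_ldistr[symmetric]) auto
      finally show ?thesis using 0 evc[OF abl(1)] evc[OF abl(2)] by simp
    qed
    have "?ev (x id) \<in> span ?X"
    proof (rule in_span_if_relation[where I = ?P and c = c, OF _ _ X _ _ _ rel])
      show "finite ?P" by (rule finite_perms)
      show "id \<in> ?P" by (simp add: permutes_id)
      show "c id \<noteq> \<zero>\<^bsub>K\<^esub>" by (simp add: c_def evenperm_id)
      fix \<sigma> assume \<sigma>: "\<sigma> \<in> ?P" "\<sigma> \<noteq> id"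
      have lt: "x \<sigma> < w" using d(3) \<sigma> by (simp add: x_def)
      have "{y. set y \<subseteq> {..<s} \<and> length y = length w \<and> y < x \<sigma>}
          \<subset> {y. set y \<subseteq> {..<s} \<and> length y = length w \<and> y < w}"
        using lt x[OF \<sigma>(1)] by (auto intro: less_trans)
      moreover have "finite {y. set y \<subseteq> {..<s} \<and> length y = length w \<and> y < w}"
        by (rule finite_subset[OF _ finite_lists_length_eq[of "{..<s}" "length w"]]) auto
      ultimately have "card {y. set y \<subseteq> {..<s} \<and> length y = length (x \<sigma>) \<and> y < x \<sigma>}
          < card {y. set y \<subseteq> {..<s} \<and> length y = length w \<and> y < w}"
        using x(2)[OF \<sigma>(1)] by (simp add: psubset_card_mono)
      then show "?ev (x \<sigma>) \<in> span ?X" using less.hyps[of "x \<sigma>"] x[OF \<sigma>(1)] by simp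
    qed (use c evc x in auto)
    then show ?thesis by (simp only: x_id)
  qed
qed

end

section \<open>Polynomial growth of algebras finite over a central subring\<close>

context finite_central_algebra
begin

text \<open>
The space of products of length at most \<open>n\<close> lies in the sum of finitely many spaces spanned by power products, each
of which has polynomial growth and lies, in turn, in a space of products of length linear in \<open>n\<close>. The largest of the exponents is
the exponent for the algebra.
\<close>

theorem growth_polynomial:
  assumes S: "finite S" "S \<subseteq> carrier A" and nontrivial: "\<one> \<noteq> \<zero>"
  shows "\<exists>m c1 c2. 0 < c1 \<and> (\<forall>n\<ge>1. c1 * real n ^ m \<le> real (growth K A S n)
    \<and> real (growth K A S n) \<le> c2 * real n ^ m)"
proof -
  obtain s and v :: "nat \<Rightarrow> 'a" where v: "S = v ` {..<s}"
    using finite_imp_nat_seg_image_inj_on[OF S(1)] unfolding lessThan_def by metis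
  have vc: "v ` {..<s} \<subseteq> carrier A" using S(2) v by simp
  define p where "p = Suc (card E)"
  define P :: nat where "P = fact p"
  have P: "1 \<le> P" by (simp add: P_def)
  \<comment> \<open>Factors of this length make windows that are not rich show the period \<open>P\<close>; \<open>B\<close> bounds the number of defects.\<close>
  define l where "l = p + P"
  define B where "B = s ^ (l + p) * (p * (l + p)) + p + (l + p)"
  let ?ev = "\<lambda>w. list_prod A (map v w)"
  have evc: "?ev x \<in> carrier A" if "set x \<subseteq> {..<s}" for x
    using that vc by (intro list_prod_closed) auto
  define U where "U Q = {u. set u \<subseteq> {..<s} \<and> length u \<le> Q}" for Q
  have finU: "finite (U Q)" for Q unfolding U_def by (rule finite_lists_length_le) simp
  define Ps where "Ps = {ps. set ps \<subseteq> U P \<times> U (2 * P) \<and> length ps = Suc B}"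
  have finPs: "finite Ps" unfolding Ps_def by (intro finite_lists_length_eq finite_cartesian_product finU)
  define ev2 where "ev2 = map (\<lambda>ug. (?ev (fst ug), ?ev (snd ug)))"
  have ev2c: "set (ev2 ps) \<subseteq> carrier A \<times> carrier A" if "ps \<in> Ps" for ps
    using that evc by (fastforce simp: ev2_def Ps_def U_def)
  have len: "length (ev2 ps) = Suc B" if "ps \<in> Ps" for ps using that by (simp add: ev2_def Ps_def)
  have psU: "set (fst ug) \<subseteq> {..<s}" "set (snd ug) \<subseteq> {..<s}" "length (fst ug) \<le> P" "length (snd ug) \<le> 2 * P"
    if "ps \<in> Ps" "ug \<in> set ps" for ps ug
  proof -
    have "ug \<in> U P \<times> U (2 * P)" using that by (auto simp: Ps_def)
    then show "set (fst ug) \<subseteq> {..<s}" "set (snd ug) \<subseteq> {..<s}"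
      "length (fst ug) \<le> P" "length (snd ug) \<le> 2 * P" by (auto simp: U_def mem_Times_iff)
  qed
  have form: "?ev (power_form ps k) = power_product A (ev2 ps) k" if "ps \<in> Ps" for ps k
    unfolding ev2_def using psU[OF that] vc by (intro list_prod_power_form) (meson image_mono subset_trans)
  define X where "X n ps = pprod (ev2 ps) ` monomials {..<Suc B} n" for n ps
  have X: "finite (X n ps)" "X n ps \<subseteq> carrier A" if "ps \<in> Ps" for n ps
    using finite_monomials[of "{..<Suc B}" n] ev2c[OF that] by (auto simp: X_def)
  define \<delta> where "\<delta> ps n = span_dim (X n ps)" for ps n
  let ?g = "growth K A S"
  let ?W = "\<lambda>n. word_products A S n"
  have W: "finite (?W n)" "?W n \<subseteq> carrier A" for n
    using S finite_word_products word_products_closed by auto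

  have "?W n \<subseteq> span (\<Union>ps\<in>Ps. X n ps)" for n
  proof
    fix a assume "a \<in> ?W n"
    then obtain vs where vs: "set vs \<subseteq> S" "length vs \<le> n" "a = list_prod A vs"
      unfolding word_products_eq by blast
    have "vs \<in> lists (v ` {..<s})" using vs(1) v by auto
    then obtain w where w: "set w \<subseteq> {..<s}" "vs = map v w" by (auto simp: lists_image)
    have "?ev w \<in> span (?ev ` {x. set x \<subseteq> {..<s} \<and> length x = length w \<and> \<not> decomposable l p x})"
      by (rule word_in_span_indecomposable[OF _ vc w(1)]) (simp add: p_def)
    moreover have "?ev ` {x. set x \<subseteq> {..<s} \<and> length x = length w \<and> \<not> decomposable l p x}
        \<subseteq> (\<Union>ps\<in>Ps. X n ps)"
    proof
      fix y assume "y \<in> ?ev ` {x. set x \<subseteq> {..<s} \<and> length x = length w \<and> \<not> decomposable l p x}"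
      then obtain x where x: "y = ?ev x" "set x \<subseteq> {..<s}" "length x = length w" "\<not> decomposable l p x"
        by blast
      have "card (defects P x) \<le> B"
        using card_defects_le[OF x(4) _ x(2)] by (simp add: p_def B_def P_def l_def)
      from power_form_of_few_defects[OF this] P obtain ps k where
        ps: "length ps = Suc B" "x = power_form ps k" "sum k {..<Suc B} \<le> length x"
        "\<forall>ug\<in>set ps. length (fst ug) \<le> P \<and> length (snd ug) \<le> 2 * P
          \<and> set (fst ug) \<subseteq> set x \<and> set (snd ug) \<subseteq> set x" by auto
      have "set ps \<subseteq> U P \<times> U (2 * P)"
      proof
        fix ug assume "ug \<in> set ps"
        with ps(4) x(2) show "ug \<in> U P \<times> U (2 * P)"
          unfolding U_def mem_Times_iff by blast
      qed
      then have psP: "ps \<in> Ps" using ps(1) by (simp add: Ps_def)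
      define M where "M = (\<Sum>i\<in>{..<Suc B}. replicate_mset (k i) i)"
      have cM: "count M i = (if i < Suc B then k i else 0)" for i
        unfolding M_def by (subst count_sum_replicate) auto
      have "size M = sum k {..<Suc B}" unfolding M_def by (rule size_sum_replicate) simp
      then have "size M \<le> n" using ps(3) x(3) vs(2) w(2) by simp
      moreover have "set_mset M \<subseteq> {..<Suc B}"
      proof
        fix i assume "i \<in># M"
        then have "count M i \<noteq> 0" by simp
        then show "i \<in> {..<Suc B}" using cM[of i] by (metis lessThan_iff)
      qed
      ultimately have "M \<in> monomials {..<Suc B} n" by (simp add: monomials_def)
      moreover have "y = pprod (ev2 ps) M"
        unfolding x(1) ps(2) form[OF psP] using len[OF psP] cM by (intro power_product_cong) simp
      ultimately show "y \<in> (\<Union>ps\<in>Ps. X n ps)" using psP by (auto simp: X_def)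
    qed
    ultimately show "a \<in> span (\<Union>ps\<in>Ps. X n ps)"
      using span_is_monotone vs(3) w(2) by blast
  qed
  moreover have "finite (\<Union>ps\<in>Ps. X n ps)" "(\<Union>ps\<in>Ps. X n ps) \<subseteq> carrier A" for n
    using finPs X(1) by (intro finite_UN_I) (use X(2) in blast)+
  ultimately have "?g n \<le> span_dim (\<Union>ps\<in>Ps. X n ps)" for n
    unfolding growth_eq using W by (intro dim_span_mono)
  moreover have "span_dim (\<Union>ps\<in>Ps. X n ps) \<le> (\<Sum>ps\<in>Ps. \<delta> ps n)" for n
    unfolding \<delta>_def using finPs X by (intro dim_span_UN_le)
  ultimately have upper: "?g n \<le> (\<Sum>ps\<in>Ps. \<delta> ps n)" for n by (rule order.trans)

  have lower: "\<delta> ps n \<le> ?g (P * n + 2 * P * Suc B)" if ps: "ps \<in> Ps" for ps n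
    unfolding \<delta>_def growth_eq
  proof (rule dim_span_mono)
    show "X n ps \<subseteq> span (?W (P * n + 2 * P * Suc B))"
    proof
      fix y assume "y \<in> X n ps"
      then obtain M where M: "M \<in> monomials {..<Suc B} n" "y = pprod (ev2 ps) M" by (auto simp: X_def)
      let ?w = "power_form ps (count M)"
      have sw: "set ?w \<subseteq> {..<s}" using psU[OF ps] by (intro set_power_form) blast
      have "size M = sum (count M) (set_mset M)" by (simp add: size_multiset_overloaded_eq)
      also have "\<dots> = sum (count M) {..<Suc B}"
        using M(1) by (intro sum.mono_neutral_left) (auto simp: monomials_def count_eq_zero_iff)
      finally have "sum (count M) {..<Suc B} \<le> n" using M(1) by (simp add: monomials_def)
      then have "P * sum (count M) {..<Suc B} \<le> P * n" by (rule mult_le_mono2)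
      moreover have "length ps = Suc B" using ps by (simp add: Ps_def)
      then have "length ?w \<le> P * sum (count M) {..<Suc B} + 2 * P * Suc B"
        using length_power_form[of ps P "2 * P" "count M"] psU[OF ps] by metis
      ultimately have lw: "length ?w \<le> P * n + 2 * P * Suc B" by linarith
      have "set (map v ?w) \<subseteq> S" using sw v by auto
      then have "y \<in> ?W (P * n + 2 * P * Suc B)"
        unfolding M(2) form[OF ps, symmetric] word_products_eq using lw by (intro imageI) simp
      then show "y \<in> span (?W (P * n + 2 * P * Suc B))" using in_own_span[OF W(2)] by blast
    qed
  qed (use W X ps in auto)

  have g1: "1 \<le> ?g n" for n by (rule growth_pos[OF S nontrivial])
  have th: "(\<forall>n. \<delta> ps n = 0) \<or> (\<exists>m d c1 c2. 0 < c1 \<and>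
    (\<forall>n\<ge>1. real (\<delta> ps n) \<le> c2 * real n ^ m \<and> c1 * real n ^ m \<le> real (\<delta> ps (n + d))))"
    if "ps \<in> Ps" for ps
    using power_product_growth[OF ev2c[OF that]] unfolding \<delta>_def X_def len[OF that] .
  \<comment> \<open>The pairs for which all power products vanish have no growth exponent and contribute nothing.\<close>
  define Q where "Q = {ps \<in> Ps. \<exists>n. \<delta> ps n \<noteq> 0}"
  have "\<forall>ps\<in>Q. \<exists>m d c1 c2. 0 < c1 \<and>
    (\<forall>n\<ge>1. real (\<delta> ps n) \<le> c2 * real n ^ m \<and> c1 * real n ^ m \<le> real (\<delta> ps (n + d)))"
  proof
    fix ps assume "ps \<in> Q"
    then have psP: "ps \<in> Ps" and nz: "\<not> (\<forall>n. \<delta> ps n = 0)" by (simp_all add: Q_def)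
    from th[OF psP] show "\<exists>m d c1 c2. 0 < c1 \<and>
      (\<forall>n\<ge>1. real (\<delta> ps n) \<le> c2 * real n ^ m \<and> c1 * real n ^ m \<le> real (\<delta> ps (n + d)))"
      by (rule disjE) (rule notE[OF nz], assumption+)
  qed
  from bchoice[OF this] obtain m where m: "\<forall>ps\<in>Q. \<exists>d c1 c2. 0 < c1 \<and>
    (\<forall>n\<ge>1. real (\<delta> ps n) \<le> c2 * real n ^ m ps \<and> c1 * real n ^ m ps \<le> real (\<delta> ps (n + d)))" ..
  then have "\<forall>ps\<in>Q. \<exists>c2. \<forall>n\<ge>1. real (\<delta> ps n) \<le> c2 * real n ^ m ps" by meson
  from bchoice[OF this] obtain c2 where
    c2: "\<forall>ps\<in>Q. \<forall>n\<ge>1. real (\<delta> ps n) \<le> c2 ps * real n ^ m ps" ..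
  have finQ: "finite Q" using finPs by (simp add: Q_def)
  have sumQ: "(\<Sum>ps\<in>Ps. \<delta> ps n) = (\<Sum>ps\<in>Q. \<delta> ps n)" for n
    using finPs by (intro sum.mono_neutral_right) (auto simp: Q_def)
  have "Q \<noteq> {}"
  proof
    assume "Q = {}"
    then have "(\<Sum>ps\<in>Q. \<delta> ps 0) = 0" by (simp only: sum.empty)
    with upper[of 0] sumQ[of 0] g1[of 0] show False by linarith
  qed
  define m' where "m' = Max (m ` Q)"
  have "m' \<in> m ` Q" unfolding m'_def using finQ \<open>Q \<noteq> {}\<close> by (intro Max_in) auto
  then obtain q where q: "q \<in> Q" "m q = m'" by auto
  have qP: "q \<in> Ps" using q(1) by (simp add: Q_def)
  have mle: "m ps \<le> m'" if "ps \<in> Q" for ps unfolding m'_def using finQ that by (intro Max_ge) auto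
  define C where "C = (\<Sum>ps\<in>Q. \<bar>c2 ps\<bar>)"
  have up: "real (?g n) \<le> C * real n ^ m'" if n: "1 \<le> n" for n
  proof -
    have "real (?g n) \<le> (\<Sum>ps\<in>Q. real (\<delta> ps n))"
      using upper[of n] unfolding sumQ by (metis of_nat_le_iff of_nat_sum)
    also have "\<dots> \<le> (\<Sum>ps\<in>Q. \<bar>c2 ps\<bar> * real n ^ m')"
    proof (rule sum_mono)
      fix ps assume ps: "ps \<in> Q"
      have "real (\<delta> ps n) \<le> c2 ps * real n ^ m ps" using c2 ps n by blast
      also have "\<dots> \<le> \<bar>c2 ps\<bar> * real n ^ m'"
        using n mle[OF ps] by (intro mult_mono power_increasing) auto
      finally show "real (\<delta> ps n) \<le> \<bar>c2 ps\<bar> * real n ^ m'" .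
    qed
    also have "\<dots> = C * real n ^ m'" by (simp add: C_def sum_distrib_right)
    finally show ?thesis .
  qed
  obtain d c1 where c1: "0 < c1" "\<forall>n\<ge>1. c1 * real n ^ m' \<le> real (\<delta> q (n + d))"
    using bspec[OF m q(1)] unfolding q(2) by meson
  have "\<exists>c'>0. \<forall>n\<ge>1. c' * real n ^ m' \<le> real (?g n)"
  proof (rule polynomial_lower_bound[OF _ g1 _ P])
    show "0 < c1" by (rule c1(1))
    show "?g a \<le> ?g b" if "a \<le> b" for a b by (rule growth_mono[OF S that])
    show "c1 * real n ^ m' \<le> real (?g (P * n + (P * d + 2 * P * Suc B)))" if n: "1 \<le> n" for n
    proof -
      have "c1 * real n ^ m' \<le> real (\<delta> q (n + d))" using c1(2) n by blast
      also have "\<dots> \<le> real (?g (P * (n + d) + 2 * P * Suc B))" using lower[OF qP] by simp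
      finally show ?thesis by (simp add: distrib_left add.assoc)
    qed
  qed
  with up show ?thesis by blast
qed

end

section \<open>Growth degree and the Gelfand-Kirillov dimension\<close>

lemma span_image_linear:
  assumes "linear_map K V W f" "inj_on f (carrier V)" and X: "X \<subseteq> carrier V" "finite X"
  shows "LinearCombinations.module.span K W (f ` X) = f ` LinearCombinations.module.span K V X"
proof -
  interpret linear_map K V W f by (rule assms(1))
  have fX: "f ` X \<subseteq> carrier W" using X(1) by auto
  have inj: "inj_on f X" using assms(2) X(1) by (rule inj_on_subset)
  show ?thesis
  proof
    show "W.module.span (f ` X) \<subseteq> f ` V.module.span X"
    proof
      fix y assume "y \<in> W.module.span (f ` X)"
      then obtain a where a: "a \<in> f ` X \<rightarrow> carrier K" "W.module.lincomb a (f ` X) = y"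
        using W.module.finite_in_span[of "f ` X" y] X(2) fX by auto
      have "y = f (V.module.lincomb (a \<circ> f) X)"
        using lincomb_linear_image[OF assms(2) X(1) a(1) X(2)] a(2) by simp
      moreover have "V.module.lincomb (a \<circ> f) X \<in> V.module.span X"
        unfolding V.module.span_def using X(2) a(1) by fastforce
      ultimately show "y \<in> f ` V.module.span X" by blast
    qed
    show "f ` V.module.span X \<subseteq> W.module.span (f ` X)"
    proof
      fix y assume "y \<in> f ` V.module.span X"
      then obtain x where x: "x \<in> V.module.span X" "y = f x" by blast
      then obtain a where a: "a \<in> X \<rightarrow> carrier K" "V.module.lincomb a X = x"
        using V.module.finite_in_span[OF X(2,1)] by blast
      let ?b = "\<lambda>z. a (inv_into X f z)"
      have b: "?b \<in> f ` X \<rightarrow> carrier K" using a(1) inj by (auto simp: Pi_iff)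
      have "V.module.lincomb (?b \<circ> f) X = V.module.lincomb a X"
        using X(1) a(1) inj by (intro V.module.lincomb_cong) auto
      then have "W.module.lincomb ?b (f ` X) = y"
        using lincomb_linear_image[OF assms(2) X(1) b X(2)] a(2) x(2) by simp
      then show "y \<in> W.module.span (f ` X)"
        unfolding W.module.span_def using X(2) b by blast
    qed
  qed
qed

lemma dim_span_image:
  assumes lin: "linear_map K V W f" and inj: "inj_on f (carrier V)"
    and X: "X \<subseteq> carrier V" "finite X"
  shows "vectorspace.dim K (W\<lparr>carrier := LinearCombinations.module.span K W (f ` X)\<rparr>)
    = vectorspace.dim K (V\<lparr>carrier := LinearCombinations.module.span K V X\<rparr>)"
proof -
  interpret linear_map K V W f by (rule lin)
  have fX: "f ` X \<subseteq> carrier W" "finite (f ` X)" using X by auto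
  note spX = span_image_linear[OF lin inj X]
  show ?thesis
  proof (rule antisym)
    obtain B where B: "finite B" "B \<subseteq> V.module.span X" "V.module.span B = V.module.span X"
      "vectorspace.dim K (V.vs (V.module.span X)) = card B"
      using V.span_basis[OF X(2,1)] by metis
    have BV: "B \<subseteq> carrier V" using B(2) V.module.span_is_subset2[OF X(1)] by blast
    have "f ` X \<subseteq> f ` V.module.span B" using B(3) V.module.in_own_span[OF X(1)] by blast
    then have "f ` X \<subseteq> W.module.span (f ` B)" using span_image_linear[OF lin inj BV B(1)] by simp
    then have "vectorspace.dim K (W.vs (W.module.span (f ` X))) \<le> card (f ` B)"
      using fX B(1) BV by (intro W.dim_span_le_card) auto
    also have "\<dots> \<le> card B" using B(1) by (rule card_image_le)
    finally show "vectorspace.dim K (W.vs (W.module.span (f ` X)))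
        \<le> vectorspace.dim K (V.vs (V.module.span X))" by (simp add: B(4))
  next
    obtain C where C: "finite C" "C \<subseteq> W.module.span (f ` X)" "W.module.span C = W.module.span (f ` X)"
      "vectorspace.dim K (W.vs (W.module.span (f ` X))) = card C"
      using W.span_basis[OF fX(2,1)] by metis
    then obtain B where B: "B \<subseteq> V.module.span X" "finite B" "C = f ` B"
      unfolding spX by (meson finite_subset_image)
    have BV: "B \<subseteq> carrier V" using B(1) V.module.span_is_subset2[OF X(1)] by blast
    have cB: "card C = card B" unfolding B(3) using inj BV by (intro card_image) (rule inj_on_subset)
    have eq: "f ` V.module.span X = f ` V.module.span B"
      using C(3) spX span_image_linear[OF lin inj BV B(2)] B(3) by simp
    have "X \<subseteq> V.module.span B"
    proof
      fix x assume x: "x \<in> X"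
      then have "f x \<in> f ` V.module.span B" using eq V.module.in_own_span[OF X(1)] by blast
      then obtain y where y: "y \<in> V.module.span B" "f x = f y" by blast
      have "y \<in> carrier V" "x \<in> carrier V" using y(1) V.module.span_is_subset2[OF BV] x X(1) by auto
      then show "x \<in> V.module.span B" using y inj by (metis inj_onD)
    qed
    then have "vectorspace.dim K (V.vs (V.module.span X)) \<le> card B"
      using X(2) B(2) BV by (intro V.dim_span_le_card)
    then show "vectorspace.dim K (V.vs (V.module.span X))
        \<le> vectorspace.dim K (W.vs (W.module.span (f ` X)))" by (simp add: C(4) cB)
  qed
qed

text \<open>
The growth of a subset is computed inside the subalgebra that it generates, so it is the same in any larger algebra.
\<close>

lemma growth_image:
  assumes R: "unital_algebra K R" and A: "unital_algebra K A"
    and f: "f \<in> Ring.ring_hom R A" "inj_on f (carrier R)"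
    and smult: "\<And>c x. c \<in> carrier K \<Longrightarrow> x \<in> carrier R \<Longrightarrow> f (c \<odot>\<^bsub>R\<^esub> x) = c \<odot>\<^bsub>A\<^esub> f x"
    and S: "finite S" "S \<subseteq> carrier R"
  shows "growth K A (f ` S) n = growth K R S n"
proof -
  interpret R: unital_algebra K R by (rule R)
  interpret A: unital_algebra K A by (rule A)
  have lin: "linear_map K R A f"
    unfolding linear_map_def mod_hom_def mod_hom_axioms_def module_hom_def
    using R.vectorspace_axioms A.vectorspace_axioms R.module_axioms A.module_axioms f(1) smult
    by (auto simp: Ring.ring_hom_def)
  have prod: "f (list_prod R ws) = list_prod A (map f ws)" if "set ws \<subseteq> carrier R" for ws
    using that f(1) by (induction ws) (auto simp: Ring.ring_hom_def)
  have "word_products A (f ` S) n = f ` word_products R S n"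
  proof
    show "word_products A (f ` S) n \<subseteq> f ` word_products R S n"
    proof
      fix y assume "y \<in> word_products A (f ` S) n"
      then obtain vs where vs: "set vs \<subseteq> f ` S" "length vs \<le> n" "y = list_prod A vs"
        unfolding word_products_eq by blast
      then have "vs \<in> lists (f ` S)" by auto
      then obtain ws where ws: "set ws \<subseteq> S" "vs = map f ws" by (auto simp: lists_image)
      then have "y = f (list_prod R ws)" using vs(3) prod[of ws] S(2) by auto
      then show "y \<in> f ` word_products R S n"
        unfolding word_products_eq using ws vs(2) by auto
    qed
    show "f ` word_products R S n \<subseteq> word_products A (f ` S) n"
    proof
      fix y assume "y \<in> f ` word_products R S n"
      then obtain ws where ws: "set ws \<subseteq> S" "length ws \<le> n" "y = f (list_prod R ws)"
        unfolding word_products_eq by blast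
      then have "y = list_prod A (map f ws)" using prod[of ws] S(2) by auto
      then show "y \<in> word_products A (f ` S) n"
        unfolding word_products_eq using ws(1,2) by (intro image_eqI[of _ _ "map f ws"]) auto
    qed
  qed
  then show ?thesis unfolding R.growth_eq A.growth_eq
    using dim_span_image[OF lin f(2) R.word_products_closed[OF S(2)] finite_word_products[OF S(1)]]
    by (simp only:)
qed

context unital_algebra
begin

lemma span_mult:
  assumes X: "X \<subseteq> carrier A" and Y: "Y \<subseteq> carrier A" and W: "W \<subseteq> carrier A"
    and XY: "\<And>x y. x \<in> X \<Longrightarrow> y \<in> Y \<Longrightarrow> x \<otimes> y \<in> span W"
    and x: "x \<in> span X" and y: "y \<in> span Y"
  shows "x \<otimes> y \<in> span W"
proof -
  note S = span_is_submodule[OF W]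
  have xY: "x' \<otimes> y \<in> span W" if x': "x' \<in> X" for x'
  proof -
    have x'c: "x' \<in> carrier A" using x' X by blast
    have "submodule K {y \<in> carrier A. x' \<otimes> y \<in> span W} A"
      using x'c submodule.m_closed[OF S] submodule.zero_closed[OF S] submodule.smult_closed[OF S]
      by unfold_locales (auto simp: alg.r_distr smult_mult_right)
    then have "span Y \<subseteq> {y \<in> carrier A. x' \<otimes> y \<in> span W}"
      using XY[OF x'] Y by (intro span_is_subset) auto
    then show ?thesis using y by blast
  qed
  have yc: "y \<in> carrier A" using y span_is_subset2[OF Y] by blast
  have "submodule K {x \<in> carrier A. x \<otimes> y \<in> span W} A"
    using yc submodule.m_closed[OF S] submodule.zero_closed[OF S] submodule.smult_closed[OF S]
    by unfold_locales (auto simp: alg.l_distr smult_mult_left)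
  then have "span X \<subseteq> {x \<in> carrier A. x \<otimes> y \<in> span W}"
    using xY X by (intro span_is_subset) auto
  then show ?thesis using x by blast
qed

lemma span_word_products_mult:
  assumes S: "S \<subseteq> carrier A" and "x \<in> span (word_products A S a)" "y \<in> span (word_products A S b)"
  shows "x \<otimes> y \<in> span (word_products A S (a + b))"
proof (rule span_mult[OF _ _ _ _ assms(2,3)])
  fix x y assume "x \<in> word_products A S a" "y \<in> word_products A S b"
  then obtain u v where "set u \<subseteq> S" "length u \<le> a" "x = list_prod A u"
    "set v \<subseteq> S" "length v \<le> b" "y = list_prod A v" unfolding word_products_eq by blast
  then have "x \<otimes> y = list_prod A (u @ v)" "set (u @ v) \<subseteq> S" "length (u @ v) \<le> a + b"
    using S alg.list_prod_append[of u v] by auto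
  then have "x \<otimes> y \<in> word_products A S (a + b)" unfolding word_products_eq by blast
  then show "x \<otimes> y \<in> span (word_products A S (a + b))"
    by (rule span_mem[OF word_products_closed[OF S]])
qed (intro word_products_closed S)+

lemma span_word_products_mono:
  assumes "a \<le> b"
  shows "span (word_products A S a) \<subseteq> span (word_products A S b)"
  unfolding word_products_eq using assms by (intro span_is_monotone image_mono) auto

text \<open>
Passing to another finite subset of the algebra generated by \<open>S\<close> only rescales the argument of the growth function.
\<close>

lemma growth_le_rescaled:
  assumes S: "finite S" "S \<subseteq> carrier A" and T: "finite T" "T \<subseteq> span (word_products A S q)"
  shows "growth K A T n \<le> growth K A S (q * n)"
proof -
  have Tc: "T \<subseteq> carrier A" using T(2) span_is_subset2[OF word_products_closed[OF S(2)]] by blast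
  have prod: "list_prod A ws \<in> span (word_products A S (q * length ws))" if "set ws \<subseteq> T" for ws
    using that
  proof (induction ws)
    case Nil
    have "\<one> \<in> word_products A S 0" unfolding word_products_eq by (rule image_eqI[of _ _ "[]"]) auto
    then show ?case using span_mem[OF word_products_closed[OF S(2)]] by simp
  next
    case (Cons t ws)
    then have "t \<otimes> list_prod A ws \<in> span (word_products A S (q + q * length ws))"
      using T(2) by (intro span_word_products_mult S(2)) auto
    then show ?case by simp
  qed
  have "word_products A T n \<subseteq> span (word_products A S (q * n))"
  proof
    fix x assume "x \<in> word_products A T n"
    then obtain ws where ws: "set ws \<subseteq> T" "length ws \<le> n" "x = list_prod A ws"
      unfolding word_products_eq by blast
    then show "x \<in> span (word_products A S (q * n))"
      using prod[OF ws(1)] span_word_products_mono[of "q * length ws" "q * n"] by auto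
  qed
  then show ?thesis unfolding growth_eq
    using S T(1) by (intro dim_span_mono finite_word_products word_products_closed)
qed

lemma generated_in_span:
  assumes S: "S \<subseteq> carrier A" and x: "x \<in> subalgebra_generated K A S"
  shows "\<exists>q. x \<in> span (word_products A S q)"
  using x
proof (induction rule: subalgebra_generated.induct)
  note W = word_products_closed[OF S]
  {
    case one
    have "\<one> \<in> word_products A S 0" unfolding word_products_eq by (rule image_eqI[of _ _ "[]"]) auto
    then show ?case using span_mem[OF W] by blast
  next
    case (incl x)
    then have "x \<in> word_products A S 1"
      unfolding word_products_eq using S by (intro image_eqI[of _ _ "[x]"]) auto
    then show ?case using span_mem[OF W] by blast
  next
    case (add x y)
    then obtain a b where "x \<in> span (word_products A S a)" "y \<in> span (word_products A S b)" by blast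
    then have "x \<in> span (word_products A S (max a b))" "y \<in> span (word_products A S (max a b))"
      using span_word_products_mono[of a "max a b"] span_word_products_mono[of b "max a b"] by auto
    then show ?case using submodule.m_closed[OF span_is_submodule[OF W]] by blast
  next
    case (mult x y)
    then show ?case using span_word_products_mult[OF S] by blast
  next
    case (smult c x)
    then show ?case using submodule.smult_closed[OF span_is_submodule[OF W]] by blast
  }
qed

lemma finite_in_span_word_products:
  assumes S: "S \<subseteq> carrier A" "subalgebra_generated K A S = carrier A"
    and T: "finite T" "T \<subseteq> carrier A"
  shows "\<exists>q\<ge>1. T \<subseteq> span (word_products A S q)"
  using T
proof (induction T rule: finite_induct)
  case empty
  show ?case by auto
next
  case (insert t T)
  then obtain a where a: "T \<subseteq> span (word_products A S a)" by auto
  obtain b where b: "t \<in> span (word_products A S b)" using generated_in_span[OF S(1), of t] S(2) insert.prems by blast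
  have "span (word_products A S a) \<subseteq> span (word_products A S (Suc (max a b)))"
    "span (word_products A S b) \<subseteq> span (word_products A S (Suc (max a b)))"
    by (intro span_word_products_mono; simp)+
  with a b show ?case by (intro exI[of _ "Suc (max a b)"]) auto
qed

end

text \<open>
An affine algebra whose growth is $n^m$ up to constant factors. It suffices to have the bounds for one generating set.
\<close>

definition growth_degree :: "'k ring \<Rightarrow> ('k, 'a) module \<Rightarrow> nat \<Rightarrow> bool" where
  "growth_degree K A m \<longleftrightarrow> (\<exists>S c1 c2. finite S \<and> S \<subseteq> carrier A \<and>
     subalgebra_generated K A S = carrier A \<and> 0 < c1 \<and>
     (\<forall>n\<ge>1. c1 * real n ^ m \<le> real (growth K A S n) \<and> real (growth K A S n) \<le> c2 * real n ^ m))"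

lemma growth_degree_upper:
  assumes "unital_algebra K A" "growth_degree K A m" "finite T" "T \<subseteq> carrier A"
  shows "\<exists>c>0. \<forall>n\<ge>1. real (growth K A T n) \<le> c * real n ^ m"
proof -
  interpret unital_algebra K A by (rule assms(1))
  obtain S c1 c2 where S: "finite S" "S \<subseteq> carrier A" "subalgebra_generated K A S = carrier A"
    and c: "\<forall>n\<ge>1. c1 * real n ^ m \<le> real (growth K A S n) \<and> real (growth K A S n) \<le> c2 * real n ^ m"
    using assms(2) unfolding growth_degree_def by blast
  obtain q where q: "1 \<le> q" "T \<subseteq> span (word_products A S q)"
    using finite_in_span_word_products[OF S(2,3) assms(3,4)] by blast
  define C where "C = (\<bar>c2\<bar> + 1) * real q ^ m"
  have "0 < C" using q(1) by (simp add: C_def)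
  moreover have "real (growth K A T n) \<le> C * real n ^ m" if n: "1 \<le> n" for n
  proof -
    have "1 \<le> q * n" using q(1) n by simp
    have "real (growth K A T n) \<le> real (growth K A S (q * n))"
      using growth_le_rescaled[OF S(1,2) assms(3) q(2)] by simp
    also have "\<dots> \<le> c2 * real (q * n) ^ m" using c \<open>1 \<le> q * n\<close> by blast
    also have "\<dots> \<le> (\<bar>c2\<bar> + 1) * real (q * n) ^ m" by (intro mult_right_mono) auto
    also have "\<dots> = C * real n ^ m" by (simp add: C_def power_mult_distrib)
    finally show ?thesis .
  qed
  ultimately show ?thesis by blast
qed

text \<open>
The bounds compare the growth functions for \<open>n \<ge> 1\<close>. At \<open>n = 0\<close> the growth of a nonzero algebra is at
least 1, so a summand added to the constant is enough.
\<close>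

lemma growth_le_of_degree:
  assumes A: "unital_algebra K A" "growth_degree K A m"
    and B: "unital_algebra K B" "growth_degree K B m" "\<one>\<^bsub>B\<^esub> \<noteq> \<zero>\<^bsub>B\<^esub>"
  shows "growth_le K A B"
  unfolding growth_le_def
proof (intro allI impI)
  interpret B: unital_algebra K B by (rule B(1))
  fix T assume T: "finite T \<and> T \<subseteq> carrier A"
  then obtain c where c: "0 < c" "\<forall>n\<ge>1. real (growth K A T n) \<le> c * real n ^ m"
    using growth_degree_upper[OF A] by blast
  obtain S c1 c2 where S: "finite S" "S \<subseteq> carrier B" and c1: "0 < c1"
    "\<forall>n\<ge>1. c1 * real n ^ m \<le> real (growth K B S n) \<and> real (growth K B S n) \<le> c2 * real n ^ m"
    using B(2) unfolding growth_degree_def by blast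
  define C where "C = c / c1 + real (growth K A T 0)"
  have "real (growth K A T n) \<le> C * real (growth K B S n)" for n
  proof (cases "n = 0")
    case True
    have "1 \<le> growth K B S 0" by (rule B.growth_pos[OF S B(3)])
    then have "C * 1 \<le> C * real (growth K B S 0)"
      using c(1) c1(1) by (intro mult_left_mono) (auto simp: C_def)
    moreover have "real (growth K A T 0) \<le> C" using c(1) c1(1) by (simp add: C_def)
    ultimately show ?thesis using True by simp
  next
    case False
    then have n: "1 \<le> n" by simp
    have "real (growth K A T n) \<le> c * real n ^ m" using c(2) n by blast
    also have "\<dots> = c / c1 * (c1 * real n ^ m)" using c1(1) by simp
    also have "\<dots> \<le> c / c1 * real (growth K B S n)"
      using c(1) c1 n by (intro mult_left_mono) auto
    also have "\<dots> \<le> C * real (growth K B S n)" by (intro mult_right_mono) (auto simp: C_def)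
    finally show ?thesis .
  qed
  with S show "\<exists>S (c::real). finite S \<and> S \<subseteq> carrier B \<and>
      (\<forall>n. real (growth K A T n) \<le> c * real (growth K B S n))" by blast
qed

lemma log_const_power_tendsto:
  assumes "0 < (c::real)"
  shows "(\<lambda>n. log (real n) (c * real n ^ m)) \<longlonglongrightarrow> real m"
proof -
  have "filterlim (\<lambda>n. ln (real n)) at_top sequentially"
    by (rule filterlim_compose[OF ln_at_top filterlim_real_sequentially])
  then have "(\<lambda>n. ln c / ln (real n)) \<longlonglongrightarrow> 0" by (rule real_tendsto_divide_at_top[OF tendsto_const])
  then have "(\<lambda>n. ln c / ln (real n) + real m) \<longlonglongrightarrow> 0 + real m" by (intro tendsto_add tendsto_const)
  then have lim: "(\<lambda>n. ln c / ln (real n) + real m) \<longlonglongrightarrow> real m" by simp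
  have "\<forall>\<^sub>F n in sequentially. ln c / ln (real n) + real m = log (real n) (c * real n ^ m)"
    using eventually_ge_at_top[of 2]
  proof eventually_elim
    case (elim n)
    then have "ln (real n) > 0" by simp
    then show ?case using assms elim
      by (simp add: log_def ln_mult ln_realpow add_divide_distrib)
  qed
  with lim show ?thesis by (rule Lim_transform_eventually)
qed

lemma GKdim_of_degree:
  assumes A: "unital_algebra K A" "growth_degree K A m" "\<one>\<^bsub>A\<^esub> \<noteq> \<zero>\<^bsub>A\<^esub>"
  shows "GKdim K A = ereal (real m)"
  unfolding GKdim_def
proof (rule antisym)
  interpret unital_algebra K A by (rule A(1))
  show "(SUP S\<in>{S. finite S \<and> S \<subseteq> carrier A}.
      limsup (\<lambda>n. ereal (log (real n) (real (growth K A S n))))) \<le> ereal (real m)"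
  proof (rule SUP_least)
    fix T assume "T \<in> {S. finite S \<and> S \<subseteq> carrier A}"
    then have T: "finite T" "T \<subseteq> carrier A" by auto
    obtain c where c: "0 < c" "\<forall>n\<ge>1. real (growth K A T n) \<le> c * real n ^ m"
      using growth_degree_upper[OF A(1,2) T] by blast
    have "\<forall>\<^sub>F n in sequentially. ereal (log (real n) (real (growth K A T n)))
        \<le> ereal (log (real n) (c * real n ^ m))"
      using eventually_ge_at_top[of 2]
    proof eventually_elim
      case (elim n)
      then have n: "1 \<le> n" by simp
      have "1 \<le> growth K A T n" by (rule growth_pos[OF T A(3)])
      then have g: "0 < real (growth K A T n)" by simp
      have "real (growth K A T n) \<le> c * real n ^ m" using c(2) n by blast
      moreover have "0 < c * real n ^ m" using c(1) n by simp
      moreover have "1 < real n" using elim by simp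
      ultimately show ?case using g by (simp add: log_le_cancel_iff)
    qed
    then have "limsup (\<lambda>n. ereal (log (real n) (real (growth K A T n))))
        \<le> limsup (\<lambda>n. ereal (log (real n) (c * real n ^ m)))" by (rule Limsup_mono)
    also have "\<dots> = ereal (real m)"
      using log_const_power_tendsto[OF c(1)] by (intro lim_imp_Limsup) auto
    finally show "limsup (\<lambda>n. ereal (log (real n) (real (growth K A T n)))) \<le> ereal (real m)" .
  qed
next
  interpret unital_algebra K A by (rule A(1))
  obtain S c1 c2 where S: "finite S" "S \<subseteq> carrier A" and c1: "0 < c1"
    "\<forall>n\<ge>1. c1 * real n ^ m \<le> real (growth K A S n) \<and> real (growth K A S n) \<le> c2 * real n ^ m"
    using A(2) unfolding growth_degree_def by blast
  have "\<forall>\<^sub>F n in sequentially. ereal (log (real n) (c1 * real n ^ m))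
      \<le> ereal (log (real n) (real (growth K A S n)))"
    using eventually_ge_at_top[of 2]
  proof eventually_elim
    case (elim n)
    then have n: "1 \<le> n" by simp
    have "1 \<le> growth K A S n" by (rule growth_pos[OF S A(3)])
    then have g: "0 < real (growth K A S n)" by simp
    have "c1 * real n ^ m \<le> real (growth K A S n)" using c1(2) n by blast
    moreover have "0 < c1 * real n ^ m" using c1(1) n by simp
    moreover have "1 < real n" using elim by simp
    ultimately show ?case using g by (simp add: log_le_cancel_iff)
  qed
  then have "limsup (\<lambda>n. ereal (log (real n) (c1 * real n ^ m)))
      \<le> limsup (\<lambda>n. ereal (log (real n) (real (growth K A S n))))" by (rule Limsup_mono)
  moreover have "limsup (\<lambda>n. ereal (log (real n) (c1 * real n ^ m))) = ereal (real m)"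
    using log_const_power_tendsto[OF c1(1)] by (intro lim_imp_Limsup) auto
  ultimately have "ereal (real m) \<le> limsup (\<lambda>n. ereal (log (real n) (real (growth K A S n))))" by simp
  also have "\<dots> \<le> (SUP S\<in>{S. finite S \<and> S \<subseteq> carrier A}.
      limsup (\<lambda>n. ereal (log (real n) (real (growth K A S n)))))"
    using S by (intro SUP_upper) auto
  finally show "ereal (real m) \<le> (SUP S\<in>{S. finite S \<and> S \<subseteq> carrier A}.
      limsup (\<lambda>n. ereal (log (real n) (real (growth K A S n)))))" .
qed

section \<open>Matrix algebras\<close>

lemma mat_algebra_carrier:
  "M \<in> carrier (mat_algebra C d) \<longleftrightarrow>
     M \<in> carrier_mat d d \<and> (\<forall>i<d. \<forall>j<d. M $$ (i, j) \<in> carrier C)"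
  by (fastforce simp: mat_algebra_def)

lemma mat_in_mat_algebra:
  "(\<And>i j. i < d \<Longrightarrow> j < d \<Longrightarrow> f (i, j) \<in> carrier C) \<Longrightarrow> mat d d f \<in> carrier (mat_algebra C d)"
  by (simp add: mat_algebra_carrier)

lemma mat_algebra_eqI:
  assumes "M \<in> carrier (mat_algebra C d)" "N \<in> carrier (mat_algebra C d)"
    "\<And>i j. i < d \<Longrightarrow> j < d \<Longrightarrow> M $$ (i, j) = N $$ (i, j)"
  shows "M = N"
  using assms by (intro eq_matI) (auto simp: mat_algebra_carrier)

lemma mat_algebra_ops:
  "M \<otimes>\<^bsub>mat_algebra C d\<^esub> N = mat d d (\<lambda>(i, j). \<Oplus>\<^bsub>C\<^esub>l\<in>{..<d}. M $$ (i, l) \<otimes>\<^bsub>C\<^esub> N $$ (l, j))"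
  "M \<oplus>\<^bsub>mat_algebra C d\<^esub> N = mat d d (\<lambda>(i, j). M $$ (i, j) \<oplus>\<^bsub>C\<^esub> N $$ (i, j))"
  "\<one>\<^bsub>mat_algebra C d\<^esub> = mat d d (\<lambda>(i, j). if i = j then \<one>\<^bsub>C\<^esub> else \<zero>\<^bsub>C\<^esub>)"
  "\<zero>\<^bsub>mat_algebra C d\<^esub> = mat d d (\<lambda>(i, j). \<zero>\<^bsub>C\<^esub>)"
  "c \<odot>\<^bsub>mat_algebra C d\<^esub> M = mat d d (\<lambda>(i, j). c \<odot>\<^bsub>C\<^esub> M $$ (i, j))"
  by (simp_all add: mat_algebra_def)

context
  fixes K :: "'k ring" and C :: "('k, 'c) module" (structure) and d :: nat
  assumes K: "field K" and C: "algebra K C"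
begin

interpretation C: cring C by (rule algebra.M_cring[OF C])
interpretation algebra K C by (rule C)

private abbreviation "A \<equiv> mat_algebra C d"

lemma entry_closed: "M \<in> carrier A \<Longrightarrow> i < d \<Longrightarrow> j < d \<Longrightarrow> M $$ (i, j) \<in> carrier C"
  by (simp add: mat_algebra_carrier)

lemma mat_mult_closed: "M \<in> carrier A \<Longrightarrow> N \<in> carrier A \<Longrightarrow> M \<otimes>\<^bsub>A\<^esub> N \<in> carrier A"
  unfolding mat_algebra_ops
  by (intro mat_in_mat_algebra) (auto intro!: C.finsum_closed C.m_closed entry_closed)

lemma mat_add_closed: "M \<in> carrier A \<Longrightarrow> N \<in> carrier A \<Longrightarrow> M \<oplus>\<^bsub>A\<^esub> N \<in> carrier A"
  unfolding mat_algebra_ops by (intro mat_in_mat_algebra) (simp add: entry_closed)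

lemma mat_const_closed: "\<one>\<^bsub>A\<^esub> \<in> carrier A" "\<zero>\<^bsub>A\<^esub> \<in> carrier A"
  unfolding mat_algebra_ops by (intro mat_in_mat_algebra; simp)+

lemma mat_smult_closed: "c \<in> carrier K \<Longrightarrow> M \<in> carrier A \<Longrightarrow> c \<odot>\<^bsub>A\<^esub> M \<in> carrier A"
  unfolding mat_algebra_ops by (intro mat_in_mat_algebra) (simp add: entry_closed)

lemma mat_mult_assoc:
  assumes "M \<in> carrier A" "N \<in> carrier A" "P \<in> carrier A"
  shows "(M \<otimes>\<^bsub>A\<^esub> N) \<otimes>\<^bsub>A\<^esub> P = M \<otimes>\<^bsub>A\<^esub> (N \<otimes>\<^bsub>A\<^esub> P)"
proof (rule mat_algebra_eqI[of _ C d])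
  fix i j assume ij: "i < d" "j < d"
  note ec = entry_closed[OF assms(1)] entry_closed[OF assms(2)] entry_closed[OF assms(3)]
  have "((M \<otimes>\<^bsub>A\<^esub> N) \<otimes>\<^bsub>A\<^esub> P) $$ (i, j)
    = (\<Oplus>l\<in>{..<d}. (\<Oplus>k\<in>{..<d}. M $$ (i, k) \<otimes> N $$ (k, l)) \<otimes> P $$ (l, j))"
    unfolding mat_algebra_ops using ij ec
    by (simp, intro C.finsum_cong') (auto intro!: C.finsum_closed)
  also have "\<dots> = (\<Oplus>l\<in>{..<d}. \<Oplus>k\<in>{..<d}. M $$ (i, k) \<otimes> N $$ (k, l) \<otimes> P $$ (l, j))"
    using ij ec by (intro C.finsum_cong' C.finsum_ldistr) (auto intro!: C.finsum_closed)
  also have "\<dots> = (\<Oplus>k\<in>{..<d}. \<Oplus>l\<in>{..<d}. M $$ (i, k) \<otimes> N $$ (k, l) \<otimes> P $$ (l, j))"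
    using ij ec by (intro C.add.finprod_finprod_swap) auto
  also have "\<dots> = (\<Oplus>k\<in>{..<d}. M $$ (i, k) \<otimes> (\<Oplus>l\<in>{..<d}. N $$ (k, l) \<otimes> P $$ (l, j)))"
  proof (intro C.finsum_cong')
    fix k assume k: "k \<in> {..<d}"
    have "M $$ (i, k) \<otimes> (\<Oplus>l\<in>{..<d}. N $$ (k, l) \<otimes> P $$ (l, j))
        = (\<Oplus>l\<in>{..<d}. M $$ (i, k) \<otimes> (N $$ (k, l) \<otimes> P $$ (l, j)))"
      using ij ec k by (intro C.finsum_rdistr) auto
    also have "\<dots> = (\<Oplus>l\<in>{..<d}. M $$ (i, k) \<otimes> N $$ (k, l) \<otimes> P $$ (l, j))"
      using ij ec k by (intro C.finsum_cong') (auto simp: C.m_assoc)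
    finally show "(\<Oplus>l\<in>{..<d}. M $$ (i, k) \<otimes> N $$ (k, l) \<otimes> P $$ (l, j))
        = M $$ (i, k) \<otimes> (\<Oplus>l\<in>{..<d}. N $$ (k, l) \<otimes> P $$ (l, j))" ..
  qed (use ij ec in \<open>auto intro!: C.finsum_closed\<close>)
  also have "\<dots> = (M \<otimes>\<^bsub>A\<^esub> (N \<otimes>\<^bsub>A\<^esub> P)) $$ (i, j)"
    unfolding mat_algebra_ops using ij ec
    by (simp, intro C.finsum_cong') (auto intro!: C.finsum_closed)
  finally show "((M \<otimes>\<^bsub>A\<^esub> N) \<otimes>\<^bsub>A\<^esub> P) $$ (i, j) = (M \<otimes>\<^bsub>A\<^esub> (N \<otimes>\<^bsub>A\<^esub> P)) $$ (i, j)" .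
qed (intro mat_mult_closed assms)+

lemma finsum_delta:
  assumes "i < d" "\<And>l. l < d \<Longrightarrow> f l \<in> carrier C"
  shows "(\<Oplus>l\<in>{..<d}. if i = l then f l else \<zero>) = f i"
  using assms by (intro C.add.finprod_singleton) auto

text \<open>
The scalar matrices are the central subring over which the matrix units span.
\<close>

definition scalar_mat :: "'c \<Rightarrow> 'c mat" where
  "scalar_mat c = mat d d (\<lambda>(i, j). if i = j then c else \<zero>)"

lemma scalar_mat_closed: "c \<in> carrier C \<Longrightarrow> scalar_mat c \<in> carrier A"
  unfolding scalar_mat_def by (intro mat_in_mat_algebra) auto

lemma scalar_mat_mult:
  assumes c: "c \<in> carrier C" and M: "M \<in> carrier A"
  shows "scalar_mat c \<otimes>\<^bsub>A\<^esub> M = mat d d (\<lambda>(i, j). c \<otimes> M $$ (i, j))"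
    and "M \<otimes>\<^bsub>A\<^esub> scalar_mat c = mat d d (\<lambda>(i, j). c \<otimes> M $$ (i, j))"
proof -
  have 1: "(\<Oplus>l\<in>{..<d}. scalar_mat c $$ (i, l) \<otimes> M $$ (l, j)) = c \<otimes> M $$ (i, j)"
    if ij: "i < d" "j < d" for i j
  proof -
    have "(\<Oplus>l\<in>{..<d}. scalar_mat c $$ (i, l) \<otimes> M $$ (l, j))
        = (\<Oplus>l\<in>{..<d}. if i = l then c \<otimes> M $$ (l, j) else \<zero>)"
      using ij c entry_closed[OF M] by (intro C.finsum_cong') (auto simp: scalar_mat_def)
    then show ?thesis using finsum_delta[OF ij(1)] c ij entry_closed[OF M] by simp
  qed
  have 2: "(\<Oplus>l\<in>{..<d}. M $$ (i, l) \<otimes> scalar_mat c $$ (l, j)) = c \<otimes> M $$ (i, j)"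
    if ij: "i < d" "j < d" for i j
  proof -
    have "(\<Oplus>l\<in>{..<d}. M $$ (i, l) \<otimes> scalar_mat c $$ (l, j))
        = (\<Oplus>l\<in>{..<d}. if j = l then c \<otimes> M $$ (i, l) else \<zero>)"
      using ij c entry_closed[OF M] by (intro C.finsum_cong') (auto simp: scalar_mat_def C.m_comm)
    then show ?thesis using finsum_delta[OF ij(2)] c ij entry_closed[OF M] by simp
  qed
  show "scalar_mat c \<otimes>\<^bsub>A\<^esub> M = mat d d (\<lambda>(i, j). c \<otimes> M $$ (i, j))"
    unfolding mat_algebra_ops using 1 by (intro eq_matI) auto
  show "M \<otimes>\<^bsub>A\<^esub> scalar_mat c = mat d d (\<lambda>(i, j). c \<otimes> M $$ (i, j))"
    unfolding mat_algebra_ops using 2 by (intro eq_matI) auto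
qed

lemma mat_one_scalar: "\<one>\<^bsub>A\<^esub> = scalar_mat \<one>"
  by (simp add: mat_algebra_ops scalar_mat_def)

lemma mat_one_mult:
  assumes "M \<in> carrier A"
  shows "\<one>\<^bsub>A\<^esub> \<otimes>\<^bsub>A\<^esub> M = M" "M \<otimes>\<^bsub>A\<^esub> \<one>\<^bsub>A\<^esub> = M"
  unfolding mat_one_scalar scalar_mat_mult[OF C.one_closed assms]
  using assms by (auto intro!: eq_matI simp: mat_algebra_carrier)

lemma mat_distrib:
  assumes "M \<in> carrier A" "N \<in> carrier A" "P \<in> carrier A"
  shows "(M \<oplus>\<^bsub>A\<^esub> N) \<otimes>\<^bsub>A\<^esub> P = M \<otimes>\<^bsub>A\<^esub> P \<oplus>\<^bsub>A\<^esub> N \<otimes>\<^bsub>A\<^esub> P"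
    and "P \<otimes>\<^bsub>A\<^esub> (M \<oplus>\<^bsub>A\<^esub> N) = P \<otimes>\<^bsub>A\<^esub> M \<oplus>\<^bsub>A\<^esub> P \<otimes>\<^bsub>A\<^esub> N"
proof -
  note ec = entry_closed[OF assms(1)] entry_closed[OF assms(2)] entry_closed[OF assms(3)]
  have "(\<Oplus>l\<in>{..<d}. (M \<oplus>\<^bsub>A\<^esub> N) $$ (i, l) \<otimes> P $$ (l, j))
      = (\<Oplus>l\<in>{..<d}. M $$ (i, l) \<otimes> P $$ (l, j)) \<oplus> (\<Oplus>l\<in>{..<d}. N $$ (i, l) \<otimes> P $$ (l, j))"
    if ij: "i < d" "j < d" for i j
  proof -
    have "(\<Oplus>l\<in>{..<d}. (M \<oplus>\<^bsub>A\<^esub> N) $$ (i, l) \<otimes> P $$ (l, j))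
      = (\<Oplus>l\<in>{..<d}. M $$ (i, l) \<otimes> P $$ (l, j) \<oplus> N $$ (i, l) \<otimes> P $$ (l, j))"
      using ij ec by (intro C.finsum_cong') (auto simp: mat_algebra_ops C.l_distr)
    also have "\<dots> = (\<Oplus>l\<in>{..<d}. M $$ (i, l) \<otimes> P $$ (l, j))
        \<oplus> (\<Oplus>l\<in>{..<d}. N $$ (i, l) \<otimes> P $$ (l, j))"
      using ij ec by (intro C.finsum_addf) auto
    finally show ?thesis .
  qed
  then show "(M \<oplus>\<^bsub>A\<^esub> N) \<otimes>\<^bsub>A\<^esub> P = M \<otimes>\<^bsub>A\<^esub> P \<oplus>\<^bsub>A\<^esub> N \<otimes>\<^bsub>A\<^esub> P"
    unfolding mat_algebra_ops(1) by (intro eq_matI) (auto simp: mat_algebra_ops(2))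
  have "(\<Oplus>l\<in>{..<d}. P $$ (i, l) \<otimes> (M \<oplus>\<^bsub>A\<^esub> N) $$ (l, j))
      = (\<Oplus>l\<in>{..<d}. P $$ (i, l) \<otimes> M $$ (l, j)) \<oplus> (\<Oplus>l\<in>{..<d}. P $$ (i, l) \<otimes> N $$ (l, j))"
    if ij: "i < d" "j < d" for i j
  proof -
    have "(\<Oplus>l\<in>{..<d}. P $$ (i, l) \<otimes> (M \<oplus>\<^bsub>A\<^esub> N) $$ (l, j))
      = (\<Oplus>l\<in>{..<d}. P $$ (i, l) \<otimes> M $$ (l, j) \<oplus> P $$ (i, l) \<otimes> N $$ (l, j))"
      using ij ec by (intro C.finsum_cong') (auto simp: mat_algebra_ops C.r_distr)
    also have "\<dots> = (\<Oplus>l\<in>{..<d}. P $$ (i, l) \<otimes> M $$ (l, j))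
        \<oplus> (\<Oplus>l\<in>{..<d}. P $$ (i, l) \<otimes> N $$ (l, j))"
      using ij ec by (intro C.finsum_addf) auto
    finally show ?thesis .
  qed
  then show "P \<otimes>\<^bsub>A\<^esub> (M \<oplus>\<^bsub>A\<^esub> N) = P \<otimes>\<^bsub>A\<^esub> M \<oplus>\<^bsub>A\<^esub> P \<otimes>\<^bsub>A\<^esub> N"
    unfolding mat_algebra_ops(1) by (intro eq_matI) (auto simp: mat_algebra_ops(2))
qed

lemma mat_abelian_group: "abelian_group A"
proof (rule abelian_groupI)
  fix M N P assume M: "M \<in> carrier A" and N: "N \<in> carrier A" and P: "P \<in> carrier A"
  show "M \<oplus>\<^bsub>A\<^esub> N \<in> carrier A" by (rule mat_add_closed[OF M N])
  show "M \<oplus>\<^bsub>A\<^esub> N \<oplus>\<^bsub>A\<^esub> P = M \<oplus>\<^bsub>A\<^esub> (N \<oplus>\<^bsub>A\<^esub> P)"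
    unfolding mat_algebra_ops using entry_closed[OF M] entry_closed[OF N] entry_closed[OF P]
    by (intro eq_matI) (auto simp: C.a_assoc)
  show "M \<oplus>\<^bsub>A\<^esub> N = N \<oplus>\<^bsub>A\<^esub> M"
    unfolding mat_algebra_ops using entry_closed[OF M] entry_closed[OF N]
    by (intro eq_matI) (auto simp: C.a_comm)
next
  show "\<zero>\<^bsub>A\<^esub> \<in> carrier A" by (rule mat_const_closed)
  fix M assume M: "M \<in> carrier A"
  show "\<zero>\<^bsub>A\<^esub> \<oplus>\<^bsub>A\<^esub> M = M"
  proof (rule mat_algebra_eqI[OF mat_add_closed[OF mat_const_closed(2) M] M])
    fix i j assume "i < d" "j < d"
    then show "(\<zero>\<^bsub>A\<^esub> \<oplus>\<^bsub>A\<^esub> M) $$ (i, j) = M $$ (i, j)"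
      using entry_closed[OF M] by (simp add: mat_algebra_ops)
  qed
  let ?N = "mat d d (\<lambda>(i, j). \<ominus> M $$ (i, j))"
  have "?N \<in> carrier A" using entry_closed[OF M] by (intro mat_in_mat_algebra) auto
  moreover have "?N \<oplus>\<^bsub>A\<^esub> M = \<zero>\<^bsub>A\<^esub>"
    unfolding mat_algebra_ops using entry_closed[OF M] by (intro eq_matI) (auto simp: C.l_neg)
  ultimately show "\<exists>N\<in>carrier A. N \<oplus>\<^bsub>A\<^esub> M = \<zero>\<^bsub>A\<^esub>" by blast
qed

lemma mat_ring: "ring A"
proof (rule ringI)
  show "abelian_group A" by (rule mat_abelian_group)
  show "Group.monoid A"
    by (rule monoidI) (auto intro: mat_mult_closed mat_const_closed mat_mult_assoc simp: mat_one_mult)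
qed (auto intro: mat_distrib)

lemma mat_unital_algebra: "unital_algebra K A"
proof -
  interpret K: field K by (rule K)
  interpret A: ring A by (rule mat_ring)
  have "module_axioms K A"
    unfolding module_axioms_def
    by (auto intro!: mat_smult_closed eq_matI
        simp: mat_algebra_ops entry_closed smult_l_distr smult_r_distr smult_assoc1)
      (auto simp: mat_algebra_carrier)
  moreover have "cring K" by unfold_locales
  ultimately have "vectorspace K A"
    unfolding vectorspace_def Module.module_def using K mat_abelian_group by blast
  moreover have "unital_algebra_axioms K A"
  proof
    fix c M N assume c: "c \<in> carrier K" and M: "M \<in> carrier A" and N: "N \<in> carrier A"
    note ec = entry_closed[OF M] entry_closed[OF N]
    have 1: "(\<Oplus>l\<in>{..<d}. (c \<odot> M $$ (i, l)) \<otimes> N $$ (l, j))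
        = c \<odot> (\<Oplus>l\<in>{..<d}. M $$ (i, l) \<otimes> N $$ (l, j))" if "i < d" "j < d" for i j
      using that ec c by (subst finsum_smult) (auto intro!: C.finsum_cong' simp: smult_assoc2)
    have "(\<Oplus>l\<in>{..<d}. M $$ (i, l) \<otimes> (c \<odot> N $$ (l, j)))
        = (\<Oplus>l\<in>{..<d}. (c \<odot> M $$ (i, l)) \<otimes> N $$ (l, j))" if "i < d" "j < d" for i j
    proof (intro C.finsum_cong')
      fix l assume l: "l \<in> {..<d}"
      have "M $$ (i, l) \<otimes> (c \<odot> N $$ (l, j)) = c \<odot> (N $$ (l, j) \<otimes> M $$ (i, l))"
        using that l ec c by (simp add: C.m_comm[of "M $$ (i, l)"] smult_assoc2)
      also have "\<dots> = (c \<odot> M $$ (i, l)) \<otimes> N $$ (l, j)"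
        using that l ec c by (simp add: C.m_comm[of "N $$ (l, j)"] smult_assoc2)
      finally show "M $$ (i, l) \<otimes> (c \<odot> N $$ (l, j)) = (c \<odot> M $$ (i, l)) \<otimes> N $$ (l, j)" .
    qed (use that ec c in auto)
    with 1 have 2: "(\<Oplus>l\<in>{..<d}. M $$ (i, l) \<otimes> (c \<odot> N $$ (l, j)))
        = c \<odot> (\<Oplus>l\<in>{..<d}. M $$ (i, l) \<otimes> N $$ (l, j))" if "i < d" "j < d" for i j
      using that by simp
    have l: "(\<Oplus>l\<in>{..<d}. (c \<odot>\<^bsub>A\<^esub> M) $$ (i, l) \<otimes> N $$ (l, j))
        = (\<Oplus>l\<in>{..<d}. (c \<odot> M $$ (i, l)) \<otimes> N $$ (l, j))" if "i < d" "j < d" for i j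
      using that ec c by (intro C.finsum_cong') (auto simp: mat_algebra_ops)
    have r: "(\<Oplus>l\<in>{..<d}. M $$ (i, l) \<otimes> (c \<odot>\<^bsub>A\<^esub> N) $$ (l, j))
        = (\<Oplus>l\<in>{..<d}. M $$ (i, l) \<otimes> (c \<odot> N $$ (l, j)))" if "i < d" "j < d" for i j
      using that ec c by (intro C.finsum_cong') (auto simp: mat_algebra_ops)
    show "(c \<odot>\<^bsub>A\<^esub> M) \<otimes>\<^bsub>A\<^esub> N = c \<odot>\<^bsub>A\<^esub> (M \<otimes>\<^bsub>A\<^esub> N)"
      unfolding mat_algebra_ops(1) using l 1 by (intro eq_matI) (auto simp: mat_algebra_ops(5))
    show "M \<otimes>\<^bsub>A\<^esub> (c \<odot>\<^bsub>A\<^esub> N) = c \<odot>\<^bsub>A\<^esub> (M \<otimes>\<^bsub>A\<^esub> N)"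
      unfolding mat_algebra_ops(1) using r 2 by (intro eq_matI) (auto simp: mat_algebra_ops(5))
  qed
  ultimately show ?thesis unfolding unital_algebra_def using mat_ring by blast
qed

definition mat_unit :: "nat \<Rightarrow> nat \<Rightarrow> 'c mat" where
  "mat_unit i j = mat d d (\<lambda>p. if p = (i, j) then \<one> else \<zero>)"

lemma mat_unit_closed: "mat_unit i j \<in> carrier A"
  unfolding mat_unit_def by (intro mat_in_mat_algebra) auto

theorem mat_finite_central_algebra:
  "finite_central_algebra K A (scalar_mat ` carrier C) {mat_unit i j | i j. i < d \<and> j < d}"
proof -
  interpret A: unital_algebra K A by (rule mat_unital_algebra)
  let ?Z = "scalar_mat ` carrier C" and ?E = "{mat_unit i j | i j. i < d \<and> j < d}"
  have "central_subring_axioms A ?Z"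
  proof
    show "?Z \<subseteq> carrier A" using scalar_mat_closed by blast
    show "z \<otimes>\<^bsub>A\<^esub> M = M \<otimes>\<^bsub>A\<^esub> z" if "z \<in> ?Z" "M \<in> carrier A" for z M
      using that scalar_mat_mult by auto
    show "\<one>\<^bsub>A\<^esub> \<in> ?Z" unfolding mat_one_scalar by blast
    fix z z' assume "z \<in> ?Z" "z' \<in> ?Z"
    then obtain c c' where c: "c \<in> carrier C" "z = scalar_mat c" "c' \<in> carrier C" "z' = scalar_mat c'" by blast
    have "scalar_mat c \<oplus>\<^bsub>A\<^esub> scalar_mat c' = scalar_mat (c \<oplus> c')"
      using c by (intro eq_matI) (auto simp: scalar_mat_def mat_algebra_ops)
    then show "z \<oplus>\<^bsub>A\<^esub> z' \<in> ?Z" using c by auto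
    have "scalar_mat c \<otimes>\<^bsub>A\<^esub> scalar_mat c' = scalar_mat (c \<otimes> c')"
      unfolding scalar_mat_mult(1)[OF c(1) scalar_mat_closed[OF c(3)]]
      using c by (intro eq_matI) (auto simp: scalar_mat_def)
    then show "z \<otimes>\<^bsub>A\<^esub> z' \<in> ?Z" using c by auto
    have "scalar_mat (\<ominus> c) \<oplus>\<^bsub>A\<^esub> scalar_mat c = \<zero>\<^bsub>A\<^esub>"
      using c by (intro eq_matI) (auto simp: scalar_mat_def mat_algebra_ops C.l_neg)
    then have "\<ominus>\<^bsub>A\<^esub> scalar_mat c = scalar_mat (\<ominus> c)"
      using c scalar_mat_closed by (intro abelian_group.minus_equality[OF mat_abelian_group]) auto
    then show "\<ominus>\<^bsub>A\<^esub> z \<in> ?Z" using c by auto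
  qed
  then have central: "central_subring A ?Z" unfolding central_subring_def using mat_ring by blast
  have "finite ?E" by (rule finite_image_set2) simp_all
  moreover have "?E \<subseteq> carrier A" using mat_unit_closed by blast
  moreover have "carrier A \<subseteq> zspan A ?Z ?E"
  proof
    fix M assume M: "M \<in> carrier A"
    \<comment> \<open>The entries of \<open>M\<close> are collected one position at a time.\<close>
    define part where "part I = mat d d (\<lambda>p. if p \<in> I then M $$ p else \<zero>)" for I
    have "part I \<in> zspan A ?Z ?E" if "finite I" "I \<subseteq> {..<d} \<times> {..<d}" for I
      using that
    proof (induction I rule: finite_induct)
      case empty
      have "part {} = \<zero>\<^bsub>A\<^esub>" by (simp add: part_def mat_algebra_ops) (rule cong_mat, auto)
      then show ?case by (simp add: zspan.zero)
    next
      case (insert p I)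
      then obtain i j where p: "p = (i, j)" "i < d" "j < d" by auto
      have Mij: "M $$ (i, j) \<in> carrier C" using entry_closed[OF M p(2,3)] .
      have "part (insert p I) = scalar_mat (M $$ (i, j)) \<otimes>\<^bsub>A\<^esub> mat_unit i j \<oplus>\<^bsub>A\<^esub> part I"
        unfolding scalar_mat_mult(1)[OF Mij mat_unit_closed] using Mij insert(2) p entry_closed[OF M]
        by (intro eq_matI) (auto simp: part_def mat_unit_def mat_algebra_ops)
      moreover have "scalar_mat (M $$ (i, j)) \<otimes>\<^bsub>A\<^esub> mat_unit i j \<oplus>\<^bsub>A\<^esub> part I \<in> zspan A ?Z ?E"
        using Mij p insert by (intro zspan.step) auto
      ultimately show ?case by (simp only:)
    qed
    from this[of "{..<d} \<times> {..<d}"] have "part ({..<d} \<times> {..<d}) \<in> zspan A ?Z ?E" by simp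
    moreover have "part ({..<d} \<times> {..<d}) = M"
      using M by (intro eq_matI) (auto simp: part_def mat_algebra_carrier)
    ultimately show "M \<in> zspan A ?Z ?E" by simp
  qed
  ultimately have "finite_central_algebra_axioms A ?Z ?E" by unfold_locales
  then show ?thesis
    unfolding finite_central_algebra_def using mat_unital_algebra central by blast
qed

end

section \<open>Polynomial algebras inside power series\<close>

lemma finite_submultisets: "finite {L. L \<subseteq># (M :: nat multiset)}"
proof (rule finite_subset)
  show "{L. L \<subseteq># M} \<subseteq> monomials (set_mset M) (size M)"
    by (auto simp: monomials_def size_mset_mono dest: mset_subset_eqD)
  show "finite (monomials (set_mset M) (size M))" by (rule finite_monomials) simp
qed

text \<open>
All functions from monomials to the base field form an algebra under convolution, because a monomial has only finitely many
divisors. Polynomials are obtained as a generated subalgebra, so finiteness of supports never has to be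
tracked.
\<close>

definition power_series_algebra :: "'k ring \<Rightarrow> ('k, nat multiset \<Rightarrow> 'k) module" where
  "power_series_algebra K =
    \<lparr>carrier = {p. \<forall>M. p M \<in> carrier K},
     monoid.mult = (\<lambda>p q M. \<Oplus>\<^bsub>K\<^esub>L\<in>{L. L \<subseteq># M}. p L \<otimes>\<^bsub>K\<^esub> q (M - L)),
     one = (\<lambda>M. if M = {#} then \<one>\<^bsub>K\<^esub> else \<zero>\<^bsub>K\<^esub>),
     zero = (\<lambda>M. \<zero>\<^bsub>K\<^esub>),
     add = (\<lambda>p q M. p M \<oplus>\<^bsub>K\<^esub> q M),
     module.smult = (\<lambda>c p M. c \<otimes>\<^bsub>K\<^esub> p M)\<rparr>"

lemma power_series_simps:
  "p \<in> carrier (power_series_algebra K) \<longleftrightarrow> (\<forall>M. p M \<in> carrier K)"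
  "(p \<otimes>\<^bsub>power_series_algebra K\<^esub> q) M = (\<Oplus>\<^bsub>K\<^esub>L\<in>{L. L \<subseteq># M}. p L \<otimes>\<^bsub>K\<^esub> q (M - L))"
  "\<one>\<^bsub>power_series_algebra K\<^esub> M = (if M = {#} then \<one>\<^bsub>K\<^esub> else \<zero>\<^bsub>K\<^esub>)"
  "\<zero>\<^bsub>power_series_algebra K\<^esub> M = \<zero>\<^bsub>K\<^esub>"
  "(p \<oplus>\<^bsub>power_series_algebra K\<^esub> q) M = p M \<oplus>\<^bsub>K\<^esub> q M"
  "(c \<odot>\<^bsub>power_series_algebra K\<^esub> p) M = c \<otimes>\<^bsub>K\<^esub> p M"
  by (simp_all add: power_series_algebra_def)

context cring
begin

lemma convolution_comm:
  assumes "\<And>M. p M \<in> carrier R" "\<And>M. q M \<in> carrier R"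
  shows "(\<Oplus>L\<in>{L. L \<subseteq># M}. p L \<otimes> q (M - L)) = (\<Oplus>L\<in>{L. L \<subseteq># (M :: nat multiset)}. q L \<otimes> p (M - L))"
proof -
  let ?S = "{L. L \<subseteq># M}"
  have inv: "M - (M - L) = L" if "L \<in> ?S" for L using that by (simp add: multiset_eq_iff subseteq_mset_def)
  have img: "(\<lambda>L. M - L) ` ?S = ?S"
  proof
    show "(\<lambda>L. M - L) ` ?S \<subseteq> ?S" by auto
    show "?S \<subseteq> (\<lambda>L. M - L) ` ?S"
    proof
      fix L assume L: "L \<in> ?S"
      then have "L = M - (M - L)" using inv by simp
      then show "L \<in> (\<lambda>L. M - L) ` ?S" by (rule image_eqI) simp
    qed
  qed
  have "(\<Oplus>L\<in>(\<lambda>L. M - L) ` ?S. p L \<otimes> q (M - L)) = (\<Oplus>L\<in>?S. p (M - L) \<otimes> q (M - (M - L)))"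
    using assms by (intro add.finprod_reindex) (auto intro: inj_on_inverseI[where g = "\<lambda>L. M - L"] inv)
  also have "\<dots> = (\<Oplus>L\<in>?S. q L \<otimes> p (M - L))"
    using assms inv by (intro finsum_cong') (auto simp: m_comm)
  finally show ?thesis by (simp only: img)
qed

text \<open>
Both sides are sums of \<open>p N \<otimes> q (L - N) \<otimes> r (M - L)\<close> over pairs of divisors \<open>N\<close> of \<open>L\<close> and \<open>L\<close> of \<open>M\<close>, taken in different orders.
Summing over all pairs of divisors of \<open>M\<close>, with zeros for the other pairs, makes the exchange of sums a matter of rectangles.
\<close>

lemma convolution_assoc:
  assumes p: "\<And>M. p M \<in> carrier R" and q: "\<And>M. q M \<in> carrier R" and r: "\<And>M. r M \<in> carrier R"
  shows "(\<Oplus>L\<in>{L. L \<subseteq># M}. (\<Oplus>N\<in>{N. N \<subseteq># L}. p N \<otimes> q (L - N)) \<otimes> r (M - L))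
    = (\<Oplus>N\<in>{N. N \<subseteq># (M :: nat multiset)}. p N \<otimes> (\<Oplus>L\<in>{L. L \<subseteq># M - N}. q L \<otimes> r (M - N - L)))"
proof -
  let ?S = "{L. L \<subseteq># M}"
  let ?f = "\<lambda>L N. if N \<subseteq># L then p N \<otimes> q (L - N) \<otimes> r (M - L) else \<zero>"
  have fin: "finite {L. L \<subseteq># (X :: nat multiset)}" for X by (rule finite_submultisets)
  have f: "?f L N \<in> carrier R" for L N using p q r by auto
  have 1: "(\<Oplus>N\<in>{N. N \<subseteq># L}. p N \<otimes> q (L - N)) \<otimes> r (M - L) = (\<Oplus>N\<in>?S. ?f L N)"
    if L: "L \<in> ?S" for L
  proof -
    have "(\<Oplus>N\<in>{N. N \<subseteq># L}. p N \<otimes> q (L - N)) \<otimes> r (M - L)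
        = (\<Oplus>N\<in>{N. N \<subseteq># L}. p N \<otimes> q (L - N) \<otimes> r (M - L))"
      using p q r fin by (intro finsum_ldistr) auto
    also have "\<dots> = (\<Oplus>N\<in>?S. ?f L N)"
      using L p q r fin subset_mset.order_trans
      by (intro add.finprod_mono_neutral_cong_left) auto
    finally show ?thesis .
  qed
  have 2: "(\<Oplus>L\<in>?S. ?f L N) = p N \<otimes> (\<Oplus>L\<in>{L. L \<subseteq># M - N}. q L \<otimes> r (M - N - L))"
    if N: "N \<in> ?S" for N
  proof -
    let ?T = "{L. L \<subseteq># M \<and> N \<subseteq># L}"
    have img: "(\<lambda>L. N + L) ` {L. L \<subseteq># M - N} = ?T"
    proof
      show "(\<lambda>L. N + L) ` {L. L \<subseteq># M - N} \<subseteq> ?T"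
        using N by (auto simp: subseteq_mset_def le_diff_conv2 add.commute)
      show "?T \<subseteq> (\<lambda>L. N + L) ` {L. L \<subseteq># M - N}"
      proof
        fix L assume L: "L \<in> ?T"
        then have "L = N + (L - N)" by simp
        moreover have "L - N \<subseteq># M - N" using L by (simp add: subseteq_mset_def diff_le_mono)
        ultimately show "L \<in> (\<lambda>L. N + L) ` {L. L \<subseteq># M - N}" by blast
      qed
    qed
    have "(\<Oplus>L\<in>?S. ?f L N) = (\<Oplus>L\<in>?T. ?f L N)"
      using fin[of M] f by (intro add.finprod_mono_neutral_cong_right) auto
    also have "\<dots> = (\<Oplus>L\<in>{L. L \<subseteq># M - N}. ?f (N + L) N)"
      unfolding img[symmetric] using f by (intro add.finprod_reindex) (auto simp: inj_on_def)
    also have "\<dots> = (\<Oplus>L\<in>{L. L \<subseteq># M - N}. p N \<otimes> (q L \<otimes> r (M - N - L)))"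
      using p q r by (intro finsum_cong') (auto simp: m_assoc)
    also have "\<dots> = p N \<otimes> (\<Oplus>L\<in>{L. L \<subseteq># M - N}. q L \<otimes> r (M - N - L))"
      using p q r fin by (intro finsum_rdistr[symmetric]) auto
    finally show ?thesis .
  qed
  have "(\<Oplus>L\<in>?S. (\<Oplus>N\<in>{N. N \<subseteq># L}. p N \<otimes> q (L - N)) \<otimes> r (M - L)) = (\<Oplus>L\<in>?S. \<Oplus>N\<in>?S. ?f L N)"
    using 1 f by (intro finsum_cong') (auto intro!: finsum_closed)
  also have "\<dots> = (\<Oplus>N\<in>?S. \<Oplus>L\<in>?S. ?f L N)"
    using fin f by (intro add.finprod_finprod_swap)
  also have "\<dots> = (\<Oplus>N\<in>?S. p N \<otimes> (\<Oplus>L\<in>{L. L \<subseteq># M - N}. q L \<otimes> r (M - N - L)))"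
    using 2 p q r by (intro finsum_cong') (auto intro!: finsum_closed)
  finally show ?thesis .
qed

lemma convolution_delta:
  assumes "\<And>M. q M \<in> carrier R"
  shows "(\<Oplus>L\<in>{L. L \<subseteq># M}. (if L = N then \<one> else \<zero>) \<otimes> q (M - L))
    = (if N \<subseteq># (M :: nat multiset) then q (M - N) else \<zero>)"
proof -
  have "(\<Oplus>L\<in>{L. L \<subseteq># M}. (if L = N then \<one> else \<zero>) \<otimes> q (M - L))
      = (\<Oplus>L\<in>{L. L \<subseteq># M}. if N = L then q (M - L) else \<zero>)"
    using assms by (intro finsum_cong') auto
  also have "\<dots> = (if N \<subseteq># M then q (M - N) else \<zero>)"
  proof (cases "N \<subseteq># M")
    case True
    then show ?thesis using assms finite_submultisets[of M]
      by (simp add: add.finprod_singleton[of N "{L. L \<subseteq># M}" "\<lambda>L. q (M - L)"])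
  next
    case False
    then have "(\<Oplus>L\<in>{L. L \<subseteq># M}. if N = L then q (M - L) else \<zero>) = (\<Oplus>L\<in>{L. L \<subseteq># M}. \<zero>)"
      by (intro finsum_cong') auto
    then show ?thesis using False by simp
  qed
  finally show ?thesis .
qed

end

lemma power_series_algebra:
  assumes "field K"
  shows "algebra K (power_series_algebra K)"
proof -
  interpret K: field K by (rule assms)
  let ?P = "power_series_algebra K"
  note S = power_series_simps
  have mult_closed: "p \<otimes>\<^bsub>?P\<^esub> q \<in> carrier ?P" if "p \<in> carrier ?P" "q \<in> carrier ?P" for p q
    using that unfolding S by (auto intro!: K.finsum_closed)
  have comm: "p \<otimes>\<^bsub>?P\<^esub> q = q \<otimes>\<^bsub>?P\<^esub> p" if "p \<in> carrier ?P" "q \<in> carrier ?P" for p q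
  proof
    fix M
    show "(p \<otimes>\<^bsub>?P\<^esub> q) M = (q \<otimes>\<^bsub>?P\<^esub> p) M"
      using that unfolding S by (intro K.convolution_comm) auto
  qed
  have group: "abelian_group ?P"
  proof (rule abelian_groupI)
    fix p assume p: "p \<in> carrier ?P"
    then have "(\<lambda>M. \<ominus>\<^bsub>K\<^esub> p M) \<in> carrier ?P" by (simp add: S)
    moreover have "(\<lambda>M. \<ominus>\<^bsub>K\<^esub> p M) \<oplus>\<^bsub>?P\<^esub> p = \<zero>\<^bsub>?P\<^esub>"
      using p by (intro ext) (simp add: S K.l_neg)
    ultimately show "\<exists>q\<in>carrier ?P. q \<oplus>\<^bsub>?P\<^esub> p = \<zero>\<^bsub>?P\<^esub>" by blast
  qed (auto simp: S fun_eq_iff K.a_ac)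
  have one: "\<one>\<^bsub>?P\<^esub> \<otimes>\<^bsub>?P\<^esub> p = p" if "p \<in> carrier ?P" for p
  proof
    fix M
    show "(\<one>\<^bsub>?P\<^esub> \<otimes>\<^bsub>?P\<^esub> p) M = p M"
      unfolding S using that K.convolution_delta[where q = p and N = "{#}" and M = M] by (simp add: S)
  qed
  have monoid: "Group.comm_monoid ?P"
  proof (rule comm_monoidI)
    fix p q r assume p: "p \<in> carrier ?P" and q: "q \<in> carrier ?P" and r: "r \<in> carrier ?P"
    show "p \<otimes>\<^bsub>?P\<^esub> q \<in> carrier ?P" by (rule mult_closed[OF p q])
    show "p \<otimes>\<^bsub>?P\<^esub> q = q \<otimes>\<^bsub>?P\<^esub> p" by (rule comm[OF p q])
    show "p \<otimes>\<^bsub>?P\<^esub> q \<otimes>\<^bsub>?P\<^esub> r = p \<otimes>\<^bsub>?P\<^esub> (q \<otimes>\<^bsub>?P\<^esub> r)"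
    proof
      fix M
      show "(p \<otimes>\<^bsub>?P\<^esub> q \<otimes>\<^bsub>?P\<^esub> r) M = (p \<otimes>\<^bsub>?P\<^esub> (q \<otimes>\<^bsub>?P\<^esub> r)) M"
        using p q r unfolding S by (intro K.convolution_assoc) auto
    qed
  qed (auto simp: S one)
  have cring: "cring ?P"
  proof (rule cringI[OF group monoid])
    fix p q r assume p: "p \<in> carrier ?P" and q: "q \<in> carrier ?P" and r: "r \<in> carrier ?P"
    show "(p \<oplus>\<^bsub>?P\<^esub> q) \<otimes>\<^bsub>?P\<^esub> r = p \<otimes>\<^bsub>?P\<^esub> r \<oplus>\<^bsub>?P\<^esub> q \<otimes>\<^bsub>?P\<^esub> r"
    proof
      fix M
      have "((p \<oplus>\<^bsub>?P\<^esub> q) \<otimes>\<^bsub>?P\<^esub> r) M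
          = (\<Oplus>\<^bsub>K\<^esub>L\<in>{L. L \<subseteq># M}. p L \<otimes>\<^bsub>K\<^esub> r (M - L) \<oplus>\<^bsub>K\<^esub> q L \<otimes>\<^bsub>K\<^esub> r (M - L))"
        using p q r unfolding S by (intro K.finsum_cong') (auto simp: K.l_distr)
      also have "\<dots> = (p \<otimes>\<^bsub>?P\<^esub> r \<oplus>\<^bsub>?P\<^esub> q \<otimes>\<^bsub>?P\<^esub> r) M"
        using p q r unfolding S by (intro K.finsum_addf) auto
      finally show "((p \<oplus>\<^bsub>?P\<^esub> q) \<otimes>\<^bsub>?P\<^esub> r) M = (p \<otimes>\<^bsub>?P\<^esub> r \<oplus>\<^bsub>?P\<^esub> q \<otimes>\<^bsub>?P\<^esub> r) M" .
    qed
  qed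
  have smult: "(c \<odot>\<^bsub>?P\<^esub> p) \<otimes>\<^bsub>?P\<^esub> q = c \<odot>\<^bsub>?P\<^esub> (p \<otimes>\<^bsub>?P\<^esub> q)"
    if c: "c \<in> carrier K" and p: "p \<in> carrier ?P" and q: "q \<in> carrier ?P" for c p q
  proof
    fix M
    have "((c \<odot>\<^bsub>?P\<^esub> p) \<otimes>\<^bsub>?P\<^esub> q) M = (\<Oplus>\<^bsub>K\<^esub>L\<in>{L. L \<subseteq># M}. c \<otimes>\<^bsub>K\<^esub> (p L \<otimes>\<^bsub>K\<^esub> q (M - L)))"
      using c p q unfolding S by (intro K.finsum_cong') (auto simp: K.m_assoc)
    also have "\<dots> = (c \<odot>\<^bsub>?P\<^esub> (p \<otimes>\<^bsub>?P\<^esub> q)) M"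
      using c p q finite_submultisets[of M] unfolding S by (intro K.finsum_rdistr[symmetric]) auto
    finally show "((c \<odot>\<^bsub>?P\<^esub> p) \<otimes>\<^bsub>?P\<^esub> q) M = (c \<odot>\<^bsub>?P\<^esub> (p \<otimes>\<^bsub>?P\<^esub> q)) M" .
  qed
  show ?thesis
  proof (rule algebraI)
    show "cring K" by unfold_locales
    show "cring ?P" by (rule cring)
  qed (auto simp: smult, auto simp: S fun_eq_iff K.l_distr K.r_distr K.m_assoc)
qed

lemma subalgebra_generated_closed:
  assumes "unital_algebra K A" "S \<subseteq> carrier A" "x \<in> subalgebra_generated K A S"
  shows "x \<in> carrier A"
proof -
  interpret unital_algebra K A by (rule assms(1))
  from assms(3) show ?thesis by (induction rule: subalgebra_generated.induct) (use assms(2) in auto)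
qed

text \<open>
The subalgebra generated by \<open>S\<close>, with each element \<open>x\<close> replaced by the coset \<open>{x}\<close>: a quotient by the zero ideal.
\<close>

definition generated_singletons :: "'k ring \<Rightarrow> ('k, 'a) module \<Rightarrow> 'a set \<Rightarrow> ('k, 'a set) module" where
  "generated_singletons K A S =
    \<lparr>carrier = (\<lambda>x. {x}) ` subalgebra_generated K A S,
     monoid.mult = (\<lambda>X Y. {the_elem X \<otimes>\<^bsub>A\<^esub> the_elem Y}),
     one = {\<one>\<^bsub>A\<^esub>},
     zero = {\<zero>\<^bsub>A\<^esub>},
     add = (\<lambda>X Y. {the_elem X \<oplus>\<^bsub>A\<^esub> the_elem Y}),
     module.smult = (\<lambda>c X. {c \<odot>\<^bsub>A\<^esub> the_elem X})\<rparr>"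

lemma generated_singletons:
  assumes K: "field K" and A: "algebra K A" and S: "S \<subseteq> carrier A"
  shows "algebra K (generated_singletons K A S)" (is "algebra K ?D")
    and "subalgebra_generated K (generated_singletons K A S) ((\<lambda>x. {x}) ` S)
           = carrier (generated_singletons K A S)"
    and "the_elem \<in> Ring.ring_hom (generated_singletons K A S) A"
    and "inj_on the_elem (carrier (generated_singletons K A S))"
proof -
  interpret K: field K by (rule K)
  interpret A: cring A by (rule algebra.M_cring[OF A])
  interpret algebra K A by (rule A)
  let ?G = "subalgebra_generated K A S"
  have UA: "unital_algebra K A" using algebra_iff_commutative_unital_algebra[OF K] A by blast
  have G: "x \<in> carrier A" if "x \<in> ?G" for x using subalgebra_generated_closed[OF UA S that] .
  note gen = subalgebra_generated.intros[where K = K and A = A and S = S]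
  have zero: "\<zero>\<^bsub>A\<^esub> \<in> ?G"
  proof -
    have "\<zero>\<^bsub>K\<^esub> \<odot>\<^bsub>A\<^esub> \<one>\<^bsub>A\<^esub> \<in> ?G"
      by (intro subalgebra_generated.smult subalgebra_generated.one K.zero_closed)
    then show ?thesis by simp
  qed
  have D: "carrier ?D = (\<lambda>x. {x}) ` ?G" "\<one>\<^bsub>?D\<^esub> = {\<one>\<^bsub>A\<^esub>}" "\<zero>\<^bsub>?D\<^esub> = {\<zero>\<^bsub>A\<^esub>}"
    "{x} \<otimes>\<^bsub>?D\<^esub> {y} = {x \<otimes>\<^bsub>A\<^esub> y}" "{x} \<oplus>\<^bsub>?D\<^esub> {y} = {x \<oplus>\<^bsub>A\<^esub> y}" "c \<odot>\<^bsub>?D\<^esub> {x} = {c \<odot>\<^bsub>A\<^esub> x}" for x y c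
    by (simp_all add: generated_singletons_def)
  have group: "abelian_group ?D"
  proof (rule abelian_groupI)
    fix X assume "X \<in> carrier ?D"
    then obtain x where x: "X = {x}" "x \<in> ?G" by (auto simp: D)
    have "{(\<ominus>\<^bsub>K\<^esub> \<one>\<^bsub>K\<^esub>) \<odot>\<^bsub>A\<^esub> x} \<in> carrier ?D"
      unfolding D using x(2) by (intro imageI subalgebra_generated.smult) simp_all
    moreover have "{(\<ominus>\<^bsub>K\<^esub> \<one>\<^bsub>K\<^esub>) \<odot>\<^bsub>A\<^esub> x} \<oplus>\<^bsub>?D\<^esub> X = \<zero>\<^bsub>?D\<^esub>"
      using G[OF x(2)] by (simp add: x(1) D smult_l_minus A.l_neg)
    ultimately show "\<exists>Y\<in>carrier ?D. Y \<oplus>\<^bsub>?D\<^esub> X = \<zero>\<^bsub>?D\<^esub>" by blast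
  qed (auto simp: D zero A.a_ac G intro: gen)
  have monoid: "Group.comm_monoid ?D"
    by (rule comm_monoidI) (auto simp: D A.m_ac G intro: gen)
  have cring: "cring ?D"
    by (rule cringI[OF group monoid]) (auto simp: D A.l_distr G)
  show "algebra K ?D"
  proof (rule algebraI)
    show "cring K" by unfold_locales
    show "cring ?D" by (rule cring)
  qed (auto simp: D smult_l_distr smult_r_distr smult_assoc1 smult_assoc2 G intro: gen)
  show "the_elem \<in> Ring.ring_hom ?D A" by (auto simp: Ring.ring_hom_def D G)
  show "inj_on the_elem (carrier ?D)" by (auto simp: inj_on_def D)
  show "subalgebra_generated K ?D ((\<lambda>x. {x}) ` S) = carrier ?D"
  proof
    have "unital_algebra K ?D"
      using algebra_iff_commutative_unital_algebra[OF K] \<open>algebra K ?D\<close> by blast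
    then show "subalgebra_generated K ?D ((\<lambda>x. {x}) ` S) \<subseteq> carrier ?D"
      using subalgebra_generated_closed[of K ?D "(\<lambda>x. {x}) ` S"] gen by (auto simp: D)
    have "{x} \<in> subalgebra_generated K ?D ((\<lambda>x. {x}) ` S)" if "x \<in> ?G" for x
      using that
    proof (induction rule: subalgebra_generated.induct)
      case one
      have "\<one>\<^bsub>?D\<^esub> \<in> subalgebra_generated K ?D ((\<lambda>x. {x}) ` S)" by (rule subalgebra_generated.one)
      then show ?case by (simp add: D)
    next
      case (incl x)
      then show ?case by (intro subalgebra_generated.incl) simp
    next
      case (add x y)
      then have "{x} \<oplus>\<^bsub>?D\<^esub> {y} \<in> subalgebra_generated K ?D ((\<lambda>x. {x}) ` S)"
        by (intro subalgebra_generated.add)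
      then show ?case by (simp add: D)
    next
      case (mult x y)
      then have "{x} \<otimes>\<^bsub>?D\<^esub> {y} \<in> subalgebra_generated K ?D ((\<lambda>x. {x}) ` S)"
        by (intro subalgebra_generated.mult)
      then show ?case by (simp add: D)
    next
      case (smult c x)
      then have "c \<odot>\<^bsub>?D\<^esub> {x} \<in> subalgebra_generated K ?D ((\<lambda>x. {x}) ` S)"
        by (intro subalgebra_generated.smult)
      then show ?case by (simp add: D)
    qed
    then show "carrier ?D \<subseteq> subalgebra_generated K ?D ((\<lambda>x. {x}) ` S)" by (auto simp: D)
  qed
qed

section \<open>Growth of polynomial algebras and the theorem\<close>

context
  fixes K :: "'k ring"
  assumes K: "field K"
begin

interpretation K: field K by (rule K)

private abbreviation "P \<equiv> power_series_algebra K"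

lemma power_series_unital: "unital_algebra K P"
  using algebra_iff_commutative_unital_algebra[OF K] power_series_algebra[OF K] by blast

interpretation P: unital_algebra K P by (rule power_series_unital)

definition monom_series :: "nat multiset \<Rightarrow> nat multiset \<Rightarrow> 'k" where
  "monom_series N = (\<lambda>M. if M = N then \<one>\<^bsub>K\<^esub> else \<zero>\<^bsub>K\<^esub>)"

lemma monom_series_closed: "monom_series N \<in> carrier P"
  by (simp add: power_series_simps monom_series_def)

lemma monom_series_mult: "monom_series N \<otimes>\<^bsub>P\<^esub> monom_series N' = monom_series (N + N')"
proof
  fix M
  have "(monom_series N \<otimes>\<^bsub>P\<^esub> monom_series N') M
      = (if N \<subseteq># M then monom_series N' (M - N) else \<zero>\<^bsub>K\<^esub>)"
    unfolding power_series_simps monom_series_def[of N]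
    by (rule K.convolution_delta) (simp add: monom_series_def)
  also have "\<dots> = monom_series (N + N') M" by (auto simp: monom_series_def)
  finally show "(monom_series N \<otimes>\<^bsub>P\<^esub> monom_series N') M = monom_series (N + N') M" .
qed

lemma list_prod_variables:
  "list_prod P (map (\<lambda>i. monom_series {#i#}) is) = monom_series (mset is)"
proof (induction "is")
  case Nil
  show ?case by (rule ext) (simp add: power_series_simps monom_series_def)
next
  case (Cons i "is")
  then show ?case by (simp add: monom_series_mult)
qed

lemma word_products_variables:
  "word_products P ((\<lambda>i. monom_series {#i#}) ` H) n = monom_series ` monomials H n"
proof
  show "word_products P ((\<lambda>i. monom_series {#i#}) ` H) n \<subseteq> monom_series ` monomials H n"
  proof
    fix x assume "x \<in> word_products P ((\<lambda>i. monom_series {#i#}) ` H) n"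
    then obtain ws where ws: "set ws \<subseteq> (\<lambda>i. monom_series {#i#}) ` H" "length ws \<le> n" "x = list_prod P ws"
      unfolding word_products_eq by blast
    then have "ws \<in> lists ((\<lambda>i. monom_series {#i#}) ` H)" by auto
    then obtain vs where "set vs \<subseteq> H" "ws = map (\<lambda>i. monom_series {#i#}) vs" by (auto simp: lists_image)
    then show "x \<in> monom_series ` monomials H n"
      using ws(2,3) by (auto simp: list_prod_variables monomials_def)
  qed
  show "monom_series ` monomials H n \<subseteq> word_products P ((\<lambda>i. monom_series {#i#}) ` H) n"
  proof
    fix x assume "x \<in> monom_series ` monomials H n"
    then obtain M where M: "M \<in> monomials H n" "x = monom_series M" by blast
    obtain vs where vs: "mset vs = M" using ex_mset by blast
    have "x = list_prod P (map (\<lambda>i. monom_series {#i#}) vs)" by (simp add: list_prod_variables vs M(2))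
    then show "x \<in> word_products P ((\<lambda>i. monom_series {#i#}) ` H) n"
      unfolding word_products_eq using M(1) vs
      by (intro image_eqI[of _ _ "map (\<lambda>i. monom_series {#i#}) vs"]) (auto simp: monomials_def)
  qed
qed

lemma finsum_power_series:
  assumes "finite I" "\<And>i. i \<in> I \<Longrightarrow> f i \<in> carrier P"
  shows "(\<Oplus>\<^bsub>P\<^esub>i\<in>I. f i) M = (\<Oplus>\<^bsub>K\<^esub>i\<in>I. f i M)"
  using assms
proof (induction I rule: finite_induct)
  case (insert i I)
  have "(\<Oplus>\<^bsub>P\<^esub>j\<in>insert i I. f j) = f i \<oplus>\<^bsub>P\<^esub> (\<Oplus>\<^bsub>P\<^esub>j\<in>I. f j)"
    using insert by (intro P.M.finsum_insert) auto
  moreover have "(\<Oplus>\<^bsub>K\<^esub>j\<in>insert i I. f j M) = f i M \<oplus>\<^bsub>K\<^esub> (\<Oplus>\<^bsub>K\<^esub>j\<in>I. f j M)"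
    using insert by (intro K.finsum_insert) (auto simp: power_series_simps(1))
  ultimately show ?case using insert by (simp add: power_series_simps)
qed (simp add: power_series_simps)

lemma inj_monom_series: "inj monom_series"
proof (rule injI)
  fix M N assume "monom_series M = monom_series N"
  then have "monom_series M M = monom_series N M" by simp
  then show "M = N" by (simp add: monom_series_def split: if_splits)
qed

lemma monom_series_lin_indpt:
  assumes "finite S"
  shows "\<not> LinearCombinations.module.lin_dep K P (monom_series ` S)"
proof (rule P.finite_lin_indpt2)
  show "finite (monom_series ` S)" using assms by simp
  show "monom_series ` S \<subseteq> carrier P" using monom_series_closed by blast
  fix a assume a: "a \<in> monom_series ` S \<rightarrow> carrier K" "P.lincomb a (monom_series ` S) = \<zero>\<^bsub>P\<^esub>"
  show "\<forall>v\<in>monom_series ` S. a v = \<zero>\<^bsub>K\<^esub>"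
  proof
    fix v assume "v \<in> monom_series ` S"
    then obtain N where N: "N \<in> S" "v = monom_series N" by blast
    have vc: "w \<in> carrier P" "a w \<in> carrier K" if "w \<in> monom_series ` S" for w
      using that a(1) monom_series_closed by auto
    have "\<zero>\<^bsub>K\<^esub> = P.lincomb a (monom_series ` S) N" using a(2) by (simp add: power_series_simps)
    also have "\<dots> = (\<Oplus>\<^bsub>K\<^esub>w\<in>monom_series ` S. (a w \<odot>\<^bsub>P\<^esub> w) N)"
      unfolding P.lincomb_def using assms vc by (intro finsum_power_series) auto
    also have "\<dots> = (\<Oplus>\<^bsub>K\<^esub>w\<in>monom_series ` S. if v = w then a w else \<zero>\<^bsub>K\<^esub>)"
    proof (intro K.finsum_cong')
      fix w assume w: "w \<in> monom_series ` S"
      then obtain L where L: "w = monom_series L" by blast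
      have "v = w \<longleftrightarrow> N = L" using N L inj_monom_series by (auto dest: injD)
      then show "(a w \<odot>\<^bsub>P\<^esub> w) N = (if v = w then a w else \<zero>\<^bsub>K\<^esub>)"
        using vc[OF w] L by (simp add: power_series_simps monom_series_def)
    qed (use vc in auto)
    also have "\<dots> = a v"
      using assms vc N by (intro K.add.finprod_singleton) auto
    finally show "a v = \<zero>\<^bsub>K\<^esub>" ..
  qed
qed

lemma growth_variables:
  assumes "finite H"
  shows "growth K P ((\<lambda>i. monom_series {#i#}) ` H) n = card (monomials H n)"
proof -
  let ?X = "monom_series ` monomials H n"
  have X: "finite ?X" "?X \<subseteq> carrier P" using finite_monomials[OF assms] monom_series_closed by auto
  have card: "card ?X = card (monomials H n)"
    using inj_monom_series by (intro card_image) (rule inj_on_subset[OF _ subset_UNIV])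
  have "?X \<subseteq> P.span ?X" by (rule P.in_own_span[OF X(2)])
  then have "card ?X \<le> vectorspace.dim K (P.vs (P.span ?X))"
    "vectorspace.dim K (P.vs (P.span ?X)) \<le> card ?X"
    using X monom_series_lin_indpt[OF finite_monomials[OF assms]]
    by (intro P.lin_indpt_card_le_dim P.dim_span_le_card; simp)+
  then show ?thesis unfolding P.growth_eq word_products_variables card by simp
qed

text \<open>
The polynomial algebra in \<open>m\<close> variables. The products of at most \<open>n\<close> variables are the monomials of degree at most
\<open>n\<close>, which are linearly independent.
\<close>

lemma exists_commutative_algebra_of_degree:
  "\<exists>D :: ('k, 'k poly_coset) module. algebra K D \<and> growth_degree K D m \<and> \<one>\<^bsub>D\<^esub> \<noteq> \<zero>\<^bsub>D\<^esub>"
proof -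
  let ?H = "{..<m}"
  let ?X = "(\<lambda>i. monom_series {#i#}) ` ?H"
  let ?D = "generated_singletons K P ?X"
  let ?S = "(\<lambda>x. {x}) ` ?X"
  have Xc: "?X \<subseteq> carrier P" using monom_series_closed by blast
  note D = generated_singletons[OF K power_series_algebra[OF K] Xc]
  have UD: "unital_algebra K ?D" using algebra_iff_commutative_unital_algebra[OF K] D(1) by blast
  have Sc: "?S \<subseteq> carrier ?D" by (auto simp: generated_singletons_def intro: subalgebra_generated.incl)
  have "growth K ?D ?S n = card (monomials ?H n)" for n
  proof -
    have "growth K P (the_elem ` ?S) n = growth K ?D ?S n"
    proof (rule growth_image[OF UD power_series_unital D(3,4) _ _ Sc])
      show "the_elem (c \<odot>\<^bsub>?D\<^esub> X) = c \<odot>\<^bsub>P\<^esub> the_elem X" for c X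
        by (simp add: generated_singletons_def)
    qed simp
    moreover have "the_elem ` ?S = ?X" by (simp add: image_image)
    ultimately show ?thesis using growth_variables[of ?H n] by simp
  qed
  moreover have "real n ^ m \<le> real m ^ m * real (card (monomials ?H n))" for n
    using card_monomials_ge[of ?H n] by simp
  moreover have "card (monomials ?H n) \<le> (2 * n) ^ m" if "1 \<le> n" for n
  proof -
    let ?Y = "{M. set_mset M \<subseteq> ?H \<and> (\<forall>i\<in>?H. count M i \<le> n) \<and> (\<forall>i\<in>?H - ?H. count M i \<le> 0)}"
    have "?Y \<subseteq> monomials ?H (m * n)"
    proof
      fix M assume M: "M \<in> ?Y"
      have "size M = sum (count M) (set_mset M)" by (simp add: size_multiset_overloaded_eq)
      also have "\<dots> \<le> sum (count M) ?H" using M by (intro sum_mono2) auto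
      also have "\<dots> \<le> (\<Sum>i\<in>?H. n)" using M by (intro sum_mono) auto
      finally show "M \<in> monomials ?H (m * n)" using M by (simp add: monomials_def)
    qed
    then have finY: "finite ?Y" using finite_monomials[of ?H "m * n"] finite_subset by blast
    have "monomials ?H n \<subseteq> ?Y" by (auto simp: monomials_def intro: order.trans[OF count_le_size])
    then have "card (monomials ?H n) \<le> card ?Y" using finY by (intro card_mono)
    also have "\<dots> \<le> Suc n ^ card ?H * Suc 0 ^ card (?H - ?H)"
      by (rule card_bounded_counts_le) auto
    also have "\<dots> = Suc n ^ m" by simp
    also have "\<dots> \<le> (2 * n) ^ m" using that by (intro power_mono) auto
    finally show ?thesis .
  qed
  ultimately have bounds: "\<forall>n\<ge>1. inverse (real m ^ m) * real n ^ m \<le> real (growth K ?D ?S n)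
      \<and> real (growth K ?D ?S n) \<le> 2 ^ m * real n ^ m"
  proof -
    assume g: "\<And>n. growth K ?D ?S n = card (monomials ?H n)"
      and lo: "\<And>n. real n ^ m \<le> real m ^ m * real (card (monomials ?H n))"
      and up: "\<And>n. 1 \<le> n \<Longrightarrow> card (monomials ?H n) \<le> (2 * n) ^ m"
    have "0 < real m ^ m" by (cases "m = 0") auto
    then have "inverse (real m ^ m) * real n ^ m \<le> real (growth K ?D ?S n)" for n
      using lo[of n] g[of n] by (simp add: field_simps)
    moreover have "real (growth K ?D ?S n) \<le> 2 ^ m * real n ^ m" if "1 \<le> n" for n
    proof -
      have "real (growth K ?D ?S n) \<le> real ((2 * n) ^ m)" unfolding g of_nat_le_iff by (rule up[OF that])
      then show ?thesis by (simp add: power_mult_distrib)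
    qed
    ultimately show ?thesis by blast
  qed
  have "0 < inverse (real m ^ m)" by (cases "m = 0") auto
  then have "growth_degree K ?D m"
    unfolding growth_degree_def using Sc D(2) bounds
    by (intro exI[of _ ?S] exI[of _ "inverse (real m ^ m)"] exI[of _ "2 ^ m"] conjI) (simp, assumption+)
  moreover have "\<one>\<^bsub>?D\<^esub> \<noteq> \<zero>\<^bsub>?D\<^esub>"
  proof -
    have "\<one>\<^bsub>P\<^esub> {#} \<noteq> \<zero>\<^bsub>P\<^esub> {#}" by (simp add: power_series_simps)
    then have "\<one>\<^bsub>P\<^esub> \<noteq> \<zero>\<^bsub>P\<^esub>" by metis
    then show ?thesis by (simp add: generated_singletons_def)
  qed
  ultimately show ?thesis using D(1) by blast
qed

end

text \<open>
The representation embeds the algebra into matrices, which are finite over the scalar matrices.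
\<close>

theorem representable_growth_degree:
  fixes K :: "'k ring" and R :: "('k, 'a) module"
  assumes K: "field K" and R: "unital_algebra K R" and aff: "affine_algebra K R"
    and rep: "representable TYPE('c) K R" and nontrivial: "\<one>\<^bsub>R\<^esub> \<noteq> \<zero>\<^bsub>R\<^esub>"
  shows "\<exists>m. growth_degree K R m"
proof -
  interpret R: unital_algebra K R by (rule R)
  obtain C :: "('k, 'c) module" and d f where C: "algebra K C"
    and f: "f \<in> Ring.ring_hom R (mat_algebra C d)" "inj_on f (carrier R)"
    and smult: "\<forall>c\<in>carrier K. \<forall>x\<in>carrier R. f (c \<odot>\<^bsub>R\<^esub> x) = c \<odot>\<^bsub>mat_algebra C d\<^esub> f x"
    using rep unfolding representable_def by blast
  let ?A = "mat_algebra C d"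
  interpret A: finite_central_algebra K ?A "scalar_mat C d ` carrier C" "{mat_unit C d i j | i j. i < d \<and> j < d}"
    by (rule mat_finite_central_algebra[OF K C])
  have UA: "unital_algebra K ?A" by unfold_locales
  obtain S where S: "finite S" "S \<subseteq> carrier R" "subalgebra_generated K R S = carrier R"
    using aff unfolding affine_algebra_def by blast
  have fc: "f x \<in> carrier ?A" if "x \<in> carrier R" for x using f(1) that by (auto simp: Ring.ring_hom_def)
  have "f \<one>\<^bsub>R\<^esub> = \<one>\<^bsub>?A\<^esub>" using f(1) by (simp add: Ring.ring_hom_def)
  moreover have "f \<zero>\<^bsub>R\<^esub> = \<zero>\<^bsub>?A\<^esub>"
  proof -
    have "f \<zero>\<^bsub>R\<^esub> = f (\<zero>\<^bsub>K\<^esub> \<odot>\<^bsub>R\<^esub> \<zero>\<^bsub>R\<^esub>)" by simp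
    also have "\<dots> = \<zero>\<^bsub>K\<^esub> \<odot>\<^bsub>?A\<^esub> f \<zero>\<^bsub>R\<^esub>" using smult by (metis R.R.zero_closed R.M.zero_closed)
    also have "\<dots> = \<zero>\<^bsub>?A\<^esub>" using fc[of "\<zero>\<^bsub>R\<^esub>"] by simp
    finally show ?thesis .
  qed
  ultimately have "\<one>\<^bsub>?A\<^esub> \<noteq> \<zero>\<^bsub>?A\<^esub>"
    using nontrivial f(2) by (metis R.M.zero_closed R.alg.one_closed inj_onD)
  moreover have "finite (f ` S)" "f ` S \<subseteq> carrier ?A" using S fc by auto
  ultimately obtain m c1 c2 where b: "0 < c1" "\<forall>n\<ge>1. c1 * real n ^ m \<le> real (growth K ?A (f ` S) n)
      \<and> real (growth K ?A (f ` S) n) \<le> c2 * real n ^ m"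
    using A.growth_polynomial by meson
  moreover have "growth K ?A (f ` S) n = growth K R S n" for n
    by (rule growth_image[OF R UA f _ S(1,2)]) (use smult in blast)
  ultimately show ?thesis unfolding growth_degree_def using S by auto
qed

text \<open>
The zero algebra has no growth at all, whereas the growth functions of a nonzero algebra are at least 1; it is therefore growth
equivalent only to a zero algebra.
\<close>

lemma growth_trivial_algebra:
  assumes "unital_algebra K A" "\<one>\<^bsub>A\<^esub> = \<zero>\<^bsub>A\<^esub>" "finite S" "S \<subseteq> carrier A"
  shows "growth K A S n = 0"
proof -
  interpret unital_algebra K A by (rule assms(1))
  have "x = \<zero>\<^bsub>A\<^esub>" if "x \<in> carrier A" for x
    using alg.l_one[OF that] assms(2) that by simp
  then have "word_products A S n \<subseteq> {\<zero>\<^bsub>A\<^esub>}" using word_products_closed[OF assms(4)] by blast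
  also have "\<dots> \<subseteq> span {}" by (simp add: span_empty)
  finally show ?thesis
    unfolding growth_eq using dim_span_le_card[of "word_products A S n" "{}"] finite_word_products[OF assms(3), of A n]
    by simp
qed

definition zero_algebra :: "'b \<Rightarrow> ('k, 'b) module" where
  "zero_algebra x = \<lparr>carrier = {x}, monoid.mult = (\<lambda>_ _. x), one = x, zero = x,
     add = (\<lambda>_ _. x), module.smult = (\<lambda>_ _. x)\<rparr>"

lemma zero_algebra:
  assumes "field K"
  shows "algebra K (zero_algebra x)"
proof -
  interpret field K by (rule assms)
  have "cring (zero_algebra x)"
    by (intro cringI abelian_groupI comm_monoidI) (auto simp: zero_algebra_def)
  moreover have "cring K" by unfold_locales
  ultimately show ?thesis by (intro algebraI) (auto simp: zero_algebra_def)
qed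

theorem theorem2:
  fixes K :: "'k ring" and R :: "('k, 'a) module"
  assumes "field K"
    and "unital_algebra K R"
    and "affine_algebra K R"
    and "representable TYPE('c) K R"
  shows "(\<exists>D :: ('k, 'k poly_coset) module.
            algebra K D \<and> affine_algebra K D \<and> growth_equivalent K R D) \<and>
         (\<exists>m :: int. GKdim K R = ereal (real_of_int m))"
proof (cases "\<one>\<^bsub>R\<^esub> = \<zero>\<^bsub>R\<^esub>")
  case False
  obtain m where m: "growth_degree K R m"
    using representable_growth_degree[OF assms False] by blast
  obtain D :: "('k, 'k poly_coset) module" where
    D: "algebra K D" "growth_degree K D m" "\<one>\<^bsub>D\<^esub> \<noteq> \<zero>\<^bsub>D\<^esub>"
    using exists_commutative_algebra_of_degree[OF assms(1)] by blast
  have UD: "unital_algebra K D" using algebra_iff_commutative_unital_algebra[OF assms(1)] D(1) by blast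
  have "affine_algebra K D" using D(2) unfolding affine_algebra_def growth_degree_def by blast
  moreover have "growth_equivalent K R D" unfolding growth_equivalent_def
    using growth_le_of_degree[OF assms(2) m UD D(2,3)] growth_le_of_degree[OF UD D(2) assms(2) m False]
    by blast
  moreover have "GKdim K R = ereal (real_of_int (int m))"
    using GKdim_of_degree[OF assms(2) m False] by simp
  ultimately show ?thesis using D(1) by blast
next
  case True
  define D :: "('k, 'k poly_coset) module" where "D = zero_algebra {}"
  have D: "algebra K D" unfolding D_def by (rule zero_algebra[OF assms(1)])
  then have UD: "unital_algebra K D" using algebra_iff_commutative_unital_algebra[OF assms(1)] by blast
  have R0: "growth K R S n = 0" if "finite S" "S \<subseteq> carrier R" for S n
    by (rule growth_trivial_algebra[OF assms(2) True that])
  have D0: "growth K D S n = 0" if "finite S" "S \<subseteq> carrier D" for S n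
    by (rule growth_trivial_algebra[OF UD _ that]) (simp add: D_def zero_algebra_def)
  have "affine_algebra K D"
  proof -
    have "subalgebra_generated K D {} = carrier D"
    proof
      show "subalgebra_generated K D {} \<subseteq> carrier D"
        using subalgebra_generated_closed[OF UD, of "{}"] by blast
      show "carrier D \<subseteq> subalgebra_generated K D {}"
        using subalgebra_generated.one[of D K "{}"] by (simp add: D_def zero_algebra_def)
    qed
    then show ?thesis unfolding affine_algebra_def by (intro exI[of _ "{}"]) simp
  qed
  moreover have "growth_equivalent K R D"
    unfolding growth_equivalent_def growth_le_def using R0 D0
    by (auto intro!: exI[of _ "{}"])
  moreover have "GKdim K R = ereal (real_of_int 0)"
  proof -
    have "limsup (\<lambda>n. ereal (log (real n) (real (growth K R S n)))) = 0"
      if "S \<in> {S. finite S \<and> S \<subseteq> carrier R}" for S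
      using that R0[of S] by (simp add: log_def zero_ereal_def[symmetric] Limsup_const)
    then have "GKdim K R = (SUP S\<in>{S. finite S \<and> S \<subseteq> carrier R}. 0)"
      unfolding GKdim_def by (intro SUP_cong refl)
    also have "\<dots> = 0" by (intro cSUP_const) auto
    finally show ?thesis by (simp add: zero_ereal_def)
  qed
  ultimately show ?thesis using D by blast
qed

end
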